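(* Let $d\ge 2$, $p\in(d,\infty]$, $\frac1p+\frac1{p'}=1$, and let $Q\subset\mathbb{R}^d$ be a bounded star domain. Then $$E_n\left(W_p^\infty(Q)\right)=c(d,p)\left(\frac{\operatorname{meas} Q}{2^d}\right)^{\frac1d+\frac1{p'}}\cdot\frac{1+o(1)}{n^{1/d}},\qquad n\to\infty,$$ where $$c(d,p):=\frac1d\left\|\frac{1}{|\cdot|_\infty^{d-1}}-|\cdot|_\infty\right\|_{L_{p'}(\{x\in\mathbb{R}^d:\,|x|_\infty\le 1\})}.$$ Moreover, the informational sets $S(n)=\{x_1^*,\dots,x_{|S(n)|}^*\}$ together with the recovery methods $$\tilde\Phi_n(f(x_1^* ),\dots,f(x_{|S(n)|}^* ))=\sum_{k=1}^{|S(n)|}c_k^*f(x_k^* ),\qquad c_k^*:=\operatorname{meas}V_k,$$ are asymptotically optimal, i.e. $$\lim_{n\to\infty}\frac{E_n(W_p^\infty(Q))}{e\left(W_p^\infty(Q),\tilde\Phi_n,x_1^*,\dots,x_{|S(n)|}^*\right)}=1 .$$ (The sets $S(n)$ and $V_k$, for $n$ large enough, are those constructed in the context.)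
   Context: **Star domain.** A bounded (nonempty) open set $Q\subset\mathbb{R}^d$ is a star domain if there is a ball $B$ of positive radius such that for all $x\in Q$ and $y\in B$ the segment $xy$ is contained in $Q$. **Norms and measure.** For $x=(x^1,\dots,x^d)\in\mathbb{R}^d$, $|x|_q=(\sum_k|x^k|^q)^{1/q}$ for $1\le q<\infty$ and $|x|_\infty=\max_k|x^k|$. $\operatorname{meas}$ is Lebesgue measure; $|A|$ is the number of elements of a finite set $A$. **Function class.** $W^{1,p}(Q)$ is the Sobolev space of $f:Q\to\mathbb{R}$ such that $f$ and all its first-order distributional partial derivatives are in $L_p(Q)$. Set $W_p^\infty(Q):=\{f\in W^{1,p}(Q):\|\,|\nabla f|_1\,\|_{L_p(Q)}\le1\}$. For $p>d$ and $Q$ a bounded star domain each such $f$ has a continuous representative, which is always used for point values. **Optimal recovery.** For a class $X$ of continuous functions on $Q$, points $x_1,\dots,x_m\in Q$ and an arbitrary function (method of recovery) $\Phi:\mathbb{R}^m\to\mathbb{R}$, put $$e(X,\Phi,x_1,\dots,x_m)=\sup_{f\in X}\left|\int_Qf(x)\,dx-\Phi(f(x_1),\dots,f(x_m))\right|,$$ and $E_n(X)=\inf_{x_1,\dots,x_n\in Q}\inf_{\Phi:\mathbb{R}^n\to\mathbb{R}}e(X,\Phi,x_1,\dots,x_n)$. **Construction of $S(n)$ and $V_k$.** For $h>0$, the lattice generated by the $d$ vectors $2h\,e_i$ ($e_i$ the standard basis vectors) divides $\mathbb{R}^d$ into cubes of side $2h$ with vertices at lattice points. $A(h)$ is the set of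 those cubes contained in $Q$, $a(h)$ is the set of centers of cubes in $A(h)$, and $B(h)$ is the set of those cubes that have common internal points with $Q$. For $n\in\mathbb{N}$ set $h_n:=\frac12\left(\frac{\operatorname{meas}Q}{n}\right)^{1/d}$. For each cube $P\in B(3h_n)$ choose one point: the center of $P$ if it belongs to $a(h_n)$; otherwise an arbitrary point of $P\cap a(h_n)$ if this is nonempty; otherwise an arbitrary interior point of $Q\cap P$. $S_1(n)$ is the set of chosen points. $S_2(n)$ is an arbitrary subset of $a(h_n)\setminus S_1(n)$ with $n-|S_1(n)|$ elements (this number is positive for large $n$), or all of $a(h_n)\setminus S_1(n)$ if it has fewer than $n-|S_1(n)|$ elements. Set $S(n):=S_1(n)\cup S_2(n)=\{x_1^*,\dots,x_{|S(n)|}^*\}$; then $S(n)\subset Q$ and $|S(n)|\le n$ for large $n$. Let $P(3h_n;x_k^* )$ be the cube from $B(3h_n)$ containing $x_k^*$, and for $k=1,\dots,|S(n)|$ define $$V_k:=\{x\in Q\cap P(3h_n;x_k^* ):\ |x-x_k^*|_\infty<|x-x_s^*|_\infty\ \text{for all } s\ne k\}.$$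
   Formalization: The V_k may miss a positive-measure part of Q (then e = ∞, e.g. for a square), so the weights are instead c_k* = meas W_k, for any disjoint measurable W_k with V_k ⊂ W_k ⊂ Q∩P(3h_n;x_k* ) covering Q up to a null set; W_k = V_k whenever the V_k already do. *)

theory Defs
  imports "HOL-Analysis.Analysis" "HOL-Probability.Essential_Supremum"
begin

text \<open>
  The ambient space is \<open>real^'d\<close>, so the dimension is \<open>CARD('d)\<close>. The maximum norm is the
  library's \<^const>\<open>infnorm\<close>.
\<close>

definition star_domain :: "(real^'d) set \<Rightarrow> bool" where
  "star_domain Q \<longleftrightarrow> open Q \<and> bounded Q \<and> Q \<noteq> {} \<and>
     (\<exists>c r. 0 < r \<and> (\<forall>x\<in>Q. \<forall>y\<in>ball c r. closed_segment x y \<subseteq> Q))"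

subsection \<open>Lebesgue and Sobolev spaces\<close>

definition Lp_space :: "ereal \<Rightarrow> (real^'d) set \<Rightarrow> (real^'d \<Rightarrow> real) set" where
  "Lp_space p A = {g \<in> borel_measurable (lebesgue_on A).
     if p = \<infinity> then esssup (lebesgue_on A) (\<lambda>x. ereal \<bar>g x\<bar>) < \<infinity>
     else integrable (lebesgue_on A) (\<lambda>x. \<bar>g x\<bar> powr real_of_ereal p)}"

text \<open>The following is the norm only on \<^const>\<open>Lp_space\<close>; elsewhere its value is meaningless.\<close>

definition Lp_norm :: "ereal \<Rightarrow> (real^'d) set \<Rightarrow> (real^'d \<Rightarrow> real) \<Rightarrow> real" where
  "Lp_norm p A g =
     (if p = \<infinity> then real_of_ereal (esssup (lebesgue_on A) (\<lambda>x. ereal \<bar>g x\<bar>))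
      else (LINT x|lebesgue_on A. \<bar>g x\<bar> powr real_of_ereal p) powr (1 / real_of_ereal p))"

definition partial_deriv :: "'d \<Rightarrow> (real^'d \<Rightarrow> real) \<Rightarrow> real^'d \<Rightarrow> real" where
  "partial_deriv i f x = frechet_derivative f (at x) (axis i 1)"

primrec iterated_partial :: "'d list \<Rightarrow> (real^'d \<Rightarrow> real) \<Rightarrow> real^'d \<Rightarrow> real" where
  "iterated_partial [] f = f"
| "iterated_partial (i # is) f = partial_deriv i (iterated_partial is f)"

text \<open>
  Being \<open>C\<^sup>\<infinity>\<close>: all iterated partial derivatives are differentiable everywhere (and hence
  continuous).
\<close>

definition smooth :: "(real^'d \<Rightarrow> real) \<Rightarrow> bool" where
  "smooth f \<longleftrightarrow> (\<forall>is x. iterated_partial is f differentiable (at x))"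

definition test_function :: "(real^'d) set \<Rightarrow> (real^'d \<Rightarrow> real) \<Rightarrow> bool" where
  "test_function Q \<phi> \<longleftrightarrow> smooth \<phi> \<and>
     compact (closure {x. \<phi> x \<noteq> 0}) \<and> closure {x. \<phi> x \<noteq> 0} \<subseteq> Q"

text \<open>
  Used only for \<open>f\<close> and \<open>g\<close> in some \<open>L\<^sub>p(Q)\<close> with \<open>p \<ge> 1\<close>, so that both integrals exist.
\<close>

definition weak_partial ::
    "(real^'d) set \<Rightarrow> 'd \<Rightarrow> (real^'d \<Rightarrow> real) \<Rightarrow> (real^'d \<Rightarrow> real) \<Rightarrow> bool" where
  "weak_partial Q i f g \<longleftrightarrow>
     (\<forall>\<phi>. test_function Q \<phi> \<longrightarrow>
        (LINT x|lebesgue_on Q. f x * partial_deriv i \<phi> x) = - (LINT x|lebesgue_on Q. g x * \<phi> x))"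

definition sobolev_gradient ::
    "ereal \<Rightarrow> (real^'d) set \<Rightarrow> (real^'d \<Rightarrow> real) \<Rightarrow> (real^'d \<Rightarrow> real^'d) \<Rightarrow> bool" where
  "sobolev_gradient p Q f G \<longleftrightarrow>
     (\<forall>i. (\<lambda>x. G x $ i) \<in> Lp_space p Q \<and> weak_partial Q i f (\<lambda>x. G x $ i))"

definition sobolev_space :: "ereal \<Rightarrow> (real^'d) set \<Rightarrow> (real^'d \<Rightarrow> real) set" where
  "sobolev_space p Q = {f \<in> Lp_space p Q. \<exists>G. sobolev_gradient p Q f G}"

text \<open>
  The class \<open>W\<^sub>p\<^sup>\<infinity>(Q)\<close>, consisting of the continuous representatives. The gradient is unique
  almost everywhere, so its existential quantification is harmless. Values of \<open>f\<close> outside \<open>Q\<close>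
  are irrelevant.
\<close>

definition sobolev_class :: "ereal \<Rightarrow> (real^'d) set \<Rightarrow> (real^'d \<Rightarrow> real) set" where
  "sobolev_class p Q = {f \<in> sobolev_space p Q. continuous_on Q f \<and>
     (\<exists>G. sobolev_gradient p Q f G \<and> Lp_norm p Q (\<lambda>x. \<Sum>i\<in>UNIV. \<bar>G x $ i\<bar>) \<le> 1)}"

subsection \<open>Optimal recovery of the integral\<close>

text \<open>
  A tuple of \<open>m\<close> points is a list of length \<open>m\<close>, and a method of recovery is a function on
  lists, of which only the values on lists of length \<open>m\<close> matter. Errors are extended reals because
  the supremum may be infinite.
\<close>

definition recovery_error ::
    "(real^'d) set \<Rightarrow> (real^'d \<Rightarrow> real) set \<Rightarrow> (real list \<Rightarrow> real) \<Rightarrow> (real^'d) list \<Rightarrow> ereal" where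
  "recovery_error Q X \<Phi> xs =
     (SUP f\<in>X. ereal \<bar>(LINT x|lebesgue_on Q. f x) - \<Phi> (map f xs)\<bar>)"

definition optimal_error :: "(real^'d) set \<Rightarrow> (real^'d \<Rightarrow> real) set \<Rightarrow> nat \<Rightarrow> ereal" where
  "optimal_error Q X n =
     (INF xs\<in>{xs. length xs = n \<and> set xs \<subseteq> Q}. INF \<Phi>. recovery_error Q X \<Phi> xs)"

subsection \<open>The informational sets\<close>

text \<open>
  A cube of the grid of side \<open>2h\<close> is represented by the integer vector \<open>z\<close> for which \<open>2hz\<close> is its
  lowest vertex. Cubes are closed.
\<close>

definition cube :: "real \<Rightarrow> int^'d \<Rightarrow> (real^'d) set" where
  "cube h z = cbox (\<chi> i. 2 * h * of_int (z $ i)) (\<chi> i. 2 * h * (of_int (z $ i) + 1))"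

definition cube_center :: "real \<Rightarrow> int^'d \<Rightarrow> real^'d" where
  "cube_center h z = (\<chi> i. 2 * h * of_int (z $ i) + h)"

definition inner_cubes :: "(real^'d) set \<Rightarrow> real \<Rightarrow> (int^'d) set" where
  "inner_cubes Q h = {z. cube h z \<subseteq> Q}"

definition inner_centers :: "(real^'d) set \<Rightarrow> real \<Rightarrow> (real^'d) set" where
  "inner_centers Q h = cube_center h ` inner_cubes Q h"

definition meeting_cubes :: "(real^'d) set \<Rightarrow> real \<Rightarrow> (int^'d) set" where
  "meeting_cubes Q h = {z. interior (Q \<inter> cube h z) \<noteq> {}}"

definition half_step :: "(real^'d) set \<Rightarrow> nat \<Rightarrow> real" where
  "half_step Q n = 1 / 2 * (measure lebesgue Q / real n) powr (1 / real CARD('d))"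

text \<open>
  \<open>is_S1 Q n S\<close> and \<open>is_S Q n S\<close> say that \<open>S\<close> is a possible outcome of the construction of
  \<open>S\<^sub>1(n)\<close> and of \<open>S(n)\<close>, respectively; the construction involves arbitrary choices.
\<close>

definition is_S1 :: "(real^'d) set \<Rightarrow> nat \<Rightarrow> (real^'d) set \<Rightarrow> bool" where
  "is_S1 Q n S \<longleftrightarrow>
     (let h = half_step Q n; a = inner_centers Q h; B = meeting_cubes Q (3 * h) in
      \<exists>\<sigma>. S = \<sigma> ` B \<and>
        (\<forall>z\<in>B.
          if cube_center (3 * h) z \<in> a then \<sigma> z = cube_center (3 * h) z
          else if cube (3 * h) z \<inter> a \<noteq> {} then \<sigma> z \<in> cube (3 * h) z \<inter> a
          else \<sigma> z \<in> interior (Q \<inter> cube (3 * h) z)))"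

text \<open>The subtraction below truncates only for small \<open>n\<close>.\<close>

definition is_S :: "(real^'d) set \<Rightarrow> nat \<Rightarrow> (real^'d) set \<Rightarrow> bool" where
  "is_S Q n S \<longleftrightarrow>
     (let a = inner_centers Q (half_step Q n) in
      \<exists>S1 S2. is_S1 Q n S1 \<and>
        (if card (a - S1) < n - card S1 then S2 = a - S1
         else S2 \<subseteq> a - S1 \<and> card S2 = n - card S1) \<and>
        S = S1 \<union> S2)"

subsection \<open>Voronoi cells and the recovery method\<close>

text \<open>
  The cube of side \<open>6h\<^sub>n\<close> containing a point of \<open>S(n)\<close> is unique, since the point is interior to
  it: by choice, or because the coordinates of points of \<open>a(h\<^sub>n)\<close> are odd multiples of \<open>h\<^sub>n\<close>.
\<close>

definition cube_of :: "(real^'d) set \<Rightarrow> nat \<Rightarrow> real^'d \<Rightarrow> (real^'d) set" where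
  "cube_of Q n y = cube (3 * half_step Q n)
     (THE z. z \<in> meeting_cubes Q (3 * half_step Q n) \<and> y \<in> cube (3 * half_step Q n) z)"

definition voronoi :: "(real^'d) set \<Rightarrow> nat \<Rightarrow> (real^'d) list \<Rightarrow> nat \<Rightarrow> (real^'d) set" where
  "voronoi Q n xs k = {x \<in> Q \<inter> cube_of Q n (xs ! k).
     \<forall>s<length xs. s \<noteq> k \<longrightarrow> infnorm (x - xs ! k) < infnorm (x - xs ! s)}"

text \<open>
  The open Voronoi cells need not exhaust \<open>Q\<close> up to a null set: bisectors of the maximum norm can
  have interior points, and the nearest node may lie in another cube. The weights of a method with
  finite error must add up to the measure of \<open>Q\<close>, as the class contains all constants. Therefore
  the left-over points of \<open>Q\<close> are distributed, arbitrarily, among the nodes in the same cube. If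
  the Voronoi cells do exhaust \<open>Q\<close> up to a null set, then \<open>W = voronoi Q n xs\<close> is allowed, and it
  is the only choice up to null sets.
\<close>

definition completed_voronoi ::
    "(real^'d) set \<Rightarrow> nat \<Rightarrow> (real^'d) list \<Rightarrow> (nat \<Rightarrow> (real^'d) set) \<Rightarrow> bool" where
  "completed_voronoi Q n xs W \<longleftrightarrow>
     (\<forall>k<length xs. W k \<in> sets lebesgue \<and>
        voronoi Q n xs k \<subseteq> W k \<and> W k \<subseteq> Q \<inter> cube_of Q n (xs ! k)) \<and>
     disjoint_family_on W {..<length xs} \<and>
     negligible (Q - (\<Union>k<length xs. W k))"

definition weighted_sum :: "(nat \<Rightarrow> (real^'d) set) \<Rightarrow> real list \<Rightarrow> real" where
  "weighted_sum W ys = (\<Sum>k<length ys. measure lebesgue (W k) * ys ! k)"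

end

theory Submission
  imports Defs
begin

text \<open>
  Let \<open>h\<close> be the half step, so that \<open>n (2h)\<^sup>d = meas Q\<close>, and let \<open>\<bar>\<cdot>\<bar>\<close> be the maximum norm. If \<open>T\<close>
  is star-shaped about \<open>x\<^sub>0\<close> and contained in the cube of radius \<open>R\<close> about \<open>x\<^sub>0\<close>, then integrating
  the gradient along the segments from \<open>x\<^sub>0\<close> gives
  \<open>\<integral>\<^sub>T \<bar>f x - f x\<^sub>0\<bar> dx \<le> \<integral>\<^sub>T k\<^sub>R(x - x\<^sub>0) \<bar>\<nabla>f\<bar>\<^sub>1 dx\<close> with \<open>k\<^sub>R(y) = (R\<^sup>d / \<bar>y\<bar>\<^sup>d\<^sup>-\<^sup>1 - \<bar>y\<bar>) / d\<close>.

  Upper bound. All but \<open>o(n)\<close> of the nodes are centres of cubes of radius \<open>h\<close> that coincide with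
  their Voronoi cells up to null sets; there the inequality is applied with \<open>R = h\<close>. The other nodes
  lie in \<open>o(n)\<close> cubes of radius \<open>3h\<close>, as the frontier of \<open>Q\<close> is a null set; there the same
  inequality on the convex hull of a point and a small ball (a Morrey estimate) bounds the
  oscillation of \<open>f\<close>. Instead of Hoelder's inequality, Young's inequality
  \<open>k \<bar>\<nabla>f\<bar>\<^sub>1 \<le> \<alpha> k\<^sup>q + \<beta> \<bar>\<nabla>f\<bar>\<^sub>1\<^sup>p\<close> is used, which is additive over cubes and covers \<open>p = \<infinity>\<close> with
  \<open>\<alpha> = 1\<close> and \<open>\<beta> = 0\<close>; in the end \<open>\<alpha>\<close> and \<open>\<beta>\<close> are optimised.

  Lower bound, for every \<open>n\<close>. Given nodes \<open>x\<^sub>k\<close>, let \<open>f = g(min\<^sub>k \<bar>x - x\<^sub>k\<bar>)\<close> with \<open>g 0 = 0\<close> and \<open>g'\<close>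
  proportional to a truncation of \<open>k\<^sub>h\<^sup>q\<^sup>-\<^sup>1\<close>. By a union bound over the nodes, the norm of the
  gradient is largest and the integral of \<open>f\<close> is smallest when the cubes of radius \<open>h\<close> about the
  nodes tile \<open>Q\<close>, and then Hoelder's inequality is an equality.
\<close>

subsection \<open>The radial kernel\<close>

text \<open>The condition p > d says (d - 1) q < d for the conjugate exponent q, and this is what
  puts the kernel, which grows like |y|^(1-d) at the origin, into L_q. As k_R is homogeneous of
  degree one in R and y together, n cubes of radius h contribute n h^(d+q) times the integral of
  k_1^q; the q-th root of this has order n^(-1/d), because n (2h)^d is constant.

  The frontier is the obstacle of the upper bound. The gradient of f may be concentrated on the o(n)
  cubes there, so their share of the integral of \<Gamma> need not be small; only their number is.
  Therefore \<alpha> and \<beta> are chosen twice for the same f: once optimal for n cubes, and once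
  optimal for \<theta> n cubes, which makes the error at the frontier of relative order
  \<theta>^(1/q).

  In the lower bound the union bound treats all positions of the nodes at once, even cubes that
  overlap or stick out of Q. The truncation is needed because k_h^(q-1) is unbounded at the origin
  if q > 1; cutting it off at a positive radius makes g continuously differentiable with bounded
  derivative.\<close>

definition icube :: "real^'d \<Rightarrow> real \<Rightarrow> (real^'d) set" where
  "icube c R = {y. infnorm (y - c) \<le> R}"

lemma infnorm_le_iff: "infnorm (x::real^'d) \<le> r \<longleftrightarrow> (\<forall>i. \<bar>x $ i\<bar> \<le> r)"
proof -
  have "infnorm x = Max ((\<lambda>i. \<bar>x \<bullet> i\<bar>) ` Basis)" by (rule infnorm_Max)
  then have "infnorm x \<le> r \<longleftrightarrow> (\<forall>i\<in>Basis. \<bar>x \<bullet> i\<bar> \<le> r)" by (simp add: finite_imageI)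
  then show ?thesis by (auto simp: Basis_vec_def inner_axis)
qed

lemma infnorm_less_iff: "infnorm (x::real^'d) < r \<longleftrightarrow> (\<forall>i. \<bar>x $ i\<bar> < r)"
proof -
  have "infnorm x = Max ((\<lambda>i. \<bar>x \<bullet> i\<bar>) ` Basis)" by (rule infnorm_Max)
  then have "infnorm x < r \<longleftrightarrow> (\<forall>i\<in>Basis. \<bar>x \<bullet> i\<bar> < r)" by (simp add: finite_imageI)
  then show ?thesis by (auto simp: Basis_vec_def inner_axis)
qed

lemma infnorm_attained: obtains i where "infnorm (x::real^'d) = \<bar>x $ i\<bar>"
proof -
  have "infnorm x = Max ((\<lambda>i. \<bar>x \<bullet> i\<bar>) ` Basis)" by (rule infnorm_Max)
  moreover have "Max ((\<lambda>i. \<bar>x \<bullet> i\<bar>) ` Basis) \<in> (\<lambda>i. \<bar>x \<bullet> i\<bar>) ` Basis"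
    by (rule Max_in) auto
  ultimately obtain b where "b \<in> Basis" "infnorm x = \<bar>x \<bullet> b\<bar>" by (metis imageE)
  then show ?thesis using that by (auto simp: Basis_vec_def inner_axis)
qed

lemma infnorm_measurable [measurable]: "(infnorm :: real^'d \<Rightarrow> real) \<in> borel_measurable borel"
  by (intro borel_measurable_continuous_onI continuous_on_infnorm continuous_on_id)

lemma infnorm_triangle_diff: "infnorm (x - z) \<le> infnorm (x - y) + infnorm (y - (z::real^'d))"
  using infnorm_triangle[of "x - y" "y - z"] by simp

lemma icube_eq_cbox: "icube (c::real^'d) R = cbox (c - (\<chi> i. R)) (c + (\<chi> i. R))"
  by (auto simp: icube_def infnorm_le_iff mem_box_cart abs_le_iff algebra_simps)

lemma icube_compact [simp]: "compact (icube c R)"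
  by (simp add: icube_eq_cbox)

lemma icube_closed [simp]: "closed (icube c R)"
  by (simp add: compact_imp_closed)

lemma icube_borel [measurable, simp]: "icube c R \<in> sets borel"
  by (simp add: icube_eq_cbox)

lemma content_cart: "(\<And>i. a $ i \<le> b $ i) \<Longrightarrow> measure lborel (cbox a (b::real^'d)) = (\<Prod>i\<in>UNIV. b $ i - a $ i)"
  by (subst content_cbox_cart) (auto simp: interval_ne_empty_cart)

lemma measure_icube: "0 \<le> R \<Longrightarrow> measure lborel (icube (c::real^'d) R) = (2*R) ^ CARD('d)"
  by (simp add: icube_eq_cbox content_cart)

lemma emeasure_icube: "0 \<le> R \<Longrightarrow> emeasure lborel (icube (c::real^'d) R) = ennreal ((2*R) ^ CARD('d))"
  using emeasure_eq_ennreal_measure[of lborel "icube c R"] emeasure_lborel_cbox_finite[of "c - (\<chi> i. R)" "c + (\<chi> i. R)"]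
  by (simp add: measure_icube less_top icube_eq_cbox[symmetric])

lemma nn_integral_translate:
  fixes F :: "real^'d \<Rightarrow> ennreal"
  assumes [measurable]: "F \<in> borel_measurable borel"
  shows "(\<integral>\<^sup>+x. F (t + x) \<partial>lborel) = (\<integral>\<^sup>+x. F x \<partial>lborel)"
proof -
  have "(\<integral>\<^sup>+x. F x \<partial>lborel) = (\<integral>\<^sup>+x. F x \<partial>distr lborel borel ((+) t))"
    by (simp only: lborel_distr_plus)
  also have "\<dots> = (\<integral>\<^sup>+x. F (t + x) \<partial>lborel)"
    by (subst nn_integral_distr) auto
  finally show ?thesis by simp
qed

lemma nn_integral_icube_translate:
  assumes [measurable]: "F \<in> borel_measurable borel"
  shows "(\<integral>\<^sup>+x\<in>icube (c::real^'d) R. F (x - c) \<partial>lborel) = (\<integral>\<^sup>+x\<in>icube 0 R. F x \<partial>lborel)"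
  by (subst nn_integral_translate[where t = c, symmetric]) (auto simp: icube_def indicator_def intro!: nn_integral_cong)

lemma nn_integral_scale:
  fixes F :: "real^'d \<Rightarrow> ennreal"
  assumes [measurable]: "F \<in> borel_measurable borel" and c: "c > 0"
  shows "(\<integral>\<^sup>+x. F x \<partial>lborel) = ennreal (c ^ CARD('d)) * (\<integral>\<^sup>+x. F (c *\<^sub>R x) \<partial>lborel)"
proof -
  have "(\<integral>\<^sup>+x. F x \<partial>lborel) = (\<integral>\<^sup>+x. F x \<partial>density (distr lborel borel (\<lambda>x. 0 + c *\<^sub>R x)) (\<lambda>_. ennreal (\<bar>c\<bar>^DIM(real^'d))))"
    using lborel_affine[where t = "0::real^'d" and c = c] c by simp
  also have "\<dots> = ennreal (c ^ CARD('d)) * (\<integral>\<^sup>+x. F (c *\<^sub>R x) \<partial>lborel)"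
    using c by (subst nn_integral_density, simp, simp, subst nn_integral_distr, simp, simp, subst nn_integral_cmult, auto)
  finally show ?thesis .
qed

text \<open>For d at least 2 the value at r = 0 is 0, because division by zero gives 0. Comparisons
  that need the true singularity are therefore made almost everywhere, off the origin.\<close>

definition rkern :: "nat \<Rightarrow> real \<Rightarrow> real \<Rightarrow> real" where
  "rkern d R r = (R ^ d / r ^ (d - 1) - r) / real d"

abbreviation kern :: "real \<Rightarrow> real^'d \<Rightarrow> real" where
  "kern R y \<equiv> rkern CARD('d) R (infnorm y)"

lemma rkern_measurable [measurable]: "rkern d R \<in> borel_measurable borel"
  unfolding rkern_def by measurable

lemma rkern_nonneg: "0 \<le> r \<Longrightarrow> r \<le> R \<Longrightarrow> 0 \<le> rkern d R r"
proof -
  assume r: "0 \<le> r" "r \<le> R"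
  show ?thesis
  proof (cases "r = 0 \<or> d = 0")
    case True then show ?thesis using r by (auto simp: rkern_def)
  next
    case False
    then have "r * r ^ (d - 1) \<le> R ^ d" using r
      by (metis power_mono power_minus_mult mult.commute neq0_conv)
    then have "r \<le> R ^ d / r ^ (d - 1)" using False r by (simp add: field_simps)
    then show ?thesis by (simp add: rkern_def)
  qed
qed

text \<open>Since \<open>ennreal\<close> sends negative numbers to 0, the kernel vanishes outside
  the cube of radius R in nonnegative integrals, so that the indicator of the cube can be added or
  dropped there.\<close>

lemma rkern_nonpos: "0 < d \<Longrightarrow> 0 < R \<Longrightarrow> R \<le> r \<Longrightarrow> rkern d R r \<le> 0"
proof -
  assume d: "0 < d" and r: "0 < R" "R \<le> r"
  then have "R ^ d \<le> r * r ^ (d - 1)"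
    by (metis power_mono power_minus_mult mult.commute less_imp_le)
  then have "R ^ d / r ^ (d - 1) \<le> r" using r by (simp add: field_simps)
  then show ?thesis by (simp add: rkern_def divide_le_0_iff)
qed

lemma rkern_scale: "0 < d \<Longrightarrow> 0 < R \<Longrightarrow> rkern d R (R * r) = R * rkern d 1 r"
proof -
  assume "0 < d" "0 < R"
  then have "R ^ d = R * R ^ (d - 1)" by (metis power_minus_mult mult.commute)
  then show ?thesis using \<open>0 < R\<close> by (simp add: rkern_def power_mult_distrib field_simps)
qed

lemma rkern_antimono: "0 < d \<Longrightarrow> 0 < R \<Longrightarrow> 0 < r \<Longrightarrow> r \<le> s \<Longrightarrow> rkern d R s \<le> rkern d R r"
  unfolding rkern_def
  by (intro divide_right_mono diff_mono divide_left_mono power_mono mult_pos_pos zero_less_power) auto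

text \<open>This is the inner integral of \<open>radial_kernel\<close>, with r = infnorm y: the
  condition r \<le> s R says that y / s lies in the cube of radius R. For r > R no s is left, which
  agrees with the nonpositive value of the kernel.\<close>

lemma nn_integral_inverse_power:
  fixes d :: nat and r R :: real
  assumes "0 < d" "0 < r" "0 < R"
  shows "(\<integral>\<^sup>+s. ennreal (r * s powr (- real d - 1)) * indicator {s. 0 < s \<and> s < 1 \<and> r \<le> s * R} s \<partial>lborel)
       = ennreal (rkern d R r)"
proof (cases "r \<le> R")
  case False
  then have "{s. 0 < s \<and> s < 1 \<and> r \<le> s * R} = {}"
    using assms by (auto simp: not_le) (smt (verit) mult_less_cancel_right1 mult_less_cancel_right2)
  then show ?thesis using rkern_nonpos[of d R r] False assms by (simp add: ennreal_neg)
next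
  case True
  let ?a = "r / R"
  have a: "0 < ?a" "?a \<le> 1" using assms True by auto
  have "(\<integral>\<^sup>+s. ennreal (r * s powr (- real d - 1)) * indicator {s. 0 < s \<and> s < 1 \<and> r \<le> s * R} s \<partial>lborel)
      = (\<integral>\<^sup>+s. ennreal (r * s powr (- real d - 1)) * indicator {?a..1} s \<partial>lborel)"
  proof (rule nn_integral_cong_AE)
    have "AE s in lborel. s \<noteq> (1::real)" by (rule AE_lborel_singleton)
    then show "AE s in lborel. ennreal (r * s powr (- real d - 1)) * indicator {s. 0 < s \<and> s < 1 \<and> r \<le> s * R} s
        = ennreal (r * s powr (- real d - 1)) * indicator {?a..1} s"
    proof eventually_elim
      case (elim s)
      then have "s \<in> {s. 0 < s \<and> s < 1 \<and> r \<le> s * R} \<longleftrightarrow> s \<in> {?a..1}"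
        using assms a by (auto simp: field_simps) (smt (verit) zero_less_mult_iff)
      then show ?case
        by (simp add: indicator_def)
    qed
  qed
  also have "\<dots> = ennreal ((- r / real d * 1 powr (- real d)) - (- r / real d * ?a powr (- real d)))"
  proof (rule nn_integral_FTC_Icc)
    show "(\<lambda>s. r * s powr (- real d - 1)) \<in> borel_measurable borel" by measurable
    fix x assume "x \<in> {?a..1}"
    then have "x > 0" using a by auto
    then show "((\<lambda>s. - r / real d * s powr (- real d)) has_real_derivative r * x powr (- real d - 1)) (at x)"
      using assms by (auto intro!: derivative_eq_intros)
  qed (use assms a in \<open>auto intro!: mult_nonneg_nonneg\<close>)
  also have "- r / real d * 1 powr (- real d) - (- r / real d * ?a powr (- real d)) = rkern d R r"
  proof -
    have "?a powr (- real d) = R ^ d / r ^ d"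
      using assms a by (simp add: powr_minus powr_realpow power_divide)
    moreover have "r * (R ^ d / r ^ d) = R ^ d / r ^ (d - 1)"
      using assms by (simp add: power_eq_if)
    moreover have "- r / real d * 1 powr (- real d) - (- r / real d * ?a powr (- real d))
        = (r * ?a powr (- real d) - r) / real d" by (simp add: diff_divide_distrib)
    ultimately show ?thesis by (simp add: rkern_def)
  qed
  finally show ?thesis .
qed

text \<open>
  Substituting \<open>y = s z\<close> for fixed \<open>s\<close> and integrating over \<open>s\<close> last avoids polar coordinates; the
  kernel is \<open>\<integral> \<bar>y\<bar> s\<^sup>-\<^sup>d\<^sup>-\<^sup>1 ds\<close> over \<open>\<bar>y\<bar> / R \<le> s \<le> 1\<close>.
\<close>

lemma radial_kernel:
  fixes F :: "real^'d \<Rightarrow> ennreal"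
  assumes F [measurable]: "F \<in> borel_measurable borel" and R: "0 < R"
  shows "(\<integral>\<^sup>+z\<in>icube 0 R. (ennreal (infnorm z) * (\<integral>\<^sup>+s\<in>{0<..<1}. F (s *\<^sub>R z) \<partial>lborel)) \<partial>lborel)
       = (\<integral>\<^sup>+y\<in>icube 0 R. (ennreal (kern R y) * F y) \<partial>lborel)"
proof -
  let ?d = "CARD('d)"
  have [measurable]: "(\<lambda>x. infnorm (fst x :: real^'d)) \<in> borel_measurable (borel \<Otimes>\<^sub>M M)"
     "(\<lambda>x. infnorm (snd x :: real^'d)) \<in> borel_measurable (M \<Otimes>\<^sub>M borel)" for M :: "real measure" by measurable
  have mem: "z \<in> icube 0 R \<longleftrightarrow> infnorm z \<le> R" for z :: "real^'d" by (simp add: icube_def)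
  have "(\<integral>\<^sup>+z\<in>icube 0 R. (ennreal (infnorm z) * (\<integral>\<^sup>+s\<in>{0<..<1}. F (s *\<^sub>R z) \<partial>lborel)) \<partial>lborel)
     = (\<integral>\<^sup>+z. (\<integral>\<^sup>+s. indicator {z. infnorm z \<le> R} z * ennreal (infnorm z) * F (s *\<^sub>R z) * indicator {0<..<1} s \<partial>lborel) \<partial>lborel)"
    by (intro nn_integral_cong, subst nn_integral_cmult[symmetric], measurable)
       (auto simp: mem indicator_def nn_integral_cmult mult_ac intro!: nn_integral_cong)
  also have "\<dots> = (\<integral>\<^sup>+s. (\<integral>\<^sup>+z. indicator {z. infnorm z \<le> R} z * ennreal (infnorm z) * F (s *\<^sub>R z) * indicator {0<..<1} s \<partial>lborel) \<partial>lborel)"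
    by (rule lborel_pair.Fubini'[symmetric]) measurable
  also have "\<dots> = (\<integral>\<^sup>+s. (\<integral>\<^sup>+y. ennreal (infnorm y * s powr (- real ?d - 1)) * indicator {s. 0 < s \<and> s < 1 \<and> infnorm y \<le> s * R} s * F y \<partial>lborel) \<partial>lborel)"
  proof (rule nn_integral_cong)
    fix s :: real
    show "(\<integral>\<^sup>+z. indicator {z. infnorm z \<le> R} z * ennreal (infnorm z) * F (s *\<^sub>R z) * indicator {0<..<1} s \<partial>lborel)
       = (\<integral>\<^sup>+y. ennreal (infnorm y * s powr (- real ?d - 1)) * indicator {s. 0 < s \<and> s < 1 \<and> infnorm y \<le> s * R} s * F y \<partial>lborel)"
    proof (cases "0 < s \<and> s < 1")
      case False then show ?thesis by (auto simp: indicator_def)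
    next
      case True
      let ?G = "\<lambda>y::real^'d. ennreal (infnorm y * s powr (- real ?d - 1)) * indicator {s. 0 < s \<and> s < 1 \<and> infnorm y \<le> s * R} s * F y"
      have "(\<integral>\<^sup>+y. ?G y \<partial>lborel) = ennreal (s ^ ?d) * (\<integral>\<^sup>+y. ?G (s *\<^sub>R y) \<partial>lborel)"
      proof (rule nn_integral_scale)
        have "?G = (\<lambda>y. ennreal (infnorm y * s powr (- real ?d - 1)) * indicator {y. 0 < s \<and> s < 1 \<and> infnorm y \<le> s * R} y * F y)"
          by (auto simp: indicator_def)
        then show "?G \<in> borel_measurable borel" by (simp only:) measurable
      qed (use True in auto)
      also have "\<dots> = (\<integral>\<^sup>+y. ennreal (s ^ ?d) * ?G (s *\<^sub>R y) \<partial>lborel)"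
      proof (rule nn_integral_cmult[symmetric])
        have "(\<lambda>y. ?G (s *\<^sub>R y)) = (\<lambda>y. ennreal (infnorm (s *\<^sub>R y) * s powr (- real ?d - 1)) * indicator {y. 0 < s \<and> s < 1 \<and> infnorm (s *\<^sub>R y) \<le> s * R} y * F (s *\<^sub>R y))"
          by (auto simp: indicator_def)
        then show "(\<lambda>y. ?G (s *\<^sub>R y)) \<in> borel_measurable lborel" by (simp only:) measurable
      qed
      also have "\<dots> = (\<integral>\<^sup>+z. indicator {z. infnorm z \<le> R} z * ennreal (infnorm z) * F (s *\<^sub>R z) * indicator {0<..<1} s \<partial>lborel)"
      proof (rule nn_integral_cong)
        fix y :: "real^'d"
        \<comment> \<open>s^d is the Jacobian of y = s z, and the single s comes from
          \<open>infnorm (s *\<^sub>R y)\<close>; together they cancel s^(-d-1).\<close>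
        have "s ^ ?d * (s * infnorm y * s powr (- real ?d - 1)) = infnorm y"
        proof -
          have "s ^ ?d * (s * infnorm y * s powr (- real ?d - 1)) = s powr ?d * s powr 1 * s powr (- real ?d - 1) * infnorm y"
            using True by (simp add: powr_realpow)
          also have "s powr ?d * s powr 1 * s powr (- real ?d - 1) = 1"
            using True by (simp only: powr_add[symmetric]) simp
          finally show ?thesis by simp
        qed
        then have *: "ennreal (s ^ ?d) * ennreal (s * infnorm y * s powr (- real ?d - 1)) = ennreal (infnorm y)"
          using True by (subst ennreal_mult[symmetric]) (auto simp: infnorm_pos_le)
        have "infnorm (s *\<^sub>R y) = s * infnorm y" using True by (simp add: infnorm_mul)
        then have "ennreal (s ^ ?d) * ?G (s *\<^sub>R y) = (ennreal (s ^ ?d) * ennreal (s * infnorm y * s powr (- real ?d - 1))) * (indicator {y. infnorm y \<le> R} y * F (s *\<^sub>R y))"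
          using True by (auto simp: indicator_def mult.assoc)
        then show "ennreal (s ^ ?d) * ?G (s *\<^sub>R y) = indicator {z. infnorm z \<le> R} y * ennreal (infnorm y) * F (s *\<^sub>R y) * indicator {0<..<1} s"
          unfolding * using True by (auto simp: mult_ac)
      qed
      finally show ?thesis by simp
    qed
  qed
  also have "\<dots> = (\<integral>\<^sup>+y. (\<integral>\<^sup>+s. ennreal (infnorm y * s powr (- real ?d - 1)) * indicator {s. 0 < s \<and> s < 1 \<and> infnorm y \<le> s * R} s * F y \<partial>lborel) \<partial>lborel)"
  proof (rule lborel_pair.Fubini')
    have "(\<lambda>(y, s). ennreal (infnorm y * s powr (- real ?d - 1)) * indicator {s. 0 < s \<and> s < 1 \<and> infnorm y \<le> s * R} s * F y)
      = (\<lambda>x::(real^'d) \<times> real. ennreal (infnorm (fst x) * snd x powr (- real ?d - 1)) * indicator {x. 0 < snd x \<and> snd x < 1 \<and> infnorm (fst x) \<le> snd x * R} x * F (fst x))"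
      by (auto simp: indicator_def split: prod.splits)
    then show "(\<lambda>(y::real^'d, s). ennreal (infnorm y * s powr (- real ?d - 1)) * indicator {s. 0 < s \<and> s < 1 \<and> infnorm y \<le> s * R} s * F y) \<in> borel_measurable (lborel \<Otimes>\<^sub>M lborel)"
      by (simp only:) measurable
  qed
  also have "\<dots> = (\<integral>\<^sup>+y\<in>icube 0 R. (ennreal (kern R y) * F y) \<partial>lborel)"
  proof (rule nn_integral_cong_AE)
    have "AE y in lborel. y \<noteq> (0::real^'d)" by (rule AE_lborel_singleton)
    then show "AE y::real^'d in lborel. (\<integral>\<^sup>+s. ennreal (infnorm y * s powr (- real ?d - 1)) * indicator {s. 0 < s \<and> s < 1 \<and> infnorm y \<le> s * R} s * F y \<partial>lborel)
       = ennreal (kern R y) * F y * indicator (icube 0 R) y"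
    proof eventually_elim
      case (elim y)
      then have y: "0 < infnorm y" by (simp add: infnorm_pos_lt)
      have "(\<integral>\<^sup>+s. ennreal (infnorm y * s powr (- real ?d - 1)) * indicator {s. 0 < s \<and> s < 1 \<and> infnorm y \<le> s * R} s * F y \<partial>lborel)
        = (\<integral>\<^sup>+s. ennreal (infnorm y * s powr (- real ?d - 1)) * indicator {s. 0 < s \<and> s < 1 \<and> infnorm y \<le> s * R} s \<partial>lborel) * F y"
        by (rule nn_integral_multc) measurable
      also have "\<dots> = ennreal (kern R y) * F y"
        by (subst nn_integral_inverse_power) (use y R in auto)
      also have "\<dots> = ennreal (kern R y) * F y * indicator (icube 0 R) y"
        using rkern_nonpos[of ?d R "infnorm y"] R by (auto simp: mem indicator_def not_le ennreal_neg)
      finally show ?case .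
    qed
  qed
  finally show ?thesis .
qed


text \<open>A layer-cake argument: for 0 < |y| \<le> 1 the power |y|^(-s) is 1 plus the integral of
  s t^(-s-1) over |y| \<le> t \<le> 1. Integrating over y first turns t into the radius of a cube
  and leaves a multiple of t^(d-s-1), which is integrable because s < d.\<close>

lemma nn_integral_infnorm_powr_finite:
  assumes s: "0 < s" "s < real CARD('d)"
  shows "(\<integral>\<^sup>+y\<in>icube (0::real^'d) 1. ennreal (infnorm y powr (- s)) \<partial>lborel) < \<infinity>"
proof -
  let ?d = "CARD('d)"
  let ?J = "\<lambda>(y::real^'d) t::real. ennreal (s * t powr (- s - 1)) * indicator {x. 0 < snd x \<and> snd x \<le> 1 \<and> infnorm (fst x) \<le> snd x} (y, t)"
  have [measurable]: "(\<lambda>x. infnorm (fst x :: real^'d)) \<in> borel_measurable (borel \<Otimes>\<^sub>M borel)" by measurable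
  have inner: "ennreal (infnorm y powr (- s)) * indicator (icube 0 1) y \<le> indicator (icube 0 1) y + (\<integral>\<^sup>+t. ?J y t \<partial>lborel)"
    if "y \<noteq> 0" for y :: "real^'d"
  proof (cases "infnorm y \<le> 1")
    case False then show ?thesis by (simp add: icube_def)
  next
    case True
    have y: "0 < infnorm y" using that by (simp add: infnorm_pos_lt)
    have "(\<integral>\<^sup>+t. ?J y t \<partial>lborel) = (\<integral>\<^sup>+t. ennreal (s * t powr (- s - 1)) * indicator {infnorm y..1} t \<partial>lborel)"
      using y by (intro nn_integral_cong) (auto simp: indicator_def)
    also have "\<dots> = ennreal ((- (1 powr (- s))) - (- (infnorm y powr (- s))))"
    proof (rule nn_integral_FTC_Icc)
      fix x assume "x \<in> {infnorm y..1}"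
      then have "x > 0" using y by auto
      then show "((\<lambda>t. - (t powr (- s))) has_real_derivative s * x powr (- s - 1)) (at x)"
        by (auto intro!: derivative_eq_intros)
    qed (use s y True in auto)
    finally have *: "(\<integral>\<^sup>+t. ?J y t \<partial>lborel) = ennreal (infnorm y powr (- s) - 1)" by simp
    have "1 \<le> infnorm y powr (- s)"
      using y True s by (simp add: powr_minus one_le_inverse powr_le1)
    then have "ennreal (infnorm y powr (- s)) = 1 + ennreal (infnorm y powr (- s) - 1)"
      by (simp add: ennreal_plus[symmetric] ennreal_1[symmetric] del: ennreal_plus ennreal_1)
    then show ?thesis unfolding * using True by (simp add: icube_def)
  qed
  have "(\<integral>\<^sup>+y\<in>icube (0::real^'d) 1. ennreal (infnorm y powr (- s)) \<partial>lborel)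
      \<le> (\<integral>\<^sup>+y. indicator (icube 0 1) y + (\<integral>\<^sup>+t. ?J y t \<partial>lborel) \<partial>lborel)"
    using AE_lborel_singleton[of "0::real^'d"] inner by (intro nn_integral_mono_AE) auto
  also have "\<dots> = (\<integral>\<^sup>+y. indicator (icube (0::real^'d) 1) y \<partial>lborel) + (\<integral>\<^sup>+y. (\<integral>\<^sup>+t. ?J y t \<partial>lborel) \<partial>lborel)"
    by (rule nn_integral_add) measurable
  also have "(\<integral>\<^sup>+y. indicator (icube (0::real^'d) 1) y \<partial>lborel) = ennreal (2 ^ ?d)"
    by (simp add: emeasure_icube)
  also have "(\<integral>\<^sup>+y. (\<integral>\<^sup>+t. ?J y t \<partial>lborel) \<partial>lborel) = (\<integral>\<^sup>+t. (\<integral>\<^sup>+y. ?J y t \<partial>lborel) \<partial>lborel)"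
    by (rule lborel_pair.Fubini'[symmetric]) measurable
  also have "\<dots> = (\<integral>\<^sup>+t. ennreal (s * 2 ^ ?d * t powr (real ?d - s - 1)) * indicator {0..1} t \<partial>lborel)"
  proof (rule nn_integral_cong)
    fix t :: real
    show "(\<integral>\<^sup>+y. ?J y t \<partial>lborel) = ennreal (s * 2 ^ ?d * t powr (real ?d - s - 1)) * indicator {0..1} t"
    proof (cases "0 < t \<and> t \<le> 1")
      case False then show ?thesis by (auto simp: indicator_def)
    next
      case True
      then have "(\<integral>\<^sup>+y. ?J y t \<partial>lborel) = (\<integral>\<^sup>+y. ennreal (s * t powr (- s - 1)) * indicator (icube 0 t) y \<partial>(lborel :: (real^'d) measure))"
        by (intro nn_integral_cong) (auto simp: indicator_def icube_def)
      also have "\<dots> = ennreal (s * t powr (- s - 1)) * ennreal ((2 * t) ^ ?d)"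
        using True by (subst nn_integral_cmult_indicator) (auto simp: emeasure_icube)
      also have "\<dots> = ennreal (s * t powr (- s - 1) * (2 * t) ^ ?d)"
        using True s by (subst ennreal_mult) auto
      also have "s * t powr (- s - 1) * (2 * t) ^ ?d = s * 2 ^ ?d * (t powr (- s - 1) * t powr ?d)"
        using True by (simp add: power_mult_distrib powr_realpow)
      also have "t powr (- s - 1) * t powr ?d = t powr (real ?d - s - 1)"
        by (simp add: powr_add[symmetric] algebra_simps)
      finally show ?thesis using True by simp
    qed
  qed
  also have "\<dots> = ennreal (s * 2 ^ ?d) * (\<integral>\<^sup>+t. ennreal (t powr (real ?d - s - 1)) * indicator {0..1} t \<partial>lborel)"
    using s by (subst nn_integral_cmult[symmetric]) (auto simp: ennreal_mult mult.assoc)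
  also have "(\<integral>\<^sup>+t. ennreal (t powr (real ?d - s - 1)) * indicator {0..1} t \<partial>lborel) = ennreal (1 powr (real ?d - s - 1 + 1) / (real ?d - s - 1 + 1))"
    using nn_integral_has_integral_lebesgue[OF _ has_integral_powr_from_0[of "real ?d - s - 1" 1]] s
    by (simp add: ennreal_mult ennreal_indicator mult.commute)
  also have "ennreal (2 ^ ?d) + ennreal (s * 2 ^ ?d) * ennreal (1 powr (real ?d - s - 1 + 1) / (real ?d - s - 1 + 1)) < \<infinity>"
    using s by (simp add: ennreal_mult_less_top)
  finally show ?thesis .
qed

text \<open>The type argument carries the dimension. Under the assumptions on q below the integral
  is finite, so the default value of \<open>enn2real\<close> at infinity does not occur.\<close>

definition kmass :: "'d::finite itself \<Rightarrow> real \<Rightarrow> real" where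
  "kmass _ q = enn2real (\<integral>\<^sup>+y\<in>icube (0::real^'d) 1. ennreal (kern 1 y powr q) \<partial>lborel)"

context
  fixes q :: real
  assumes d: "2 \<le> CARD('d::finite)" and q: "1 \<le> q" "(real CARD('d) - 1) * q < real CARD('d)"
begin

text \<open>The kernel is at most |y|^(-(d-1)), whose q-th power is integrable since (d - 1) q <
  d.\<close>

lemma nn_integral_kern_unit:
  "(\<integral>\<^sup>+y\<in>icube (0::real^'d) 1. ennreal (kern 1 y powr q) \<partial>lborel) = ennreal (kmass TYPE('d) q)"
proof -
  let ?s = "(real CARD('d) - 1) * q"
  have s: "0 < ?s" using d q by simp
  have "(\<integral>\<^sup>+y\<in>icube (0::real^'d) 1. ennreal (kern 1 y powr q) \<partial>lborel)
     \<le> (\<integral>\<^sup>+y\<in>icube (0::real^'d) 1. ennreal (infnorm y powr (- ?s)) \<partial>lborel)"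
  proof (intro nn_integral_mono)
    fix y :: "real^'d"
    have "kern 1 y powr q \<le> infnorm y powr (- ?s)" if "infnorm y \<le> 1"
    proof (cases "y = 0")
      case True then show ?thesis using d by (simp add: rkern_def infnorm_0)
    next
      case False
      then have y: "0 < infnorm y" by (simp add: infnorm_pos_lt)
      have "kern 1 y \<le> (1 / infnorm y ^ (CARD('d) - 1)) / real CARD('d)"
        unfolding rkern_def using y by (intro divide_right_mono) auto
      also have "\<dots> \<le> (1 / infnorm y ^ (CARD('d) - 1)) / 1"
        using y d by (intro divide_left_mono) auto
      also have "\<dots> = infnorm y powr (- (real CARD('d) - 1))"
        using y d by (simp add: powr_minus powr_realpow[symmetric] of_nat_diff inverse_eq_divide powr_diff)
      finally have "kern 1 y powr q \<le> (infnorm y powr (- (real CARD('d) - 1))) powr q"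
        using that y q by (intro powr_mono2 rkern_nonneg) (auto simp: infnorm_pos_le)
      then show ?thesis by (simp only: powr_powr mult_minus_left)
    qed
    then show "ennreal (kern 1 y powr q) * indicator (icube 0 1) y \<le> ennreal (infnorm y powr (- ?s)) * indicator (icube 0 1) y"
      by (auto simp: icube_def indicator_def intro: ennreal_leI)
  qed
  also have "\<dots> < \<infinity>" by (rule nn_integral_infnorm_powr_finite) (use s q in auto)
  finally show ?thesis unfolding kmass_def by (simp add: less_top)
qed

text \<open>The kernel decreases in the radius, so on the cube of radius 1/2, which has volume 1, it
  is almost everywhere at least its value at 1/2.\<close>

lemma kmass_pos: "0 < kmass TYPE('d) q"
proof -
  let ?c = "rkern CARD('d) 1 (1/2) powr q"
  have "rkern CARD('d) 1 (1/2) > 0"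
  proof -
    have "(1::real) \<le> 2 ^ (CARD('d) - 1)" by simp
    then have "0 < 2 ^ (CARD('d) - 1) - 1 / (2::real)" by linarith
    then show ?thesis using d by (simp add: rkern_def power_one_over)
  qed
  then have c: "?c > 0" by simp
  have "ennreal ?c * ennreal 1 = (\<integral>\<^sup>+y. ennreal ?c * indicator (icube (0::real^'d) (1/2)) y \<partial>lborel)"
    by (subst nn_integral_cmult_indicator) (auto simp: emeasure_icube)
  also have "\<dots> \<le> (\<integral>\<^sup>+y\<in>icube (0::real^'d) 1. ennreal (kern 1 y powr q) \<partial>lborel)"
  proof (rule nn_integral_mono_AE)
    show "AE y::real^'d in lborel. ennreal ?c * indicator (icube 0 (1/2)) y \<le> ennreal (kern 1 y powr q) * indicator (icube 0 1) y"
      using AE_lborel_singleton[of "0::real^'d"]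
    proof eventually_elim
      case (elim y)
      then have y: "0 < infnorm y" by (simp add: infnorm_pos_lt)
      have "?c \<le> kern 1 y powr q" if "infnorm y \<le> 1/2"
        using that y q d by (intro powr_mono2 rkern_nonneg rkern_antimono) auto
      then show ?case by (auto simp: icube_def indicator_def intro: ennreal_leI)
    qed
  qed
  finally have "ennreal ?c \<le> ennreal (kmass TYPE('d) q)" by (simp add: nn_integral_kern_unit)
  then show ?thesis using c by (meson ennreal_le_iff2 less_le_trans not_less)
qed

text \<open>Homogeneity of the kernel gives the factor R^q and the volume element gives R^d.\<close>

lemma nn_integral_kern:
  assumes R: "0 < R"
  shows "(\<integral>\<^sup>+y\<in>icube (c::real^'d) R. ennreal (kern R (y - c) powr q) \<partial>lborel)
       = ennreal (R powr (q + real CARD('d)) * kmass TYPE('d) q)"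
proof -
  have "(\<integral>\<^sup>+y\<in>icube c R. ennreal (kern R (y - c) powr q) \<partial>lborel) = (\<integral>\<^sup>+y\<in>icube (0::real^'d) R. ennreal (kern R y powr q) \<partial>lborel)"
    by (rule nn_integral_icube_translate) measurable
  also have "\<dots> = ennreal (R ^ CARD('d)) * (\<integral>\<^sup>+y. ennreal (kern R (R *\<^sub>R y) powr q) * indicator (icube 0 R) (R *\<^sub>R y) \<partial>(lborel::(real^'d) measure))"
    using R by (intro nn_integral_scale) measurable
  also have "(\<integral>\<^sup>+y. ennreal (kern R (R *\<^sub>R y) powr q) * indicator (icube 0 R) (R *\<^sub>R y) \<partial>(lborel::(real^'d) measure))
     = (\<integral>\<^sup>+y. ennreal (R powr q) * (ennreal (kern 1 y powr q) * indicator (icube 0 1) y) \<partial>(lborel::(real^'d) measure))"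
  proof (rule nn_integral_cong)
    fix y :: "real^'d"
    have "(R * rkern CARD('d) 1 (infnorm y)) powr q = R powr q * rkern CARD('d) 1 (infnorm y) powr q" if "infnorm y \<le> 1"
      by (rule powr_mult)
    then show "ennreal (kern R (R *\<^sub>R y) powr q) * indicator (icube 0 R) (R *\<^sub>R y) = ennreal (R powr q) * (ennreal (kern 1 y powr q) * indicator (icube 0 1) y)"
      using R by (auto simp: icube_def indicator_def infnorm_mul rkern_scale ennreal_mult[symmetric])
  qed
  also have "\<dots> = ennreal (R powr q) * ennreal (kmass TYPE('d) q)"
    by (subst nn_integral_cmult) (auto simp: nn_integral_kern_unit)
  also have "ennreal (R ^ CARD('d)) * \<dots> = ennreal (R powr (q + real CARD('d)) * kmass TYPE('d) q)"
    using R kmass_pos by (simp add: ennreal_mult[symmetric] powr_add powr_realpow mult_ac)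
  finally show ?thesis .
qed

end

subsection \<open>Bump functions\<close>

text \<open>In \<open>smooth\<close> the last derivative is the outermost one, which does not suit
  an induction for sums and products. Here the first derivative is split off, so that the product
  rule reduces n + 1 to n.\<close>

primrec times_differentiable :: "nat \<Rightarrow> (real^'d \<Rightarrow> real) \<Rightarrow> bool" where
  "times_differentiable 0 f = True"
| "times_differentiable (Suc n) f \<longleftrightarrow> (\<forall>x. f differentiable (at x)) \<and> (\<forall>i. times_differentiable n (partial_deriv i f))"

lemma smoothI: "(\<And>n. times_differentiable n f) \<Longrightarrow> smooth f"
proof -
  assume f: "\<And>n. times_differentiable n f"
  have "times_differentiable n (iterated_partial is f)" for "is" n
  proof (induction "is" arbitrary: n)
    case (Cons i "is")
    from Cons.IH[of "Suc n"] show ?case by simp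
  qed (simp add: f)
  from this[of "Suc 0"] show ?thesis by (simp add: smooth_def)
qed

lemma times_differentiable_Suc: "times_differentiable (Suc n) f \<Longrightarrow> times_differentiable n f"
  by (induction n arbitrary: f) auto

lemma partial_derivI: "(f has_derivative D) (at x) \<Longrightarrow> partial_deriv i f x = D (axis i 1)"
  unfolding partial_deriv_def by (simp add: frechet_derivative_at[symmetric])

lemma times_differentiable_add:
  "times_differentiable n f \<Longrightarrow> times_differentiable n g \<Longrightarrow> times_differentiable n (\<lambda>x. f x + g x)"
proof (induction n arbitrary: f g)
  case (Suc n)
  have D: "(f has_derivative frechet_derivative f (at x)) (at x)" "(g has_derivative frechet_derivative g (at x)) (at x)" for x
    using Suc.prems by (auto simp: frechet_derivative_works)
  have "partial_deriv i (\<lambda>x. f x + g x) = (\<lambda>x. partial_deriv i f x + partial_deriv i g x)" for i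
    using partial_derivI[OF has_derivative_add[OF D]] by (auto simp: partial_deriv_def)
  then show ?case using Suc by auto
qed simp

lemma times_differentiable_mult:
  "times_differentiable n f \<Longrightarrow> times_differentiable n g \<Longrightarrow> times_differentiable n (\<lambda>x. f x * g x)"
proof (induction n arbitrary: f g)
  case (Suc n)
  have D: "(f has_derivative frechet_derivative f (at x)) (at x)" "(g has_derivative frechet_derivative g (at x)) (at x)" for x
    using Suc.prems by (auto simp: frechet_derivative_works)
  have "partial_deriv i (\<lambda>x. f x * g x) = (\<lambda>x. f x * partial_deriv i g x + partial_deriv i f x * g x)" for i
    using partial_derivI[OF has_derivative_mult[OF D]] by (auto simp: partial_deriv_def)
  moreover have "times_differentiable n f" "times_differentiable n g"
    using Suc.prems by (auto intro: times_differentiable_Suc)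
  ultimately show ?case using Suc by (auto intro!: times_differentiable_add)
qed simp

lemma times_differentiable_const: "times_differentiable n (\<lambda>x. c)"
proof (induction n arbitrary: c)
  case (Suc n)
  have "partial_deriv i (\<lambda>x. c) = (\<lambda>x. 0)" for i :: 'a
    using partial_derivI[OF has_derivative_const] by auto
  then show ?case using Suc by auto
qed simp

lemma times_differentiable_prod:
  "finite I \<Longrightarrow> (\<And>i. i \<in> I \<Longrightarrow> times_differentiable n (f i)) \<Longrightarrow> times_differentiable n (\<lambda>x. \<Prod>i\<in>I. f i x)"
  by (induction I rule: finite_induct) (auto intro: times_differentiable_const times_differentiable_mult)

text \<open>The powers of t in the denominator close the family under differentiation up to linear
  combinations, so smoothness follows by induction without a formula for the higher
  derivatives.\<close>

definition flat_exp :: "nat \<Rightarrow> real \<Rightarrow> real" where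
  "flat_exp k t = (if 0 < t then exp (- 1 / t) / t ^ k else 0)"

lemma flat_exp_tendsto_0: "(flat_exp k \<longlongrightarrow> 0) (at 0)"
proof -
  have "((\<lambda>t. (inverse t) ^ k / exp (inverse t)) \<longlongrightarrow> 0) (at_right (0::real))"
    by (rule filterlim_compose[OF tendsto_power_div_exp_0 filterlim_inverse_at_top_right])
  then have "(flat_exp k \<longlongrightarrow> 0) (at_right 0)"
    by (rule Lim_transform_eventually)
       (auto simp: flat_exp_def eventually_at_right_field exp_minus field_simps intro: exI[of _ 1])
  moreover have "(flat_exp k \<longlongrightarrow> 0) (at_left 0)"
    by (rule tendsto_eventually) (auto simp: flat_exp_def eventually_at_left_field intro: exI[of _ "-1"])
  ultimately show ?thesis by (simp add: filterlim_split_at)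
qed

lemma flat_exp_DERIV:
  "(flat_exp k has_real_derivative (flat_exp (k + 2) t - real k * flat_exp (k + 1) t)) (at t)"
proof -
  consider "t < 0" | "t = 0" | "t > 0" by linarith
  then show ?thesis
  proof cases
    case 1
    have "(flat_exp k has_real_derivative 0) (at t)"
      by (rule has_field_derivative_transform_within_open[of "\<lambda>t. 0" _ _ "{..<0}"])
         (use 1 in \<open>auto simp: flat_exp_def\<close>)
    then show ?thesis using 1 by (simp add: flat_exp_def)
  next
    case 2
    \<comment> \<open>At 0 the difference quotient of the k-th function is the (k + 1)-st
      function.\<close>
    have "((\<lambda>h. (flat_exp k (0 + h) - flat_exp k 0) / h) \<longlongrightarrow> 0) (at 0)"
      using flat_exp_tendsto_0[of "k + 1"]
      by (rule Lim_transform_eventually)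
         (auto simp: flat_exp_def eventually_at_filter)
    then show ?thesis using 2 by (simp add: DERIV_def flat_exp_def)
  next
    case 3
    have "((\<lambda>t. exp (- 1 / t) / t ^ k) has_real_derivative
       ((exp (- 1 / t) * (1 / t ^ 2)) * t ^ k - exp (- 1 / t) * (real k * t ^ (k - 1))) / (t ^ k * t ^ k)) (at t)"
      using 3 by (auto intro!: derivative_eq_intros simp: power2_eq_square field_simps)
    also have "((exp (- 1 / t) * (1 / t ^ 2)) * t ^ k - exp (- 1 / t) * (real k * t ^ (k - 1))) / (t ^ k * t ^ k)
       = exp (- 1 / t) / t ^ (k + 2) - real k * (exp (- 1 / t) / t ^ (k + 1))"
      using 3 by (cases k) (auto simp: field_simps power2_eq_square power_add)
    finally have *: "((\<lambda>t. exp (- 1 / t) / t ^ k) has_real_derivative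
       exp (- 1 / t) / t ^ (k + 2) - real k * (exp (- 1 / t) / t ^ (k + 1))) (at t)" .
    have "(flat_exp k has_real_derivative exp (- 1 / t) / t ^ (k + 2) - real k * (exp (- 1 / t) / t ^ (k + 1))) (at t)"
      by (rule has_field_derivative_transform_within_open[OF *, of "{0<..}"])
         (use 3 in \<open>auto simp: flat_exp_def\<close>)
    then show ?thesis using 3 by (simp add: flat_exp_def)
  qed
qed

lemma times_differentiable_flat_exp:
  "times_differentiable n (\<lambda>x::real^'d. flat_exp k (a * x $ j + c))"
proof (induction n arbitrary: k)
  case (Suc n)
  let ?D = "\<lambda>x::real^'d. flat_exp (k + 2) (a * x $ j + c) - real k * flat_exp (k + 1) (a * x $ j + c)"
  have D: "((\<lambda>x::real^'d. flat_exp k (a * x $ j + c)) has_derivative (\<lambda>h. ?D x * (a * h $ j))) (at x)" for x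
    by (rule has_derivative_compose[where f = "\<lambda>x. a * x $ j + c",
          OF _ flat_exp_DERIV[unfolded has_field_derivative_def]])
       (auto intro!: derivative_eq_intros bounded_linear_imp_has_derivative[OF bounded_linear_vec_nth])
  have "times_differentiable n (partial_deriv i (\<lambda>x::real^'d. flat_exp k (a * x $ j + c)))" for i
  proof -
    let ?a = "a * axis i 1 $ j"
    have "partial_deriv i (\<lambda>x::real^'d. flat_exp k (a * x $ j + c)) = (\<lambda>x. ?a * flat_exp (k + 2) (a * x $ j + c) + (- real k * ?a) * flat_exp (k + 1) (a * x $ j + c))"
      using partial_derivI[OF D] by (auto simp: algebra_simps)
    then show ?thesis
      by (simp only:) (intro times_differentiable_add times_differentiable_mult times_differentiable_const Suc.IH)
  qed
  then show ?case using D by (auto intro: differentiableI)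
qed simp

lemma flat_exp_continuous: "continuous_on A (flat_exp k)"
  using flat_exp_DERIV by (meson DERIV_isCont continuous_at_imp_continuous_on)

text \<open>A product of one-dimensional bumps, so that for e > 0 the support is the cube of radius
  e and fits the maximum norm. It is not normalised; its mass is carried along as
  \<open>bump_mass\<close>.\<close>

definition bump :: "real \<Rightarrow> real^'d \<Rightarrow> real" where
  "bump e v = (\<Prod>i\<in>UNIV. flat_exp 0 (v $ i + e) * flat_exp 0 (e - v $ i))"

lemma bump_smooth: "smooth (\<lambda>y. bump e (y - x))"
proof (rule smoothI)
  fix n
  have "(\<lambda>y. bump e (y - x)) = (\<lambda>y. \<Prod>i\<in>UNIV. flat_exp 0 (1 * y $ i + (e - x $ i)) * flat_exp 0 ((- 1) * y $ i + (e + x $ i)))"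
    by (auto simp: bump_def algebra_simps)
  then show "times_differentiable n (\<lambda>y. bump e (y - x))"
    by (simp only:) (intro times_differentiable_prod times_differentiable_mult times_differentiable_flat_exp finite)
qed

lemma bump_nonneg: "0 \<le> bump e v"
  by (auto simp: bump_def flat_exp_def intro!: prod_nonneg)

lemma bump_pos_iff: "0 < bump e v \<longleftrightarrow> infnorm v < e"
proof (cases "infnorm v < e")
  case True
  then have v: "\<bar>v $ i\<bar> < e" for i by (simp add: infnorm_less_iff)
  have "0 < v $ i + e" "0 < e - v $ i" for i using v[of i] by linarith+
  then have "0 < bump e v" unfolding bump_def
    by (intro prod_pos) (simp add: flat_exp_def)
  then show ?thesis using True by simp
next
  case False
  then obtain i where "e \<le> \<bar>v $ i\<bar>" by (auto simp: infnorm_less_iff not_less)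
  then have "flat_exp 0 (v $ i + e) * flat_exp 0 (e - v $ i) = 0" by (auto simp: flat_exp_def)
  then have "bump e v = 0" unfolding bump_def by (intro prod_zero) auto
  then show ?thesis using False by simp
qed

lemma bump_eq_0: "e \<le> infnorm v \<Longrightarrow> bump e v = 0"
  using bump_pos_iff[of e v] bump_nonneg[of e v] by linarith

lemma bump_continuous: "continuous_on A (bump e)"
  unfolding bump_def
  by (intro continuous_on_prod continuous_on_mult continuous_on_compose2[OF flat_exp_continuous[of UNIV]] continuous_intros) auto

lemma bump_measurable [measurable]: "bump e \<in> borel_measurable borel"
  by (intro borel_measurable_continuous_onI bump_continuous)

lemma bump_le_1: "0 < e \<Longrightarrow> bump e v \<le> 1"
  by (auto simp: bump_def flat_exp_def intro!: prod_le_1 mult_le_one)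

lemma test_function_bump:
  assumes "icube x e \<subseteq> Q" "0 < e"
  shows "test_function Q (\<lambda>y. bump e (y - x))"
proof -
  have "{y. bump e (y - x) \<noteq> 0} \<subseteq> icube x e"
    using bump_eq_0[of e] by (force simp: icube_def not_le)
  then have "closure {y. bump e (y - x) \<noteq> 0} \<subseteq> icube x e"
    by (rule closure_minimal) simp
  moreover from this have "compact (closure {y. bump e (y - x) \<noteq> 0})"
    using compact_Int_closed[OF icube_compact[of x e] closed_closure[of "{y. bump e (y - x) \<noteq> 0}"]]
    by (simp add: Int_absorb1)
  ultimately show ?thesis
    using assms bump_smooth[of e x] by (auto simp: test_function_def)
qed

lemma bump_differentiable: "bump e differentiable (at v)"
proof -
  have "\<forall>is x. iterated_partial is (bump e) differentiable (at x)"
    using bump_smooth[of e 0] by (simp add: smooth_def)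
  from spec[OF spec[OF this, of "[]"], of v] show ?thesis by simp
qed

lemma partial_deriv_shift:
  assumes "\<And>v. f differentiable at v"
  shows "partial_deriv i (\<lambda>y. f (y - x)) y = partial_deriv i f (y - x)"
proof -
  have "(f has_derivative frechet_derivative f (at (y - x))) (at (y - x))"
    using assms by (simp add: frechet_derivative_works)
  then have "((\<lambda>y. f (y - x)) has_derivative frechet_derivative f (at (y - x))) (at y)"
    by (rule has_derivative_compose[where f = "\<lambda>y. y - x", rotated]) (auto intro!: derivative_eq_intros)
  then show ?thesis by (simp add: partial_derivI) (simp add: partial_deriv_def)
qed

lemma partial_deriv_sum:
  assumes "f differentiable at x"
  shows "frechet_derivative f (at x) v = (\<Sum>i\<in>UNIV. v $ i * partial_deriv i f x)"
proof -
  interpret linear "frechet_derivative f (at x)" using assms by (rule linear_frechet_derivative)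
  have "v = (\<Sum>i\<in>UNIV. v $ i *\<^sub>R axis i 1)"
    using basis_expansion[of v] by (simp add: scalar_mult_eq_scaleR)
  then have "frechet_derivative f (at x) v = frechet_derivative f (at x) (\<Sum>i\<in>UNIV. v $ i *\<^sub>R axis i 1)" by simp
  then show ?thesis by (simp add: sum scaleR partial_deriv_def)
qed

lemma bump_partial_continuous: "continuous_on A (partial_deriv i (bump e))"
proof -
  have "partial_deriv i (bump e) differentiable (at x)" for x
  proof -
    have "\<forall>is x. iterated_partial is (bump e) differentiable (at x)"
      using bump_smooth[of e 0] by (simp add: smooth_def)
    from spec[OF spec[OF this, of "[i]"], of x] show ?thesis by simp
  qed
  then show ?thesis
    by (meson differentiable_imp_continuous_within continuous_at_imp_continuous_on)
qed


lemma test_function_differentiable: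
  assumes "test_function Q \<phi>"
  shows "\<phi> differentiable (at x)" "partial_deriv i \<phi> differentiable (at x)"
proof -
  have "\<forall>is x. iterated_partial is \<phi> differentiable (at x)"
    using assms by (simp add: test_function_def smooth_def)
  from spec[OF spec[OF this, of "[]"], of x] spec[OF spec[OF this, of "[i]"], of x]
  show "\<phi> differentiable (at x)" "partial_deriv i \<phi> differentiable (at x)" by simp_all
qed

lemma test_function_continuous:
  assumes "test_function Q \<phi>"
  shows "continuous_on A \<phi>" "continuous_on A (partial_deriv i \<phi>)"
  using test_function_differentiable[OF assms]
  by (meson differentiable_imp_continuous_within continuous_at_imp_continuous_on)+

lemma test_function_partial_0:
  assumes "x \<notin> closure {x. \<phi> x \<noteq> 0}"
  shows "partial_deriv i \<phi> x = 0"
proof -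
  have "((\<lambda>x. 0) has_derivative (\<lambda>h. 0)) (at x)" by simp
  then have "(\<phi> has_derivative (\<lambda>h. 0)) (at x)"
    by (rule has_derivative_transform_within_open[OF _ open_Compl[OF closed_closure[of "{x. \<phi> x \<noteq> 0}"]]])
       (use assms closure_subset[of "{x. \<phi> x \<noteq> 0}"] in auto)
  then show ?thesis by (simp add: partial_derivI)
qed

lemma test_function_bounded:
  assumes "test_function Q \<phi>"
  obtains B where "\<And>x. \<bar>\<phi> x\<bar> \<le> B" "\<And>i x. \<bar>partial_deriv i \<phi> x\<bar> \<le> B" "0 \<le> B"
proof -
  let ?K = "closure {x. \<phi> x \<noteq> 0}"
  have K: "compact ?K" using assms by (simp add: test_function_def)
  have "\<exists>B. \<forall>x. \<bar>g x\<bar> \<le> B" if "continuous_on ?K g" "\<And>x. x \<notin> ?K \<Longrightarrow> g x = 0" for g :: "real^'a \<Rightarrow> real"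
  proof -
    have "bounded (g ` ?K)" by (rule compact_imp_bounded[OF compact_continuous_image[OF that(1) K]])
    then obtain B where "\<forall>x\<in>?K. \<bar>g x\<bar> \<le> B" by (auto simp: bounded_iff)
    then have "\<bar>g x\<bar> \<le> max B 0" for x using that(2)[of x] by (cases "x \<in> ?K") (auto simp: max_def)
    then show ?thesis by blast
  qed
  note ex = this
  have "\<phi> x = 0" if "x \<notin> ?K" for x using that closure_subset[of "{x. \<phi> x \<noteq> 0}"] by auto
  then obtain B0 where B0: "\<And>x. \<bar>\<phi> x\<bar> \<le> B0" using ex[of \<phi>] test_function_continuous(1)[OF assms] by metis
  have "\<forall>i. \<exists>B. \<forall>x. \<bar>partial_deriv i \<phi> x\<bar> \<le> B"
    using ex test_function_continuous(2)[OF assms] test_function_partial_0 by metis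
  then obtain B1 where B1: "\<And>i x. \<bar>partial_deriv i \<phi> x\<bar> \<le> B1 i" by metis
  show ?thesis
  proof (rule that)
    have B1n: "0 \<le> B1 i" for i using B1[of i undefined] by linarith
    have B0n: "0 \<le> B0" using B0[of undefined] by linarith
    show "\<bar>\<phi> x\<bar> \<le> B0 + sum B1 UNIV" for x using B0[of x] sum_nonneg[of UNIV B1] B1n by fastforce
    show "\<bar>partial_deriv i \<phi> x\<bar> \<le> B0 + sum B1 UNIV" for i x
      using B1[of i x] member_le_sum[of i UNIV B1] B1n B0n by fastforce
    show "0 \<le> B0 + sum B1 UNIV" using B0n B1n by (simp add: sum_nonneg)
  qed
qed

section \<open>Closed neighbourhoods of compact sets in the maximum norm\<close>

definition thick :: "(real^'d) set \<Rightarrow> real \<Rightarrow> (real^'d) set" where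
  "thick T e = {y. \<exists>x\<in>T. infnorm (y - x) \<le> e}"

lemma thick_compact: "compact T \<Longrightarrow> compact (thick T e)"
proof -
  assume "compact T"
  then have "compact {x + y | x y. x \<in> T \<and> y \<in> icube 0 e}" by (rule compact_sums) simp
  also have "{x + y | x y. x \<in> T \<and> y \<in> icube 0 e} = thick T e"
  proof (intro equalityI subsetI)
    fix y assume "y \<in> thick T e"
    then obtain x where "x \<in> T" "infnorm (y - x) \<le> e" by (auto simp: thick_def)
    then show "y \<in> {x + y | x y. x \<in> T \<and> y \<in> icube 0 e}"
      by (intro CollectI exI[of _ x] exI[of _ "y - x"]) (simp add: icube_def)
  next
    fix z assume "z \<in> {x + y | x y. x \<in> T \<and> y \<in> icube 0 e}"
    then obtain x y where "z = x + y" "x \<in> T" "infnorm y \<le> e" by (auto simp: icube_def)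
    then show "z \<in> thick T e" by (auto simp: thick_def intro!: bexI[of _ x])
  qed
  finally show ?thesis .
qed

lemma thick_mono: "e \<le> e' \<Longrightarrow> thick T e \<subseteq> thick T e'"
  by (auto simp: thick_def intro: order_trans)

lemma subset_thick: "0 \<le> e \<Longrightarrow> T \<subseteq> thick T e"
  by (auto simp: thick_def infnorm_0 intro!: bexI)

lemma thick_Inter: "compact T \<Longrightarrow> 0 < e \<Longrightarrow> (\<Inter>n. thick T (e / real (Suc n))) = T"
proof (intro equalityI subsetI)
  assume T: "compact T" "0 < e"
  show "x \<in> (\<Inter>n. thick T (e / real (Suc n)))" if "x \<in> T" for x
  proof
    fix n
    have "0 \<le> e / real (Suc n)" using T by simp
    then show "x \<in> thick T (e / real (Suc n))" using subset_thick that by blast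
  qed
  show "x \<in> T" if x: "x \<in> (\<Inter>n. thick T (e / real (Suc n)))" for x
  proof -
    have "\<forall>n. \<exists>y\<in>T. infnorm (x - y) \<le> e / real (Suc n)" using x by (auto simp: thick_def)
    then obtain y where y: "\<And>n. y n \<in> T" "\<And>n. infnorm (x - y n) \<le> e / real (Suc n)" by metis
    have bnd: "norm (y n - x) \<le> sqrt DIM(real^'a) * e * inverse (real (Suc n))" for n
    proof -
      have "norm (y n - x) \<le> sqrt DIM(real^'a) * infnorm (x - y n)"
        using norm_le_infnorm[of "x - y n"] by (simp add: norm_minus_commute)
      also have "\<dots> \<le> sqrt DIM(real^'a) * (e / real (Suc n))" by (intro mult_left_mono y) simp
      finally show ?thesis by (simp add: divide_inverse mult.assoc)
    qed
    have "(\<lambda>n. sqrt DIM(real^'a) * e * inverse (real (Suc n))) \<longlonglongrightarrow> 0"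
      using LIMSEQ_inverse_real_of_nat tendsto_mult_right_zero by blast
    then have "(\<lambda>n. y n - x) \<longlonglongrightarrow> 0"
      by (rule Lim_null_comparison[OF always_eventually[OF allI[OF bnd]]])
    then have "y \<longlonglongrightarrow> x" by (simp add: LIM_zero_iff)
    then show "x \<in> T" using closed_sequentially[OF compact_imp_closed[OF T(1)]] y(1) by metis
  qed
qed

text \<open>Continuity from above of the measure with density \<Gamma>: a compact T is closed, so
  its closed neighbourhoods shrink to T itself.\<close>

lemma thick_approx:
  fixes \<Gamma> :: "real^'d \<Rightarrow> ennreal"
  assumes T: "compact T" and e: "0 < e" and [measurable]: "\<Gamma> \<in> borel_measurable borel"
    and fin: "(\<integral>\<^sup>+x\<in>thick T e. \<Gamma> x \<partial>lborel) < \<infinity>"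
  shows "(\<lambda>n. \<integral>\<^sup>+x\<in>thick T (e / real (Suc n)). \<Gamma> x \<partial>lborel) \<longlonglongrightarrow> (\<integral>\<^sup>+x\<in>T. \<Gamma> x \<partial>lborel)"
proof -
  let ?M = "density lborel \<Gamma>"
  have [measurable]: "thick T e' \<in> sets borel" for e' using thick_compact[OF T] borel_compact by blast
  have [measurable]: "T \<in> sets borel" using T borel_compact by blast
  have em: "emeasure ?M A = (\<integral>\<^sup>+x\<in>A. \<Gamma> x \<partial>lborel)" if "A \<in> sets borel" for A
    using that by (simp add: emeasure_density)
  have "(\<lambda>n. emeasure ?M (thick T (e / real (Suc n)))) \<longlonglongrightarrow> emeasure ?M (\<Inter>n. thick T (e / real (Suc n)))"
  proof (rule Lim_emeasure_decseq)
    show "decseq (\<lambda>n. thick T (e / real (Suc n)))"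
      using e by (intro decseq_SucI thick_mono) (auto simp: field_simps)
    fix n
    have "emeasure ?M (thick T (e / real (Suc n))) \<le> emeasure ?M (thick T e)"
      using e by (intro emeasure_mono thick_mono) (auto simp: field_simps)
    then show "emeasure ?M (thick T (e / real (Suc n))) \<noteq> \<infinity>"
      using fin by (auto simp: em top_unique)
  qed auto
  then show ?thesis unfolding thick_Inter[OF T e] by (simp add: em)
qed

lemma thick_subset_open:
  assumes "compact T" "open Q" "T \<subseteq> Q"
  obtains e where "0 < e" "thick T e \<subseteq> (Q :: (real^'d) set)"
proof -
  obtain e where e: "0 < e" "(\<Union>x\<in>T. ball x e) \<subseteq> Q"
    using compact_subset_open_imp_ball_epsilon_subset[OF assms] .
  let ?c = "sqrt DIM(real^'d)"
  have c: "?c > 0" by simp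
  show ?thesis
  proof (rule that[of "e / (2 * ?c)"])
    show "thick T (e / (2 * ?c)) \<subseteq> Q"
    proof
      fix y assume "y \<in> thick T (e / (2 * ?c))"
      then obtain x where x: "x \<in> T" "infnorm (y - x) \<le> e / (2 * ?c)" by (auto simp: thick_def)
      have "norm (y - x) \<le> ?c * infnorm (y - x)" by (rule norm_le_infnorm)
      also have "\<dots> \<le> ?c * (e / (2 * ?c))" using x c by (intro mult_left_mono) auto
      also have "\<dots> = e / 2" using c by (metis (no_types, opaque_lifting) less_irrefl mult.commute nonzero_mult_divide_mult_cancel_right times_divide_eq_right)
      also have "\<dots> < e" using e by simp
      finally have "y \<in> ball x e" by (simp add: dist_norm norm_minus_commute)
      then show "y \<in> Q" using e(2) x(1) by blast
    qed
  qed (use e in auto)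
qed

subsection \<open>A sharp Poincare inequality on star-shaped sets\<close>

lemma norm_mult_bound: "\<bar>c\<bar> \<le> B \<Longrightarrow> norm (a * c) \<le> norm (B * (a::real))"
proof -
  assume "\<bar>c\<bar> \<le> B"
  then have "\<bar>a\<bar> * \<bar>c\<bar> \<le> \<bar>a\<bar> * B" by (rule mult_left_mono) simp
  moreover have "0 \<le> B" using \<open>\<bar>c\<bar> \<le> B\<close> by linarith
  ultimately show ?thesis by (simp add: abs_mult mult.commute)
qed

lemma shift_lborel:
  fixes h :: "real^'d \<Rightarrow> real"
  assumes [measurable]: "h \<in> borel_measurable borel"
  shows "integrable lborel (\<lambda>y. h (y + t)) \<longleftrightarrow> integrable lborel h"
    and "(LINT y|lborel. h (y + t)) = (LINT y|lborel. h y)"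
proof -
  have "integrable (distr lborel borel ((+) t)) h \<longleftrightarrow> integrable lborel (\<lambda>y. h (t + y))"
    by (rule integrable_distr_eq) measurable
  then show "integrable lborel (\<lambda>y. h (y + t)) \<longleftrightarrow> integrable lborel h"
    by (simp add: lborel_distr_plus add.commute)
  have "integral\<^sup>L (distr lborel borel ((+) t)) h = (LINT y|lborel. h (t + y))"
    by (rule integral_distr) measurable
  then show "(LINT y|lborel. h (y + t)) = (LINT y|lborel. h y)"
    by (simp add: lborel_distr_plus add.commute)
qed

text \<open>
  The assumption \<open>young\<close> replaces Hoelder's inequality: being linear in \<open>\<Gamma>\<close>, it is additive over
  disjoint sets. It is used with \<open>\<Gamma> = \<bar>\<nabla>f\<bar>\<^sub>1\<^sup>p\<close> if \<open>p < \<infinity>\<close>, and with \<open>\<alpha> = 1\<close>, \<open>\<beta> = 0\<close> if \<open>p = \<infinity>\<close>.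
\<close>

locale dominated_gradient =
  fixes Q :: "(real^'d) set" and f :: "real^'d \<Rightarrow> real" and G :: "'d \<Rightarrow> real^'d \<Rightarrow> real"
    and g :: "real^'d \<Rightarrow> real" and \<Gamma> :: "real^'d \<Rightarrow> real" and \<alpha> \<beta> q :: real
  assumes Q: "open Q"
    and f_cont: "continuous_on Q f" and f_int: "integrable (lebesgue_on Q) f"
    and G_int: "\<And>i. integrable (lebesgue_on Q) (G i)"
    and weak: "\<And>i. weak_partial Q i f (G i)"
    and g_meas [measurable]: "g \<in> borel_measurable borel"
    and g_bound: "AE x in lebesgue_on Q. (\<Sum>i\<in>UNIV. \<bar>G i x\<bar>) \<le> g x"
    and \<Gamma>_meas [measurable]: "\<Gamma> \<in> borel_measurable borel"
    and g_nonneg: "\<And>x. 0 \<le> g x" and \<Gamma>_nonneg: "\<And>x. 0 \<le> \<Gamma> x"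
    and \<alpha>\<beta>: "0 \<le> \<alpha>" "0 \<le> \<beta>"
    and young: "\<And>x a. x \<in> Q \<Longrightarrow> 0 \<le> a \<Longrightarrow> a * g x \<le> \<alpha> * a powr q + \<beta> * \<Gamma> x"
    and \<Gamma>_fin: "(\<integral>\<^sup>+x\<in>Q. \<Gamma> x \<partial>lborel) < \<infinity>"
begin

lemma Q_borel [measurable]: "Q \<in> sets borel" using Q by simp

lemma Q_lebesgue: "Q \<inter> space lebesgue \<in> sets lebesgue"
  using Q by (simp add: borel_open)

text \<open>Outside Q nothing is known about f. Extension by zero makes it Borel measurable and
  integrable on the whole space, so that Fubini and translation invariance of \<open>lborel\<close>
  are available.\<close>

definition f0 :: "real^'d \<Rightarrow> real" where "f0 y = indicator Q y * f y"

lemma f0_measurable [measurable]: "f0 \<in> borel_measurable borel"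
  using borel_measurable_continuous_on_indicator[OF Q_borel f_cont] unfolding f0_def by simp

lemma f0_integral:
  assumes [measurable]: "h \<in> borel_measurable borel"
  shows "(LINT x|lebesgue_on Q. f x * h x) = (LINT x|lborel. f0 x * h x)"
proof -
  have "(LINT x|lebesgue_on Q. f x * h x) = (LINT x|lebesgue. f0 x * h x)"
    using integral_restrict_space[OF Q_lebesgue, of "\<lambda>x. f x * h x"] by (simp add: f0_def mult.assoc)
  also have "\<dots> = (LINT x|lborel. f0 x * h x)" by (rule integral_completion) measurable
  finally show ?thesis .
qed

lemma f0_integrable: "integrable lborel f0"
proof -
  have "integrable lebesgue (\<lambda>x. indicator Q x *\<^sub>R f x)"
    using f_int integrable_restrict_space[OF Q_lebesgue, of f] by simp
  then have "integrable lebesgue f0" by (simp add: f0_def[abs_def])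
  then show ?thesis by (subst (asm) integrable_completion) measurable
qed

definition mollified :: "real \<Rightarrow> real^'d \<Rightarrow> real" where
  "mollified e x = (LINT y|lborel. f0 y * bump e (y - x))"

text \<open>The bound g is measurable and nonnegative; with values in \<open>ennreal\<close> its
  mollification makes sense without any integrability.\<close>

definition gmol :: "real \<Rightarrow> real^'d \<Rightarrow> ennreal" where
  "gmol e x = (\<integral>\<^sup>+y\<in>Q. ennreal (g y * bump e (y - x)) \<partial>lborel)"

lemma mollified_measurable [measurable]: "mollified e \<in> borel_measurable borel"
  unfolding mollified_def by measurable

lemma gmol_measurable [measurable]: "gmol e \<in> borel_measurable borel"
  unfolding gmol_def by measurable

lemma bump_bounds:
  obtains B where "\<And>x::real^'d. \<bar>bump e x\<bar> \<le> B" "\<And>i (x::real^'d). \<bar>partial_deriv i (bump e) x\<bar> \<le> B" "0 \<le> B"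
proof (cases "e > 0")
  case True
  then have "test_function UNIV (bump e :: real^'d \<Rightarrow> real)"
    using test_function_bump[of "0::real^'d" e UNIV] by simp
  then have "\<exists>B\<ge>0. (\<forall>x::real^'d. \<bar>bump e x\<bar> \<le> B) \<and> (\<forall>i. \<forall>x::real^'d. \<bar>partial_deriv i (bump e) x\<bar> \<le> B)"
    by (rule test_function_bounded) blast
  then show ?thesis using that by blast
next
  case False
  have "bump e = (\<lambda>x::real^'d. 0)"
  proof (intro ext bump_eq_0)
    fix x :: "real^'d" show "e \<le> infnorm x" using False infnorm_pos_le[of x] by linarith
  qed
  moreover from this have "partial_deriv i (bump e) = (\<lambda>x::real^'d. 0)" for i
    by (auto intro!: ext partial_derivI)
  ultimately show ?thesis using that[of 0] by auto
qed

text \<open>The bump about x is a test function because its support lies in Q, so the weak gradient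
  takes over the derivative. Then |\<Sum> v_i G_i| is at most infnorm v times the l1 norm of G: this
  duality is the reason why the l1 norm of the gradient goes with the maximum norm of the
  points.\<close>

lemma directional_bound:
  assumes e: "0 < e" "icube x e \<subseteq> Q"
  shows "ennreal \<bar>LINT y|lborel. f0 y * (\<Sum>i\<in>UNIV. v $ i * partial_deriv i (bump e) (y - x))\<bar>
    \<le> ennreal (infnorm v) * gmol e x"
proof -
  have [measurable]: "partial_deriv i (bump e) \<in> borel_measurable borel" for i :: 'd
    by (intro borel_measurable_continuous_onI bump_partial_continuous)
  have [measurable]: "(\<lambda>y. bump e (y - x)) \<in> borel_measurable lebesgue"
    "(\<lambda>y. bump e (y - x)) \<in> borel_measurable (lebesgue_on Q)"
    by (auto intro!: borel_measurable_continuous_onI measurable_restrict_space1 measurable_completion)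
  obtain B where B: "\<And>x::real^'d. \<bar>bump e x\<bar> \<le> B" "\<And>i x. \<bar>partial_deriv i (bump e) (x::real^'d)\<bar> \<le> B" "0 \<le> B"
    using bump_bounds by blast
  have int1: "integrable lborel (\<lambda>y. f0 y * partial_deriv i (bump e) (y - x))" for i
  proof (rule Bochner_Integration.integrable_bound[OF integrable_mult_right[OF f0_integrable, of B]])
    show "AE y in lborel. norm (f0 y * partial_deriv i (bump e) (y - x)) \<le> norm (B * f0 y)"
      by (intro AE_I2 norm_mult_bound B)
  qed measurable
  have int2: "integrable (lebesgue_on Q) (\<lambda>y. G i y * bump e (y - x))" for i
  proof (rule Bochner_Integration.integrable_bound[OF integrable_mult_right[OF G_int[of i], of B]])
    show "(\<lambda>y. G i y * bump e (y - x)) \<in> borel_measurable (lebesgue_on Q)"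
      using G_int[of i] by measurable
    show "AE y in lebesgue_on Q. norm (G i y * bump e (y - x)) \<le> norm (B * G i y)"
      by (intro AE_I2 norm_mult_bound B)
  qed
  have tf: "test_function Q (\<lambda>y. bump e (y - x))" by (rule test_function_bump[OF e(2,1)])
  have eq: "(LINT y|lborel. f0 y * partial_deriv i (bump e) (y - x)) = - (LINT y|lebesgue_on Q. G i y * bump e (y - x))" for i
  proof -
    have "(LINT y|lborel. f0 y * partial_deriv i (bump e) (y - x)) = (LINT y|lebesgue_on Q. f y * partial_deriv i (bump e) (y - x))"
      by (rule f0_integral[symmetric]) measurable
    also have "\<dots> = (LINT y|lebesgue_on Q. f y * partial_deriv i (\<lambda>y. bump e (y - x)) y)"
      by (simp add: partial_deriv_shift bump_differentiable)
    finally show ?thesis using weak[of i] tf by (simp add: weak_partial_def)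
  qed
  have "(LINT y|lborel. f0 y * (\<Sum>i\<in>UNIV. v $ i * partial_deriv i (bump e) (y - x)))
      = (\<Sum>i\<in>UNIV. v $ i * (LINT y|lborel. f0 y * partial_deriv i (bump e) (y - x)))"
    using int1 by (simp add: sum_distrib_left mult.left_commute Bochner_Integration.integral_sum)
  also have "\<dots> = (LINT y|lebesgue_on Q. (\<Sum>i\<in>UNIV. - (v $ i) * (G i y * bump e (y - x))))"
    using int2 by (simp add: eq Bochner_Integration.integral_sum)
  finally have "ennreal \<bar>LINT y|lborel. f0 y * (\<Sum>i\<in>UNIV. v $ i * partial_deriv i (bump e) (y - x))\<bar>
     = ennreal (norm (LINT y|lebesgue_on Q. (\<Sum>i\<in>UNIV. - (v $ i) * (G i y * bump e (y - x)))))" by simp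
  also have "\<dots> \<le> (\<integral>\<^sup>+y. ennreal (norm (\<Sum>i\<in>UNIV. - (v $ i) * (G i y * bump e (y - x)))) \<partial>lebesgue_on Q)"
    using int2 by (intro integral_norm_bound_ennreal Bochner_Integration.integrable_sum integrable_mult_right)
  also have "\<dots> \<le> (\<integral>\<^sup>+y. ennreal (infnorm v * (g y * bump e (y - x))) \<partial>lebesgue_on Q)"
  proof (rule nn_integral_mono_AE)
    show "AE y in lebesgue_on Q. ennreal (norm (\<Sum>i\<in>UNIV. - (v $ i) * (G i y * bump e (y - x)))) \<le> ennreal (infnorm v * (g y * bump e (y - x)))"
      using g_bound
    proof eventually_elim
      case (elim y)
      have "norm (\<Sum>i\<in>UNIV. - (v $ i) * (G i y * bump e (y - x))) \<le> (\<Sum>i\<in>UNIV. infnorm v * (\<bar>G i y\<bar> * bump e (y - x)))"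
        by (rule sum_norm_le) (auto simp: abs_mult bump_nonneg intro!: mult_mono component_le_infnorm_cart infnorm_pos_le)
      also have "\<dots> = infnorm v * ((\<Sum>i\<in>UNIV. \<bar>G i y\<bar>) * bump e (y - x))"
        by (simp add: sum_distrib_left sum_distrib_right)
      also have "\<dots> \<le> infnorm v * (g y * bump e (y - x))"
        by (intro mult_left_mono mult_right_mono elim infnorm_pos_le bump_nonneg)
      finally show ?case by (rule ennreal_leI)
    qed
  qed
  also have "\<dots> = (\<integral>\<^sup>+y. ennreal (infnorm v * (g y * bump e (y - x))) * indicator Q y \<partial>lebesgue)"
    by (rule nn_integral_restrict_space[OF Q_lebesgue])
  also have "\<dots> = (\<integral>\<^sup>+y. ennreal (infnorm v * (g y * bump e (y - x))) * indicator Q y \<partial>lborel)"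
    by (rule nn_integral_completion)
  also have "\<dots> = (\<integral>\<^sup>+y. ennreal (infnorm v) * (ennreal (g y * bump e (y - x)) * indicator Q y) \<partial>lborel)"
    using g_nonneg by (simp add: ennreal_mult infnorm_pos_le bump_nonneg mult.assoc)
  also have "\<dots> = ennreal (infnorm v) * gmol e x"
    unfolding gmol_def by (rule nn_integral_cmult) measurable
  finally show ?thesis .
qed

text \<open>The fundamental theorem of calculus is applied to the bump along the segment, for fixed
  y, and the order of integration is exchanged; thus the mollification itself never has to be
  differentiated.\<close>

lemma mollified_segment:
  assumes e: "0 < e" and seg: "\<And>s. 0 \<le> s \<Longrightarrow> s \<le> 1 \<Longrightarrow> icube (x + s *\<^sub>R v) e \<subseteq> Q"
  shows "ennreal \<bar>mollified e (x + v) - mollified e x\<bar>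
    \<le> ennreal (infnorm v) * (\<integral>\<^sup>+s\<in>{0<..<1}. gmol e (x + s *\<^sub>R v) \<partial>lborel)"
proof -
  have [measurable]: "partial_deriv i (bump e) \<in> borel_measurable borel" for i :: 'd
    by (intro borel_measurable_continuous_onI bump_partial_continuous)
  obtain B where B: "\<And>x::real^'d. \<bar>bump e x\<bar> \<le> B" "\<And>i x. \<bar>partial_deriv i (bump e) (x::real^'d)\<bar> \<le> B" "0 \<le> B"
    using bump_bounds by blast
  define b where "b s y = (\<Sum>i\<in>UNIV. v $ i * partial_deriv i (bump e) (y - (x + s *\<^sub>R v)))" for s y
  let ?C = "\<Sum>i\<in>UNIV. \<bar>v $ i\<bar> * B"
  have b_bound: "\<bar>b s y\<bar> \<le> ?C" for s y
    unfolding b_def by (rule order_trans[OF sum_abs]) (auto simp: abs_mult intro!: sum_mono mult_left_mono B)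
  have [measurable]: "(\<lambda>(y, s). b s y) \<in> borel_measurable (borel \<Otimes>\<^sub>M borel)"
    unfolding b_def by measurable
  have b_cont: "continuous_on A (\<lambda>s. b s y)" for A y
    unfolding b_def
    by (intro continuous_intros continuous_on_compose2[OF bump_partial_continuous[of UNIV]]) auto
  have ftc: "bump e (y - (x + v)) - bump e (y - x) = - (LINT s|lborel. indicator {0..1} s * b s y)" for y
  proof -
    have "((\<lambda>s. bump e (y - (x + s *\<^sub>R v))) has_vector_derivative - b s y) (at s within {0..1})" for s
    proof -
      have "(bump e has_derivative frechet_derivative (bump e) (at (y - (x + s *\<^sub>R v)))) (at (y - (x + s *\<^sub>R v)))"
        using bump_differentiable frechet_derivative_works by blast
      then have "((\<lambda>s. bump e (y - (x + s *\<^sub>R v))) has_derivative (\<lambda>h. frechet_derivative (bump e) (at (y - (x + s *\<^sub>R v))) (- (h *\<^sub>R v)))) (at s within {0..1})"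
        by (rule has_derivative_compose[where f = "\<lambda>s. y - (x + s *\<^sub>R v)", rotated]) (auto intro!: derivative_eq_intros)
      moreover have "frechet_derivative (bump e) (at (y - (x + s *\<^sub>R v))) (- (h *\<^sub>R v)) = h * - b s y" for h
        by (simp add: partial_deriv_sum[OF bump_differentiable] b_def sum_distrib_left sum_negf mult.assoc)
      ultimately show ?thesis by (simp add: has_vector_derivative_def)
    qed
    from integral_FTC_Icc[of 0 1 "\<lambda>s. bump e (y - (x + s *\<^sub>R v))" "\<lambda>s. - b s y", OF _ this]
    show ?thesis using b_cont by (simp add: continuous_on_minus)
  qed
  have prod_int: "integrable (lborel \<Otimes>\<^sub>M lborel) (\<lambda>(y, s). f0 y * (indicator {0..1} s * b s y))"
  proof (rule lborel_pair.Fubini_integrable)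
    show "(\<lambda>(y, s). f0 y * (indicator {0..1} s * b s y)) \<in> borel_measurable (lborel \<Otimes>\<^sub>M lborel)"
      by measurable
    have si: "integrable lborel (\<lambda>s. indicator {0..1} s * b s y)" for y
      using borel_integrable_atLeastAtMost'[OF b_cont, of 0 1 y] by (simp add: set_integrable_def)
    show "AE y in lborel. integrable lborel (\<lambda>s. case (y, s) of (y, s) \<Rightarrow> f0 y * (indicator {0..1} s * b s y))"
      using si by auto
    show "integrable lborel (\<lambda>y. LINT s|lborel. norm (case (y, s) of (y, s) \<Rightarrow> f0 y * (indicator {0..1} s * b s y)))"
    proof (rule Bochner_Integration.integrable_bound[OF integrable_mult_right[OF f0_integrable, of ?C]])
      show "AE y in lborel. norm (LINT s|lborel. norm (case (y, s) of (y, s) \<Rightarrow> f0 y * (indicator {0..1} s * b s y))) \<le> norm (?C * f0 y)"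
      proof (rule AE_I2)
        fix y
        have "(LINT s|lborel. norm (f0 y * (indicator {0..1} s * b s y))) \<le> (LINT s|lborel. indicator {0..1::real} s * (?C * \<bar>f0 y\<bar>))"
        proof (rule Bochner_Integration.integral_mono)
          show "integrable lborel (\<lambda>s. norm (f0 y * (indicator {0..1} s * b s y)))" using si by auto
          fix s :: real
          have "\<bar>f0 y\<bar> * \<bar>b s y\<bar> \<le> ?C * \<bar>f0 y\<bar>" by (subst mult.commute, rule mult_right_mono[OF b_bound]) simp
          then show "norm (f0 y * (indicator {0..1} s * b s y)) \<le> indicator {0..1} s * (?C * \<bar>f0 y\<bar>)"
            by (auto simp: abs_mult indicator_def)
        qed (auto intro!: integrable_mult_left)
        also have "\<dots> = ?C * \<bar>f0 y\<bar>" by simp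
        finally show "norm (LINT s|lborel. norm (case (y, s) of (y, s) \<Rightarrow> f0 y * (indicator {0..1} s * b s y))) \<le> norm (?C * f0 y)"
          using B(3) by (simp add: abs_mult sum_nonneg)
      qed
    qed measurable
  qed
  have "mollified e (x + v) - mollified e x = (LINT y|lborel. f0 y * (bump e (y - (x + v)) - bump e (y - x)))"
  proof -
    have "integrable lborel (\<lambda>y. f0 y * bump e (y - z))" for z
    proof (rule Bochner_Integration.integrable_bound[OF integrable_mult_right[OF f0_integrable, of B]])
      show "AE y in lborel. norm (f0 y * bump e (y - z)) \<le> norm (B * f0 y)"
        by (intro AE_I2 norm_mult_bound B)
    qed measurable
    then show ?thesis unfolding mollified_def right_diff_distrib by simp
  qed
  also have "\<dots> = - (LINT y|lborel. (LINT s|lborel. f0 y * (indicator {0..1} s * b s y)))"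
    by (simp add: ftc)
  also have "\<dots> = - (LINT s|lborel. (LINT y|lborel. f0 y * (indicator {0..1} s * b s y)))"
    using lborel_pair.Fubini_integral[OF prod_int] by simp
  also have "\<dots> = - (LINT s|lborel. indicator {0..1} s * (LINT y|lborel. f0 y * b s y))"
    by (simp add: mult.left_commute[of "f0 _"])
  finally have "ennreal \<bar>mollified e (x + v) - mollified e x\<bar> = ennreal (norm (LINT s|lborel. indicator {0..1} s * (LINT y|lborel. f0 y * b s y)))"
    by simp
  also have "\<dots> \<le> (\<integral>\<^sup>+s. ennreal (norm (indicator {0..1} s * (LINT y|lborel. f0 y * b s y))) \<partial>lborel)"
  proof (rule integral_norm_bound_ennreal)
    show "integrable lborel (\<lambda>s. indicator {0..1} s * (LINT y|lborel. f0 y * b s y))"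
      using lborel_pair.integrable_snd[OF prod_int] by (simp add: mult.left_commute[of "f0 _"])
  qed
  also have "\<dots> \<le> (\<integral>\<^sup>+s. ennreal (infnorm v) * (gmol e (x + s *\<^sub>R v) * indicator {0<..<1} s) \<partial>lborel)"
  proof (rule nn_integral_mono_AE)
    show "AE s in lborel. ennreal (norm (indicator {0..1} s * (LINT y|lborel. f0 y * b s y))) \<le> ennreal (infnorm v) * (gmol e (x + s *\<^sub>R v) * indicator {0<..<1} s)"
      using AE_lborel_singleton[of "0::real"] AE_lborel_singleton[of "1::real"]
    proof eventually_elim
      case (elim s)
      show ?case
      proof (cases "0 < s \<and> s < 1")
        case True
        then have "ennreal \<bar>LINT y|lborel. f0 y * b s y\<bar> \<le> ennreal (infnorm v) * gmol e (x + s *\<^sub>R v)"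
          unfolding b_def by (intro directional_bound e seg) auto
        then show ?thesis using True by simp
      qed (use elim in \<open>auto simp: indicator_def\<close>)
    qed
  qed
  also have "\<dots> = ennreal (infnorm v) * (\<integral>\<^sup>+s\<in>{0<..<1}. gmol e (x + s *\<^sub>R v) \<partial>lborel)"
    by (rule nn_integral_cmult) measurable
  finally show ?thesis .
qed


definition bump_mass :: "real \<Rightarrow> real" where
  "bump_mass e = (LINT v|(lborel::(real^'d) measure). bump e v)"

lemma bump_integrable: "0 < e \<Longrightarrow> integrable lborel (bump e :: real^'d \<Rightarrow> real)"
proof (rule Bochner_Integration.integrable_bound)
  assume e: "0 < e"
  have "emeasure lborel (icube (0::real^'d) e) < \<infinity>" using e by (simp add: emeasure_icube)
  then show "integrable lborel (indicator (icube (0::real^'d) e) :: _ \<Rightarrow> real)"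
    by (simp add: integrable_indicator_iff less_top)
  show "AE v::real^'d in lborel. norm (bump e v) \<le> norm (indicator (icube 0 e) v :: real)"
  proof (rule AE_I2)
    fix v :: "real^'d"
    show "norm (bump e v) \<le> norm (indicator (icube 0 e) v :: real)"
      using bump_le_1[OF e, of v] bump_eq_0[of e v] bump_nonneg[of e v]
      by (cases "infnorm v \<le> e") (auto simp: icube_def)
  qed
qed measurable

lemma nn_integral_bump: "0 < e \<Longrightarrow> (\<integral>\<^sup>+v. ennreal (bump e v) \<partial>(lborel::(real^'d) measure)) = ennreal (bump_mass e)"
  unfolding bump_mass_def by (intro nn_integral_eq_integral bump_integrable) (auto simp: bump_nonneg)

lemma bump_mass_pos: "0 < e \<Longrightarrow> 0 < bump_mass e"
proof (rule ccontr)
  assume e: "0 < e" "\<not> 0 < bump_mass e"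
  then have "(\<integral>\<^sup>+v. ennreal (bump e v) \<partial>(lborel::(real^'d) measure)) = 0"
    using nn_integral_bump by (simp add: ennreal_neg)
  then have "AE v::real^'d in lborel. bump e v \<le> 0"
    by (subst (asm) nn_integral_0_iff_AE) (auto simp: ennreal_eq_0_iff)
  then have "AE v::real^'d in lborel. v \<notin> icube 0 (e/2)"
  proof eventually_elim
    case (elim v)
    then have "e \<le> infnorm v" using bump_pos_iff[of e v] by linarith
    then show ?case using e by (simp add: icube_def)
  qed
  then have "emeasure lborel (icube (0::real^'d) (e/2)) = 0"
    by (subst (asm) AE_iff_measurable[OF _ refl]) auto
  then show False using e by (simp add: emeasure_icube)
qed

lemma integral_bump_shift: "(LINT y|(lborel::(real^'d) measure). bump e (y - x)) = bump_mass e"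
  unfolding bump_mass_def
  using shift_lborel(2)[of "bump e" "- x"] by simp

lemma mollified_approx:
  assumes e: "0 < e" "icube x e \<subseteq> Q" and osc: "\<And>y. infnorm (y - x) \<le> e \<Longrightarrow> \<bar>f y - f x\<bar> \<le> \<delta>"
  shows "\<bar>mollified e x - bump_mass e * f x\<bar> \<le> bump_mass e * \<delta>"
proof -
  have int: "integrable lborel (\<lambda>y. bump e (y - x))"
    using shift_lborel(1)[of "bump e" "- x"] bump_integrable[OF e(1)] by simp
  have eq: "f0 y * bump e (y - x) = f y * bump e (y - x)" for y
  proof (cases "y \<in> Q")
    case False
    then have "\<not> infnorm (y - x) \<le> e" using e by (auto simp: icube_def)
    then show ?thesis by (simp add: bump_eq_0)
  qed (simp add: f0_def)
  obtain B where B: "\<And>x::real^'d. \<bar>bump e x\<bar> \<le> B" "\<And>i (x::real^'d). \<bar>partial_deriv i (bump e) x\<bar> \<le> B" "0 \<le> B"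
    using bump_bounds by blast
  have int2: "integrable lborel (\<lambda>y. f0 y * bump e (y - x))"
  proof (rule Bochner_Integration.integrable_bound[OF integrable_mult_right[OF f0_integrable, of B]])
    show "AE y in lborel. norm (f0 y * bump e (y - x)) \<le> norm (B * f0 y)"
      by (intro AE_I2 norm_mult_bound B)
  qed measurable
  have "mollified e x - bump_mass e * f x = (LINT y|lborel. f0 y * bump e (y - x)) - (LINT y|lborel. f x * bump e (y - x))"
    by (simp add: mollified_def integral_bump_shift mult.commute)
  also have "\<dots> = (LINT y|lborel. f0 y * bump e (y - x) - f x * bump e (y - x))"
    using int int2 by (intro Bochner_Integration.integral_diff[symmetric]) auto
  finally have "\<bar>mollified e x - bump_mass e * f x\<bar> = norm (LINT y|lborel. f0 y * bump e (y - x) - f x * bump e (y - x))" by simp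
  also have "\<dots> \<le> (LINT y|lborel. \<delta> * bump e (y - x))"
  proof (rule Bochner_Integration.integral_norm_bound_integral)
    show "integrable lborel (\<lambda>y. f0 y * bump e (y - x) - f x * bump e (y - x))" using int int2 by auto
    show "integrable lborel (\<lambda>y. \<delta> * bump e (y - x))" using int by auto
    fix y
    show "norm (f0 y * bump e (y - x) - f x * bump e (y - x)) \<le> \<delta> * bump e (y - x)"
    proof (cases "infnorm (y - x) \<le> e")
      case True
      have "norm (f y * bump e (y - x) - f x * bump e (y - x)) = \<bar>f y - f x\<bar> * bump e (y - x)"
        by (simp add: left_diff_distrib[symmetric] abs_mult bump_nonneg)
      also have "\<dots> \<le> \<delta> * bump e (y - x)" by (intro mult_right_mono osc True bump_nonneg)
      finally show ?thesis by (simp add: eq)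
    qed (simp add: bump_eq_0)
  qed
  also have "\<dots> = bump_mass e * \<delta>" by (simp add: integral_bump_shift)
  finally show ?thesis .
qed

context
  fixes T :: "(real^'d) set" and x0 :: "real^'d" and R :: real
  assumes T: "compact T" "T \<subseteq> Q" "T \<subseteq> icube x0 R" and R: "0 < R"
    and star: "\<And>z s. z \<in> T \<Longrightarrow> 0 \<le> s \<Longrightarrow> s \<le> 1 \<Longrightarrow> x0 + s *\<^sub>R (z - x0) \<in> T"
begin

lemma T_borel [measurable]: "T \<in> sets borel"
  using T by (simp add: borel_compact)

text \<open>Segments from x0 to points of T stay in T, so \<open>gmol\<close> may be cut off outside
  T before \<open>radial_kernel\<close> is applied. Writing \<open>gmol\<close> as an integral over
  shifts u, Young's inequality is used for each u separately, with the unshifted kernel and g at the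
  shifted point. That point stays in the e-neighbourhood of T, and translation invariance removes u
  from the integral of \<Gamma>.\<close>

lemma mollified_poincare:
  assumes e: "0 < e" "thick T e \<subseteq> Q"
  shows "(\<integral>\<^sup>+z\<in>T. ennreal \<bar>mollified e z - mollified e x0\<bar> \<partial>lborel)
     \<le> ennreal (bump_mass e) * (ennreal \<alpha> * (\<integral>\<^sup>+y\<in>icube x0 R. ennreal (kern R (y - x0) powr q) \<partial>lborel)
        + ennreal \<beta> * (\<integral>\<^sup>+y\<in>thick T e. ennreal (\<Gamma> y) \<partial>lborel))"
    (is "_ \<le> _ * (_ * ?K + _ * ?L)")
proof -
  let ?H = "\<lambda>x. gmol e x * indicator T x"
  have [measurable]: "thick T e \<in> sets borel" using T by (simp add: borel_compact thick_compact)
  have icT: "icube x e \<subseteq> Q" if "x \<in> T" for x using that e by (auto simp: icube_def thick_def)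
  have "(\<integral>\<^sup>+z\<in>T. ennreal \<bar>mollified e z - mollified e x0\<bar> \<partial>lborel)
     = (\<integral>\<^sup>+w. ennreal \<bar>mollified e (x0 + w) - mollified e x0\<bar> * indicator T (x0 + w) \<partial>lborel)"
  proof (rule nn_integral_translate[symmetric])
    show "(\<lambda>x. ennreal \<bar>mollified e x - mollified e x0\<bar> * indicator T x) \<in> borel_measurable borel"
      by measurable
  qed
  also have "\<dots> \<le> (\<integral>\<^sup>+w\<in>icube 0 R. (ennreal (infnorm w) * (\<integral>\<^sup>+s\<in>{0<..<1}. ?H (x0 + s *\<^sub>R w) \<partial>lborel)) \<partial>lborel)"
  proof (rule nn_integral_mono)
    fix w
    show "ennreal \<bar>mollified e (x0 + w) - mollified e x0\<bar> * indicator T (x0 + w)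
      \<le> ennreal (infnorm w) * (\<integral>\<^sup>+s\<in>{0<..<1}. ?H (x0 + s *\<^sub>R w) \<partial>lborel) * indicator (icube 0 R) w"
    proof (cases "x0 + w \<in> T")
      case True
      have st: "x0 + s *\<^sub>R w \<in> T" if "0 \<le> s" "s \<le> 1" for s using star[OF True that] by simp
      have "ennreal \<bar>mollified e (x0 + w) - mollified e x0\<bar> \<le> ennreal (infnorm w) * (\<integral>\<^sup>+s\<in>{0<..<1}. gmol e (x0 + s *\<^sub>R w) \<partial>lborel)"
        using st icT by (intro mollified_segment e) auto
      also have "(\<integral>\<^sup>+s\<in>{0<..<1}. gmol e (x0 + s *\<^sub>R w) \<partial>lborel) = (\<integral>\<^sup>+s\<in>{0<..<1}. ?H (x0 + s *\<^sub>R w) \<partial>lborel)"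
        using st by (intro nn_integral_cong) (auto simp: indicator_def)
      finally show ?thesis using True T(3) by (auto simp: icube_def)
    qed simp
  qed
  also have "\<dots> = (\<integral>\<^sup>+w\<in>icube 0 R. (ennreal (kern R w) * ?H (x0 + w)) \<partial>lborel)"
    by (rule radial_kernel[OF _ R]) measurable
  also have "\<dots> = (\<integral>\<^sup>+w. (\<integral>\<^sup>+u. ennreal (bump e u) * (ennreal (kern R w) * ennreal (g (x0 + w + u)) * indicator Q (x0 + w + u) * indicator T (x0 + w) * indicator (icube 0 R) w) \<partial>lborel) \<partial>lborel)"
  proof (rule nn_integral_cong)
    fix w
    have "gmol e (x0 + w) = (\<integral>\<^sup>+u. ennreal (g (x0 + w + u) * bump e u) * indicator Q (x0 + w + u) \<partial>lborel)"
      unfolding gmol_def by (subst nn_integral_translate[where t = "x0 + w", symmetric]) auto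
    then have "ennreal (kern R w) * ?H (x0 + w) * indicator (icube 0 R) w
       = ennreal (kern R w) * indicator T (x0 + w) * indicator (icube 0 R) w * (\<integral>\<^sup>+u. ennreal (g (x0 + w + u) * bump e u) * indicator Q (x0 + w + u) \<partial>lborel)"
      by (simp add: mult_ac)
    also have "\<dots> = (\<integral>\<^sup>+u. ennreal (kern R w) * indicator T (x0 + w) * indicator (icube 0 R) w * (ennreal (g (x0 + w + u) * bump e u) * indicator Q (x0 + w + u)) \<partial>lborel)"
      by (rule nn_integral_cmult[symmetric]) measurable
    finally show "ennreal (kern R w) * ?H (x0 + w) * indicator (icube 0 R) w =
      (\<integral>\<^sup>+u. ennreal (bump e u) * (ennreal (kern R w) * ennreal (g (x0 + w + u)) * indicator Q (x0 + w + u) * indicator T (x0 + w) * indicator (icube 0 R) w) \<partial>lborel)"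
      by (simp add: ennreal_mult g_nonneg bump_nonneg mult_ac)
  qed
  also have "\<dots> = (\<integral>\<^sup>+u. (\<integral>\<^sup>+w. ennreal (bump e u) * (ennreal (kern R w) * ennreal (g (x0 + w + u)) * indicator Q (x0 + w + u) * indicator T (x0 + w) * indicator (icube 0 R) w) \<partial>lborel) \<partial>lborel)"
    by (rule lborel_pair.Fubini'[symmetric]) measurable
  also have "\<dots> \<le> (\<integral>\<^sup>+u. ennreal (bump e u) * (ennreal \<alpha> * ?K + ennreal \<beta> * ?L) \<partial>(lborel::(real^'d) measure))"
  proof (rule nn_integral_mono)
    fix u :: "real^'d"
    have "(\<integral>\<^sup>+w. (ennreal (kern R w) * ennreal (g (x0 + w + u)) * indicator Q (x0 + w + u) * indicator T (x0 + w) * indicator (icube 0 R) w) \<partial>lborel) \<le> ennreal \<alpha> * ?K + ennreal \<beta> * ?L" if u: "infnorm u \<le> e"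
    proof -
      have "(\<integral>\<^sup>+w. (ennreal (kern R w) * ennreal (g (x0 + w + u)) * indicator Q (x0 + w + u) * indicator T (x0 + w) * indicator (icube 0 R) w) \<partial>lborel)
       \<le> (\<integral>\<^sup>+w. ennreal \<alpha> * (ennreal (kern R w powr q) * indicator (icube 0 R) w) + ennreal \<beta> * (ennreal (\<Gamma> (x0 + u + w)) * indicator (thick T e) (x0 + u + w)) \<partial>lborel)"
      proof (rule nn_integral_mono)
        fix w
        show "ennreal (kern R w) * ennreal (g (x0 + w + u)) * indicator Q (x0 + w + u) * indicator T (x0 + w) * indicator (icube 0 R) w
          \<le> ennreal \<alpha> * (ennreal (kern R w powr q) * indicator (icube 0 R) w) + ennreal \<beta> * (ennreal (\<Gamma> (x0 + u + w)) * indicator (thick T e) (x0 + u + w))"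
        proof (cases "x0 + w \<in> T \<and> infnorm w \<le> R")
          case True
          then have th: "x0 + w + u \<in> thick T e" using u by (auto simp: thick_def intro!: bexI[of _ "x0 + w"])
          then have inQ: "x0 + w + u \<in> Q" using e by auto
          have k: "0 \<le> kern R w" using True by (intro rkern_nonneg infnorm_pos_le) auto
          have "ennreal (kern R w) * ennreal (g (x0 + w + u)) = ennreal (kern R w * g (x0 + w + u))"
            using k g_nonneg by (simp add: ennreal_mult)
          also have "\<dots> \<le> ennreal (\<alpha> * kern R w powr q + \<beta> * \<Gamma> (x0 + w + u))"
            by (intro ennreal_leI young inQ k)
          also have "\<dots> = ennreal \<alpha> * ennreal (kern R w powr q) + ennreal \<beta> * ennreal (\<Gamma> (x0 + w + u))"
            using \<alpha>\<beta> \<Gamma>_nonneg by (simp add: ennreal_mult)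
          finally show ?thesis using True th inQ by (simp add: icube_def add_ac)
        qed (auto simp: icube_def indicator_def)
      qed
      also have "\<dots> = ennreal \<alpha> * (\<integral>\<^sup>+w\<in>icube 0 R. ennreal (kern R w powr q) \<partial>(lborel::(real^'d) measure)) + ennreal \<beta> * (\<integral>\<^sup>+w. ennreal (\<Gamma> (x0 + u + w)) * indicator (thick T e) (x0 + u + w) \<partial>lborel)"
        by (simp add: nn_integral_add nn_integral_cmult)
      also have "(\<integral>\<^sup>+w\<in>icube 0 R. ennreal (kern R w powr q) \<partial>(lborel::(real^'d) measure)) = ?K"
        by (rule nn_integral_icube_translate[symmetric]) measurable
      also have "(\<integral>\<^sup>+w. ennreal (\<Gamma> (x0 + u + w)) * indicator (thick T e) (x0 + u + w) \<partial>lborel) = ?L"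
        by (rule nn_integral_translate) measurable
      finally show ?thesis .
    qed
    note main = this
    have "(\<integral>\<^sup>+w. ennreal (bump e u) * (ennreal (kern R w) * ennreal (g (x0 + w + u)) * indicator Q (x0 + w + u) * indicator T (x0 + w) * indicator (icube 0 R) w) \<partial>lborel)
      = ennreal (bump e u) * (\<integral>\<^sup>+w. (ennreal (kern R w) * ennreal (g (x0 + w + u)) * indicator Q (x0 + w + u) * indicator T (x0 + w) * indicator (icube 0 R) w) \<partial>lborel)"
      by (rule nn_integral_cmult) measurable
    also have "\<dots> \<le> ennreal (bump e u) * (ennreal \<alpha> * ?K + ennreal \<beta> * ?L)"
      using main bump_eq_0[of e u] by (cases "infnorm u \<le> e") (auto intro: mult_left_mono)
    finally show "(\<integral>\<^sup>+w. ennreal (bump e u) * (ennreal (kern R w) * ennreal (g (x0 + w + u)) * indicator Q (x0 + w + u) * indicator T (x0 + w) * indicator (icube 0 R) w) \<partial>lborel)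
      \<le> ennreal (bump e u) * (ennreal \<alpha> * ?K + ennreal \<beta> * ?L)" .
  qed
  also have "\<dots> = ennreal (bump_mass e) * (ennreal \<alpha> * ?K + ennreal \<beta> * ?L)"
    by (simp add: nn_integral_multc nn_integral_bump e)
  finally show ?thesis .
qed

text \<open>
  Mollification is needed because only the weak gradient is available; Young's inequality is applied
  before the mollification parameter tends to zero, so that only \<open>\<integral> \<Gamma>\<close> over shrinking neighbourhoods
  of \<open>T\<close> has to converge.
\<close>

lemma star_poincare:
  "(\<integral>\<^sup>+z\<in>T. ennreal \<bar>f z - f x0\<bar> \<partial>lborel)
     \<le> ennreal \<alpha> * (\<integral>\<^sup>+y\<in>icube x0 R. ennreal (kern R (y - x0) powr q) \<partial>lborel)
        + ennreal \<beta> * (\<integral>\<^sup>+y\<in>T. ennreal (\<Gamma> y) \<partial>lborel)"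
    (is "?I \<le> _ * ?K + _ * ?L T")
proof (cases "T = {}")
  case False
  then obtain z0 where "z0 \<in> T" by auto
  from star[OF this, of 0] have x0: "x0 \<in> T" by simp
  obtain e0 where e0: "0 < e0" "thick T e0 \<subseteq> Q" using thick_subset_open[OF T(1) Q T(2)] .
  let ?e = "\<lambda>n. e0 / real (Suc n)"
  have e: "0 < ?e n" "?e n \<le> e0" for n using e0 by (auto simp: field_simps)
  have eQ: "thick T (?e n) \<subseteq> Q" for n using thick_mono[OF e(2)] e0 by blast
  have I0: "?I = (\<integral>\<^sup>+z\<in>T. ennreal \<bar>f0 z - f x0\<bar> \<partial>lborel)"
    using T by (intro nn_integral_cong) (auto simp: f0_def indicator_def)
  have lim: "(\<lambda>n. ennreal \<alpha> * ?K + ennreal \<beta> * ?L (thick T (?e n)) + ennreal \<eta>) \<longlonglongrightarrow> ennreal \<alpha> * ?K + ennreal \<beta> * ?L T + ennreal \<eta>" for \<eta>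
  proof (intro tendsto_add tendsto_const ennreal_tendsto_cmult)
    have "?L (thick T e0) \<le> (\<integral>\<^sup>+x\<in>Q. \<Gamma> x \<partial>lborel)"
      using e0 by (intro nn_integral_mono) (auto simp: indicator_def)
    then show "(\<lambda>n. ?L (thick T (?e n))) \<longlonglongrightarrow> ?L T"
      using \<Gamma>_fin by (intro thick_approx T e0) auto
  qed simp
  have ucont: "uniformly_continuous_on (thick T e0) f"
    by (rule compact_uniformly_continuous[OF continuous_on_subset[OF f_cont e0(2)] thick_compact[OF T(1)]])
  have "emeasure lborel T < \<infinity>" by (rule emeasure_bounded_finite[OF compact_imp_bounded[OF T(1)]])
  then obtain m where m: "emeasure lborel T = ennreal m" "0 \<le> m"
    by (metis ennreal_cases infinity_ennreal_def less_irrefl)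
  show ?thesis
  proof (rule ennreal_le_epsilon)
    fix \<eta> :: real assume \<eta>: "0 < \<eta>"
    \<comment> \<open>Replacing f by its mollification at z and at x0 costs 2 \<delta> m, with m the
      measure of T; this has to be at most \<eta>, and the summand 1 covers m = 0.\<close>
    define \<delta> where "\<delta> = \<eta> / (2 * m + 1)"
    have \<delta>: "0 < \<delta>" using \<eta> m by (simp add: \<delta>_def)
    have "2 * \<delta> * m = \<eta> * (2 * m / (2 * m + 1))" by (simp add: \<delta>_def)
    also have "\<dots> \<le> \<eta> * 1" using \<eta> m by (intro mult_left_mono) auto
    finally have \<delta>m: "2 * \<delta> * m \<le> \<eta>" by simp
    obtain \<rho> where \<rho>: "0 < \<rho>" "\<And>x y. x \<in> thick T e0 \<Longrightarrow> y \<in> thick T e0 \<Longrightarrow> dist y x < \<rho> \<Longrightarrow> dist (f y) (f x) < \<delta>"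
      using ucont \<delta> unfolding uniformly_continuous_on_def by metis
    have ev: "eventually (\<lambda>n. sqrt DIM(real^'d) * ?e n < \<rho>) sequentially"
    proof (rule order_tendstoD(2)[OF _ \<rho>(1)])
      have "(\<lambda>n. sqrt DIM(real^'d) * e0 * inverse (real (Suc n))) \<longlonglongrightarrow> 0"
        using LIMSEQ_inverse_real_of_nat tendsto_mult_right_zero by blast
      then show "(\<lambda>n. sqrt DIM(real^'d) * ?e n) \<longlonglongrightarrow> 0" by (simp add: divide_inverse mult.assoc)
    qed
    show "?I \<le> ennreal \<alpha> * ?K + ennreal \<beta> * ?L T + ennreal \<eta>"
    proof (rule tendsto_lowerbound[OF lim])
      show "\<forall>\<^sub>F n in sequentially. ?I \<le> ennreal \<alpha> * ?K + ennreal \<beta> * ?L (thick T (?e n)) + ennreal \<eta>"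
        using ev
      proof eventually_elim
        case (elim n)
        let ?c = "bump_mass (?e n)"
        have c: "0 < ?c" using bump_mass_pos e by blast
        have appr: "\<bar>mollified (?e n) x - ?c * f x\<bar> \<le> ?c * \<delta>" if x: "x \<in> T" for x
        proof (rule mollified_approx[OF e(1)])
          show "icube x (?e n) \<subseteq> Q" using x eQ[of n] by (auto simp: icube_def thick_def)
          fix y assume y: "infnorm (y - x) \<le> ?e n"
          then have "y \<in> thick T e0" using x e(2)[of n] by (auto simp: thick_def intro!: bexI[of _ x])
          moreover have "x \<in> thick T e0" using x e0 subset_thick[of e0 T] by auto
          moreover have "dist y x < \<rho>"
          proof -
            have "dist y x \<le> sqrt DIM(real^'d) * infnorm (y - x)" using norm_le_infnorm[of "y - x"] by (simp add: dist_norm)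
            also have "\<dots> \<le> sqrt DIM(real^'d) * ?e n" using y by (intro mult_left_mono) auto
            finally show ?thesis using elim by linarith
          qed
          ultimately show "\<bar>f y - f x\<bar> \<le> \<delta>" using \<rho>(2)[of x y] by (simp add: dist_norm)
        qed
        \<comment> \<open>The bump has mass \<open>?c\<close> instead of 1, so the inequality is
          proved with this factor, which is cancelled at the end.\<close>
        have "ennreal ?c * ?I = (\<integral>\<^sup>+z. ennreal ?c * (ennreal \<bar>f0 z - f x0\<bar> * indicator T z) \<partial>lborel)"
          unfolding I0 by (rule nn_integral_cmult[symmetric]) measurable
        also have "\<dots> \<le> (\<integral>\<^sup>+z. ennreal \<bar>mollified (?e n) z - mollified (?e n) x0\<bar> * indicator T z + ennreal (2 * ?c * \<delta>) * indicator T z \<partial>lborel)"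
        proof (rule nn_integral_mono)
          fix z
          show "ennreal ?c * (ennreal \<bar>f0 z - f x0\<bar> * indicator T z) \<le> ennreal \<bar>mollified (?e n) z - mollified (?e n) x0\<bar> * indicator T z + ennreal (2 * ?c * \<delta>) * indicator T z"
          proof (cases "z \<in> T")
            case True
            then have f0: "f0 z = f z" using T by (auto simp: f0_def)
            have "?c * \<bar>f z - f x0\<bar> = \<bar>?c * f z - ?c * f x0\<bar>" using c by (simp add: right_diff_distrib[symmetric] abs_mult)
            also have "\<dots> \<le> \<bar>mollified (?e n) z - mollified (?e n) x0\<bar> + 2 * ?c * \<delta>"
              using appr[OF True] appr[OF x0] by linarith
            finally have "ennreal (?c * \<bar>f z - f x0\<bar>) \<le> ennreal (\<bar>mollified (?e n) z - mollified (?e n) x0\<bar> + 2 * ?c * \<delta>)"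
              by (rule ennreal_leI)
            then show ?thesis using True c \<delta> by (simp add: f0 ennreal_mult)
          qed simp
        qed
        also have "\<dots> = (\<integral>\<^sup>+z\<in>T. ennreal \<bar>mollified (?e n) z - mollified (?e n) x0\<bar> \<partial>lborel) + ennreal (2 * ?c * \<delta>) * ennreal m"
          by (subst nn_integral_add) (auto simp: nn_integral_cmult_indicator m)
        also have "\<dots> \<le> ennreal ?c * (ennreal \<alpha> * ?K + ennreal \<beta> * ?L (thick T (?e n))) + ennreal ?c * ennreal \<eta>"
        proof (rule add_mono)
          show "(\<integral>\<^sup>+z\<in>T. ennreal \<bar>mollified (?e n) z - mollified (?e n) x0\<bar> \<partial>lborel) \<le> ennreal ?c * (ennreal \<alpha> * ?K + ennreal \<beta> * ?L (thick T (?e n)))"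
            by (rule mollified_poincare[OF e(1) eQ])
          have "2 * ?c * \<delta> * m \<le> ?c * \<eta>" using mult_left_mono[OF \<delta>m, of ?c] c by (simp add: mult_ac)
          then have "ennreal (2 * ?c * \<delta> * m) \<le> ennreal (?c * \<eta>)" by (rule ennreal_leI)
          then show "ennreal (2 * ?c * \<delta>) * ennreal m \<le> ennreal ?c * ennreal \<eta>"
            using c \<delta> m \<eta> by (simp add: ennreal_mult[symmetric])
        qed
        also have "\<dots> = ennreal ?c * (ennreal \<alpha> * ?K + ennreal \<beta> * ?L (thick T (?e n)) + ennreal \<eta>)"
          by (simp add: distrib_left)
        finally show ?case using c by (subst (asm) ennreal_mult_le_mult_iff) auto
      qed
    qed simp
  qed
qed simp

end

end

subsection \<open>Star domains\<close>

lemma star_domainE: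
  assumes "star_domain (Q :: (real^'d) set)"
  obtains c r D where "0 < r" "0 < D" "icube c r \<subseteq> Q" "\<And>x. x \<in> Q \<Longrightarrow> infnorm (x - c) \<le> D"
    "\<And>x y s. x \<in> Q \<Longrightarrow> y \<in> icube c r \<Longrightarrow> 0 \<le> s \<Longrightarrow> s \<le> 1 \<Longrightarrow> x + s *\<^sub>R (y - x) \<in> Q"
proof -
  obtain c r where r: "0 < r" and seg: "\<And>x y. x \<in> Q \<Longrightarrow> y \<in> ball c r \<Longrightarrow> closed_segment x y \<subseteq> Q"
    and Q: "open Q" "bounded Q" "Q \<noteq> {}"
    using assms unfolding star_domain_def by blast
  obtain e where e: "0 < e" "thick {c} e \<subseteq> ball c r"
    using thick_subset_open[of "{c}" "ball c r"] r by auto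
  then have ic: "icube c e \<subseteq> ball c r" by (simp add: thick_def icube_def)
  have st: "x + s *\<^sub>R (y - x) \<in> Q" if "x \<in> Q" "y \<in> icube c e" "0 \<le> s" "s \<le> 1" for x y s
  proof -
    have "x + s *\<^sub>R (y - x) \<in> closed_segment x y"
      using that by (auto simp: closed_segment_def algebra_simps intro!: exI[of _ s])
    then show ?thesis using seg[of x y] that ic by blast
  qed
  obtain B where B: "\<And>x. x \<in> Q \<Longrightarrow> norm (x - c) \<le> B"
    using bounded_translation[OF Q(2), of "- c"] by (auto simp: bounded_iff algebra_simps)
  obtain x where "x \<in> Q" using Q by auto
  show ?thesis
  proof (rule that[of e "max B 1" c])
    show "icube c e \<subseteq> Q" using st[OF \<open>x \<in> Q\<close>, of _ 1] by auto
    show "infnorm (x - c) \<le> max B 1" if "x \<in> Q" for x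
      using B[OF that] infnorm_le_norm[of "x - c"] by linarith
  qed (use e st in auto)
qed

text \<open>For y in Q close to x, the point c + s (x - c) also lies on the segment from y to a
  point \<open>?w\<close> of the cube about c. Solving for \<open>?w\<close> gives c plus s / (1 -
  s) times x - y, and \<open>\<eta>\<close> is the closeness that keeps it within radius r.\<close>

lemma star_domain_closure:
  assumes Q: "star_domain (Q :: (real^'d) set)"
  obtains c where "\<And>x s. x \<in> closure Q \<Longrightarrow> 0 \<le> s \<Longrightarrow> s < 1 \<Longrightarrow> c + s *\<^sub>R (x - c) \<in> Q"
proof -
  obtain c r D where r: "0 < r" and st: "\<And>x y s. x \<in> Q \<Longrightarrow> y \<in> icube c r \<Longrightarrow> 0 \<le> s \<Longrightarrow> s \<le> 1 \<Longrightarrow> x + s *\<^sub>R (y - x) \<in> Q"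
    using star_domainE[OF Q] by metis
  show ?thesis
  proof (rule that[of c])
    fix x s assume x: "x \<in> closure Q" and s: "0 \<le> s" "s < (1::real)"
    define \<eta> where "\<eta> = r * (1 - s)"
    have "\<eta> > 0" using r s by (simp add: \<eta>_def)
    then obtain y where y: "y \<in> Q" "dist y x < \<eta>" using x by (meson closure_approachable)
    let ?w = "c + (s / (1 - s)) *\<^sub>R (x - y)"
    have "infnorm (?w - c) = s / (1 - s) * infnorm (x - y)" using s by (simp add: infnorm_mul)
    also have "\<dots> \<le> 1 / (1 - s) * \<eta>"
      using s y infnorm_le_norm[of "x - y"] by (intro mult_mono divide_right_mono infnorm_pos_le) (auto simp: dist_norm norm_minus_commute)
    also have "\<dots> = r" using s by (simp add: \<eta>_def)
    finally have "?w \<in> icube c r" by (simp add: icube_def)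
    from st[OF y(1) this, of "1 - s"] s have "y + (1 - s) *\<^sub>R (?w - y) \<in> Q" by simp
    also have "y + (1 - s) *\<^sub>R (?w - y) = c + s *\<^sub>R (x - c)"
    proof -
      have "(1 - s) *\<^sub>R (s / (1 - s)) *\<^sub>R (x - y) = s *\<^sub>R (x - y)" using s by simp
      moreover have "y + (1 - s) *\<^sub>R (?w - y) = y + (1 - s) *\<^sub>R c - (1 - s) *\<^sub>R y + (1 - s) *\<^sub>R (s / (1 - s)) *\<^sub>R (x - y)"
        by (simp only: scaleR_add_right scaleR_diff_right add_diff_eq) (simp add: algebra_simps)
      ultimately show ?thesis by (simp add: algebra_simps)
    qed
    finally show "c + s *\<^sub>R (x - c) \<in> Q" .
  qed
qed

text \<open>Shrinking the closure towards c by a factor s < 1 moves it into Q, so s^d times the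
  measure of the closure is at most the measure of Q; then s tends to 1.\<close>

lemma star_domain_frontier_null:
  assumes Q: "star_domain (Q :: (real^'d) set)"
  shows "emeasure lborel (frontier Q) = 0"
proof -
  obtain c where c: "\<And>x s. x \<in> closure Q \<Longrightarrow> 0 \<le> s \<Longrightarrow> s < 1 \<Longrightarrow> c + s *\<^sub>R (x - c) \<in> Q"
    using star_domain_closure[OF Q] by blast
  have op: "open Q" "bounded Q" using Q by (auto simp: star_domain_def)
  have [measurable]: "Q \<in> sets borel" "closure Q \<in> sets borel" using op by auto
  have fin: "emeasure lborel Q < \<infinity>" "emeasure lborel (closure Q) < \<infinity>" 
    using emeasure_bounded_finite[OF op(2)] emeasure_bounded_finite[OF bounded_closure[OF op(2)]] by simp_all
  have le: "ennreal (s ^ CARD('d)) * emeasure lborel (closure Q) \<le> emeasure lborel Q" if s: "0 < s" "s < 1" for s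
  proof -
    have "emeasure lborel (closure Q) = (\<integral>\<^sup>+x. indicator (closure Q) (c + x) \<partial>lborel)"
      by (subst nn_integral_translate) auto
    also have "ennreal (s ^ CARD('d)) * \<dots> \<le> ennreal (s ^ CARD('d)) * (\<integral>\<^sup>+x. indicator Q (c + s *\<^sub>R x) \<partial>lborel)"
      using c[of "c + _" s] s by (intro mult_left_mono nn_integral_mono) (auto simp: indicator_def)
    also have "\<dots> = (\<integral>\<^sup>+x. indicator Q (c + x) \<partial>lborel)"
      using s by (subst nn_integral_scale[where c = s and F = "\<lambda>x. indicator Q (c + x)"]) auto
    also have "\<dots> = emeasure lborel Q" by (subst nn_integral_translate) auto
    finally show ?thesis .
  qed
  obtain a b where ab: "emeasure lborel Q = ennreal a" "emeasure lborel (closure Q) = ennreal b" "0 \<le> a" "0 \<le> b"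
    using fin by (metis ennreal_cases infinity_ennreal_def less_irrefl)
  have "b \<le> a"
  proof (rule tendsto_upperbound)
    show "((\<lambda>s. s ^ CARD('d) * b) \<longlongrightarrow> b) (at_left 1)" by (auto intro!: tendsto_eq_intros)
    show "\<forall>\<^sub>F s in at_left 1. s ^ CARD('d) * b \<le> a"
      unfolding eventually_at_left_field
    proof (intro exI[of _ 0] conjI allI impI)
      fix s :: real assume s: "0 < s" "s < 1"
      have "ennreal (s ^ CARD('d) * b) \<le> ennreal a" using le[OF s] s ab by (simp add: ennreal_mult)
      then show "s ^ CARD('d) * b \<le> a" using ab by (simp add: ennreal_le_iff)
    qed simp
  qed simp
  have "emeasure lborel (closure Q - Q) = emeasure lborel (closure Q) - emeasure lborel Q"
    using fin closure_subset by (intro emeasure_Diff) auto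
  also have "\<dots> = 0" using ab \<open>b \<le> a\<close> by (simp add: ennreal_minus ennreal_eq_0_iff)
  finally show ?thesis using op by (simp add: frontier_def interior_open)
qed

context dominated_gradient
begin

text \<open>A Morrey estimate. From z, the set \<open>T z\<close> consists of the initial parts of
  the segments towards the cube about c, a fraction \<mu> of each, and is star-shaped about z. For z
  = x and for z = y it contains the same cube P, so \<open>star_poincare\<close> compares both f x
  and f y with the values of f on P.\<close>

lemma oscillation:
  assumes r: "0 < r" "\<And>x y s. x \<in> Q \<Longrightarrow> y \<in> icube c r \<Longrightarrow> 0 \<le> s \<Longrightarrow> s \<le> 1 \<Longrightarrow> x + s *\<^sub>R (y - x) \<in> Q"
    and D: "0 < D" "\<And>x. x \<in> Q \<Longrightarrow> infnorm (x - c) \<le> D"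
    and \<rho>: "0 < \<rho>" "2 * \<rho> \<le> r" and x: "x \<in> Q" and y: "y \<in> Q" and xy: "infnorm (x - y) \<le> \<rho>"
  defines "R \<equiv> 2 * \<rho> / r * (r + D)"
  shows "ennreal ((2 * \<rho>) ^ CARD('d) * \<bar>f x - f y\<bar>)
     \<le> 2 * (ennreal \<alpha> * (\<integral>\<^sup>+z\<in>icube (0::real^'d) R. ennreal (kern R z powr q) \<partial>lborel)
        + ennreal \<beta> * (\<integral>\<^sup>+z\<in>Q \<inter> icube x (R + \<rho>). ennreal (\<Gamma> z) \<partial>lborel))"
proof -
  \<comment> \<open>\<open>T z\<close> contains the cube of radius \<mu> r = 2 \<rho> about z +
    \<mu> (c - z). Replacing z by x moves this centre by at most \<rho>, which leaves the radius
    \<rho> for P. The set lies in the cube of radius R = \<mu> (r + D) about z, as the segments have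
    length at most r + D.\<close>
  define \<mu> where "\<mu> = 2 * \<rho> / r"
  have \<mu>: "0 < \<mu>" "\<mu> \<le> 1" using r \<rho> by (auto simp: \<mu>_def)
  have R: "0 < R" "R = \<mu> * (r + D)" using r D \<rho> by (auto simp: R_def \<mu>_def)
  define T where "T x = (\<lambda>(s, y). x + s *\<^sub>R (y - x)) ` ({0..\<mu>} \<times> icube c r)" for x :: "real^'d"
  define P where "P = icube (x + \<mu> *\<^sub>R (c - x)) \<rho>"
  have T: "compact (T z)" "T z \<subseteq> Q" "T z \<subseteq> icube z R"
    "\<And>w s. w \<in> T z \<Longrightarrow> 0 \<le> s \<Longrightarrow> s \<le> 1 \<Longrightarrow> z + s *\<^sub>R (w - z) \<in> T z" if z: "z \<in> Q" for z
  proof -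
    show "compact (T z)" unfolding T_def
      by (intro compact_continuous_image compact_Times icube_compact compact_Icc) (auto simp: case_prod_beta intro!: continuous_intros)
    show "T z \<subseteq> Q" using r(2)[OF z] \<mu> by (auto simp: T_def)
    show "T z \<subseteq> icube z R"
    proof
      fix w assume "w \<in> T z"
      then obtain s y where s: "w = z + s *\<^sub>R (y - z)" "0 \<le> s" "s \<le> \<mu>" "infnorm (y - c) \<le> r"
        by (auto simp: T_def icube_def)
      have "infnorm (w - z) = s * infnorm (y - z)" using s by (simp add: infnorm_mul)
      also have "\<dots> \<le> \<mu> * (r + D)"
        using s \<mu> D(2)[OF z] infnorm_triangle_diff[of y z c] infnorm_sub[of z c] by (intro mult_mono infnorm_pos_le) auto
      finally show "w \<in> icube z R" by (simp add: icube_def R)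
    qed
    fix w s assume "w \<in> T z" and s: "0 \<le> s" "s \<le> (1::real)"
    then obtain t y where t: "w = z + t *\<^sub>R (y - z)" "0 \<le> t" "t \<le> \<mu>" "y \<in> icube c r" by (auto simp: T_def)
    then have "z + s *\<^sub>R (w - z) = z + (s * t) *\<^sub>R (y - z)" by simp
    moreover have "0 \<le> s * t" "s * t \<le> \<mu>" using s t mult_mono[of s 1 t \<mu>] by auto
    ultimately show "z + s *\<^sub>R (w - z) \<in> T z" unfolding T_def using t(4) by (intro image_eqI[of _ _ "(s * t, y)"]) auto
  qed
  have sub: "P \<subseteq> T z" if z: "infnorm (x - z) \<le> \<rho>" for z
  proof
    fix w assume "w \<in> P"
    then have w: "infnorm (w - (x + \<mu> *\<^sub>R (c - x))) \<le> \<rho>" by (simp add: P_def icube_def)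
    define y where "y = z + (1 / \<mu>) *\<^sub>R (w - z)"
    have "infnorm (w - (z + \<mu> *\<^sub>R (c - z))) \<le> infnorm (w - (x + \<mu> *\<^sub>R (c - x))) + infnorm ((x + \<mu> *\<^sub>R (c - x)) - (z + \<mu> *\<^sub>R (c - z)))"
      by (rule infnorm_triangle_diff)
    also have "(x + \<mu> *\<^sub>R (c - x)) - (z + \<mu> *\<^sub>R (c - z)) = (1 - \<mu>) *\<^sub>R (x - z)" by (simp add: algebra_simps)
    also have "infnorm ((1 - \<mu>) *\<^sub>R (x - z)) \<le> 1 * \<rho>" unfolding infnorm_mul using \<mu> z by (intro mult_mono infnorm_pos_le) auto
    finally have w2: "infnorm (w - (z + \<mu> *\<^sub>R (c - z))) \<le> 2 * \<rho>" using w by simp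
    have "y - c = (1 / \<mu>) *\<^sub>R (w - (z + \<mu> *\<^sub>R (c - z)))" using \<mu> by (simp add: y_def algebra_simps)
    then have "infnorm (y - c) \<le> (1 / \<mu>) * (2 * \<rho>)" using w2 \<mu> by (simp add: infnorm_mul divide_right_mono)
    also have "\<dots> = r" using \<mu> r \<rho> by (simp add: \<mu>_def)
    finally have "y \<in> icube c r" by (simp add: icube_def)
    moreover have "w = z + \<mu> *\<^sub>R (y - z)" using \<mu> by (simp add: y_def)
    ultimately show "w \<in> T z" unfolding T_def using \<mu> by (intro image_eqI[of _ _ "(\<mu>, y)"]) auto
  qed
  let ?K = "\<integral>\<^sup>+z\<in>icube (0::real^'d) R. ennreal (kern R z powr q) \<partial>lborel"
  let ?L = "\<integral>\<^sup>+z\<in>Q \<inter> icube x (R + \<rho>). ennreal (\<Gamma> z) \<partial>lborel"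
  have [measurable]: "P \<in> sets borel" by (simp add: P_def)
  have PQ: "P \<subseteq> Q" using sub[of x] T(2)[OF x] \<rho> by (simp add: infnorm_0)
  have est: "(\<integral>\<^sup>+w\<in>P. ennreal \<bar>f0 w - f z\<bar> \<partial>lborel) \<le> ennreal \<alpha> * ?K + ennreal \<beta> * ?L" if z: "z \<in> Q" "infnorm (x - z) \<le> \<rho>" for z
  proof -
    have [measurable]: "T z \<in> sets borel" using T(1)[OF z(1)] by (rule borel_compact)
    have "(\<integral>\<^sup>+w\<in>P. ennreal \<bar>f0 w - f z\<bar> \<partial>lborel) \<le> (\<integral>\<^sup>+w\<in>T z. ennreal \<bar>f w - f z\<bar> \<partial>lborel)"
      using sub[OF z(2)] PQ by (intro nn_integral_mono) (auto simp: indicator_def f0_def)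
    also have "\<dots> \<le> ennreal \<alpha> * (\<integral>\<^sup>+y\<in>icube z R. ennreal (kern R (y - z) powr q) \<partial>lborel) + ennreal \<beta> * (\<integral>\<^sup>+y\<in>T z. ennreal (\<Gamma> y) \<partial>lborel)"
      by (rule star_poincare[OF T(1)[OF z(1)] T(2)[OF z(1)] T(3)[OF z(1)] R(1) T(4)[OF z(1)]])
    also have "(\<integral>\<^sup>+y\<in>icube z R. ennreal (kern R (y - z) powr q) \<partial>lborel) = ?K"
      by (rule nn_integral_icube_translate) measurable
    also have "(\<integral>\<^sup>+y\<in>T z. ennreal (\<Gamma> y) \<partial>lborel) \<le> ?L"
    proof (rule nn_integral_mono)
      have "T z \<subseteq> Q \<inter> icube x (R + \<rho>)"
      proof
        fix w assume w: "w \<in> T z"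
        then have "infnorm (w - z) \<le> R" using T(3)[OF z(1)] by (auto simp: icube_def)
        then have "infnorm (w - x) \<le> R + \<rho>" using infnorm_triangle_diff[of w x z] z(2) infnorm_sub[of x z] by linarith
        then show "w \<in> Q \<inter> icube x (R + \<rho>)" using w T(2)[OF z(1)] by (auto simp: icube_def)
      qed
      then show "ennreal (\<Gamma> y) * indicator (T z) y \<le> ennreal (\<Gamma> y) * indicator (Q \<inter> icube x (R + \<rho>)) y" for y
        by (auto simp: indicator_def)
    qed
    finally show ?thesis by (simp add: add_left_mono mult_left_mono)
  qed
  have "ennreal ((2 * \<rho>) ^ CARD('d) * \<bar>f x - f y\<bar>) = (\<integral>\<^sup>+w\<in>P. ennreal \<bar>f x - f y\<bar> \<partial>lborel)"
    using \<rho> by (simp add: nn_integral_cmult_indicator P_def emeasure_icube ennreal_mult mult.commute)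
  also have "\<dots> \<le> (\<integral>\<^sup>+w. ennreal \<bar>f0 w - f x\<bar> * indicator P w + ennreal \<bar>f0 w - f y\<bar> * indicator P w \<partial>lborel)"
    by (intro nn_integral_mono) (auto simp: indicator_def ennreal_plus[symmetric] simp del: ennreal_plus intro!: ennreal_leI)
  also have "\<dots> = (\<integral>\<^sup>+w\<in>P. ennreal \<bar>f0 w - f x\<bar> \<partial>lborel) + (\<integral>\<^sup>+w\<in>P. ennreal \<bar>f0 w - f y\<bar> \<partial>lborel)"
    by (rule nn_integral_add) measurable
  also have "\<dots> \<le> (ennreal \<alpha> * ?K + ennreal \<beta> * ?L) + (ennreal \<alpha> * ?K + ennreal \<beta> * ?L)"
    using x y xy \<rho> by (intro add_mono est) (auto simp: infnorm_0)
  finally show ?thesis by (simp only: mult_2)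
qed

end

subsection \<open>Lattice cubes\<close>

definition cell :: "real \<Rightarrow> real^'d \<Rightarrow> int^'d" where
  "cell h x = (\<chi> i. \<lfloor>x $ i / (2 * h)\<rfloor>)"

definition grid :: "real \<Rightarrow> (real^'d) set" where
  "grid h = (\<Union>i. \<Union>k::int. {x. x $ i = 2 * h * of_int k})"

lemma mem_cube: "x \<in> cube h z \<longleftrightarrow> (\<forall>i. 2 * h * of_int (z $ i) \<le> x $ i \<and> x $ i \<le> 2 * h * (of_int (z $ i) + 1))"
  by (simp add: cube_def mem_box_cart)

lemma cube_eq_icube: "cube h z = icube (cube_center h z) h"
proof -
  have *: "(2 * h * of_int a \<le> t \<and> t \<le> 2 * h * (of_int a + 1)) \<longleftrightarrow> \<bar>t - (2 * h * of_int a + h)\<bar> \<le> h" for t and a :: int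
    by (auto simp: abs_le_iff algebra_simps)
  show ?thesis by (auto simp: mem_cube icube_def infnorm_le_iff cube_center_def *)
qed

lemma open_cube_iff: "infnorm (x - cube_center h z) < h \<longleftrightarrow> (\<forall>i. 2 * h * of_int (z $ i) < x $ i \<and> x $ i < 2 * h * (of_int (z $ i) + 1))"
proof -
  have *: "(2 * h * of_int a < t \<and> t < 2 * h * (of_int a + 1)) \<longleftrightarrow> \<bar>t - (2 * h * of_int a + h)\<bar> < h" for t and a :: int
    by (auto simp: abs_less_iff algebra_simps)
  show ?thesis by (auto simp: infnorm_less_iff cube_center_def *)
qed

lemma interior_cube: "interior (cube h z) = {x. infnorm (x - cube_center h z) < h}"
  by (auto simp: cube_def open_cube_iff mem_box_cart interior_cbox)

lemma cube_unique:
  assumes "0 < h" "infnorm (x - cube_center h z) < h" "x \<in> cube h z'"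
  shows "z' = z"
proof -
  have "z' $ i = z $ i" for i
  proof -
    have "2 * h * of_int (z' $ i) < 2 * h * (of_int (z $ i) + 1)" "2 * h * of_int (z $ i) < 2 * h * (of_int (z' $ i) + 1)"
      using assms(2,3) unfolding open_cube_iff mem_cube by (smt (verit))+
    then have "of_int (z' $ i) < (of_int (z $ i) + 1 :: real)" "of_int (z $ i) < (of_int (z' $ i) + 1 :: real)"
      using assms(1) by auto
    then show ?thesis by linarith
  qed
  then show ?thesis by (simp add: vec_eq_iff)
qed

lemma cell_open_cube: "0 < h \<Longrightarrow> infnorm (x - cube_center h z) < h \<Longrightarrow> cell h x = z"
  unfolding open_cube_iff cell_def vec_eq_iff vec_lambda_beta
proof
  fix i
  assume h: "0 < h" and "\<forall>i. 2 * h * of_int (z $ i) < x $ i \<and> x $ i < 2 * h * (of_int (z $ i) + 1)"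
  then have "2 * h * of_int (z $ i) < x $ i" "x $ i < 2 * h * (of_int (z $ i) + 1)" by auto
  then have "of_int (z $ i) < x $ i / (2 * h)" "x $ i / (2 * h) < of_int (z $ i) + 1"
    using h by (simp_all add: pos_less_divide_eq pos_divide_less_eq mult.commute)
  then show "\<lfloor>x $ i / (2 * h)\<rfloor> = z $ i" by linarith
qed

lemma cell_off_grid: "0 < h \<Longrightarrow> x \<notin> grid h \<Longrightarrow> infnorm (x - cube_center h (cell h x)) < h"
proof -
  assume h: "0 < h" and x: "x \<notin> grid h"
  have "2 * h * of_int (cell h x $ i) < x $ i \<and> x $ i < 2 * h * (of_int (cell h x $ i) + 1)" for i
  proof -
    let ?k = "\<lfloor>x $ i / (2 * h)\<rfloor>"
    have "of_int ?k \<le> x $ i / (2 * h)" "x $ i / (2 * h) < of_int ?k + 1" by linarith+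
    then have "2 * h * of_int ?k \<le> x $ i" "x $ i < 2 * h * (of_int ?k + 1)"
    proof -
      assume k: "of_int ?k \<le> x $ i / (2 * h)" "x $ i / (2 * h) < of_int ?k + 1"
      have "of_int ?k * (2 * h) \<le> x $ i / (2 * h) * (2 * h)" using k h by (intro mult_right_mono) auto
      moreover have "x $ i / (2 * h) * (2 * h) < (of_int ?k + 1) * (2 * h)" using k h by (intro mult_strict_right_mono) auto
      moreover have "x $ i / (2 * h) * (2 * h) = x $ i" using h by simp
      ultimately show "2 * h * of_int ?k \<le> x $ i" "x $ i < 2 * h * (of_int ?k + 1)" by (simp_all only: mult.commute)
    qed
    moreover have "x $ i \<noteq> 2 * h * of_int ?k" using x by (auto simp: grid_def)
    ultimately show ?thesis by (simp add: cell_def)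
  qed
  then show ?thesis by (simp add: open_cube_iff)
qed

lemma grid_null: "grid h \<in> null_sets (lborel :: (real^'d) measure)"
proof -
  have "{x::real^'d. x $ i = c} \<in> null_sets lborel" for i c
  proof -
    have "{x::real^'d. x $ i = c} \<in> sets borel" by measurable
    moreover have "negligible {x::real^'d. x $ i = c}"
      using negligible_hyperplane[of "axis i 1 :: real^'d" c] by (simp add: inner_axis inner_commute axis_eq_0_iff)
    ultimately show ?thesis by (simp add: negligible_iff_null_sets null_sets_completion_iff)
  qed
  then show ?thesis unfolding grid_def by (intro null_sets_UN') auto
qed

lemma AE_off_grid: "AE x in (lborel :: (real^'d) measure). x \<notin> grid h"
  by (rule AE_not_in[OF grid_null])

lemma cube_borel [measurable, simp]: "cube h z \<in> sets borel"
  by (simp add: cube_def)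

text \<open>Different closed cubes of one lattice meet only in the grid, which is a null
  set.\<close>

lemma sum_cubes_le:
  fixes F :: "real^'d \<Rightarrow> ennreal"
  assumes h: "0 < h" and Z: "finite Z" "\<And>z. z \<in> Z \<Longrightarrow> cube h z \<subseteq> S"
    and [measurable]: "F \<in> borel_measurable borel"
  shows "(\<Sum>z\<in>Z. \<integral>\<^sup>+x\<in>cube h z. F x \<partial>lborel) \<le> (\<integral>\<^sup>+x\<in>S. F x \<partial>lborel)"
proof -
  have "(\<Sum>z\<in>Z. \<integral>\<^sup>+x\<in>cube h z. F x \<partial>lborel) = (\<integral>\<^sup>+x. (\<Sum>z\<in>Z. F x * indicator (cube h z) x) \<partial>lborel)"
    by (rule nn_integral_sum[symmetric]) measurable
  also have "\<dots> \<le> (\<integral>\<^sup>+x\<in>S. F x \<partial>lborel)"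
  proof (rule nn_integral_mono_AE)
    show "AE x in lborel. (\<Sum>z\<in>Z. F x * indicator (cube h z) x) \<le> F x * indicator S x"
      using AE_off_grid[of h]
    proof eventually_elim
      case (elim x)
      have un: "z = cell h x" if "x \<in> cube h z" for z
        using cube_unique[OF h cell_off_grid[OF h elim] that] .
      have "(\<Sum>z\<in>Z. F x * indicator (cube h z) x) = (\<Sum>z\<in>Z \<inter> {cell h x}. F x * indicator (cube h z) x)"
        using un Z(1) by (intro sum.mono_neutral_right) (auto simp: indicator_def)
      also have "\<dots> \<le> F x * indicator S x"
      proof (cases "cell h x \<in> Z")
        case True
        then have *: "Z \<inter> {cell h x} = {cell h x}" by auto
        have "(\<Sum>z\<in>Z \<inter> {cell h x}. F x * indicator (cube h z) x) = F x * indicator (cube h (cell h x)) x"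
          by (simp only: * sum.insert finite.emptyI empty_iff not_False_eq_True sum.empty add_0_right)
        then show ?thesis using Z(2)[OF True] by (auto simp: indicator_def)
      qed simp
      finally show ?case .
    qed
  qed
  finally show ?thesis .
qed

lemma card_cubes_le:
  assumes h: "0 < h" and Z: "finite Z" "\<And>z. z \<in> Z \<Longrightarrow> cube h z \<subseteq> (S::(real^'d) set)"
    and S: "S \<in> sets borel" "bounded S"
  shows "real (card Z) * (2 * h) ^ CARD('d) \<le> measure lborel S"
proof -
  have "ennreal (real (card Z) * (2 * h) ^ CARD('d)) = (\<Sum>z\<in>Z. \<integral>\<^sup>+x\<in>cube h z. 1 \<partial>lborel)"
    using h by (simp add: cube_eq_icube emeasure_icube ennreal_mult ennreal_of_nat_eq_real_of_nat)
  also have "\<dots> \<le> (\<integral>\<^sup>+x\<in>S. 1 \<partial>lborel)" by (rule sum_cubes_le[OF h Z]) auto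
  also have "\<dots> = ennreal (measure lborel S)"
    using S emeasure_bounded_finite[OF S(2)] by (simp add: emeasure_eq_ennreal_measure less_top)
  finally show ?thesis by (simp add: ennreal_le_iff)
qed

text \<open>Every finite subfamily obeys the volume bound of \<open>card_cubes_le\<close>, so its
  cardinality is bounded uniformly.\<close>

lemma finite_cubes:
  assumes h: "0 < h" and S: "bounded (S::(real^'d) set)"
  shows "finite {z. cube h z \<subseteq> S}"
proof -
  obtain B where B: "S \<subseteq> cball 0 B" using S by (auto simp: bounded_iff subset_iff dist_norm)
  have "finite {z. cube h z \<subseteq> cball (0::real^'d) B} \<and> card {z. cube h z \<subseteq> cball (0::real^'d) B} \<le> nat \<lfloor>measure lborel (cball (0::real^'d) B) / (2 * h) ^ CARD('d)\<rfloor>"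
  proof (rule finite_if_finite_subsets_card_bdd[where C = "nat \<lfloor>measure lborel (cball (0::real^'d) B) / (2 * h) ^ CARD('d)\<rfloor>"])
    fix G :: "(int^'d) set" assume G: "G \<subseteq> {z. cube h z \<subseteq> cball (0::real^'d) B}" "finite G"
    have "real (card G) * (2 * h) ^ CARD('d) \<le> measure lborel (cball (0::real^'d) B)"
      using G by (intro card_cubes_le h) auto
    then have "real (card G) \<le> measure lborel (cball (0::real^'d) B) / (2 * h) ^ CARD('d)"
      using h by (simp add: field_simps)
    then show "card G \<le> nat \<lfloor>measure lborel (cball (0::real^'d) B) / (2 * h) ^ CARD('d)\<rfloor>" by linarith
  qed
  then show ?thesis using B by (auto intro: finite_subset[rotated])
qed

lemma finite_cubes_meeting:
  assumes h: "0 < h" and S: "bounded (S::(real^'d) set)"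
  shows "finite {z. cube h z \<inter> S \<noteq> {}}"
proof -
  obtain B where B: "\<And>x. x \<in> S \<Longrightarrow> norm x \<le> B" using S by (auto simp: bounded_iff)
  let ?B = "B + sqrt DIM(real^'d) * (2 * h)"
  have "{z. cube h z \<inter> S \<noteq> {}} \<subseteq> {z. cube h z \<subseteq> cball 0 ?B}"
  proof (intro subsetI CollectI)
    fix z y assume "z \<in> {z. cube h z \<inter> S \<noteq> {}}" and y: "y \<in> cube h z"
    then obtain x where x: "x \<in> cube h z" "x \<in> S" by auto
    have "infnorm (y - x) \<le> 2 * h"
      using infnorm_triangle_diff[of y x "cube_center h z"] infnorm_sub[of x "cube_center h z"] x(1) y
      by (simp add: cube_eq_icube icube_def)
    then have "norm (y - x) \<le> sqrt DIM(real^'d) * (2 * h)"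
      using norm_le_infnorm[of "y - x"] by (meson mult_left_mono order_trans real_sqrt_ge_zero of_nat_0_le_iff)
    then show "y \<in> cball 0 ?B" using B[OF x(2)] norm_triangle_ineq[of x "y - x"] by simp
  qed
  moreover have "finite {z. cube h z \<subseteq> cball (0::real^'d) ?B}" by (rule finite_cubes[OF h]) simp
  ultimately show ?thesis by (rule finite_subset)
qed

lemma finite_meeting_cubes: "0 < h \<Longrightarrow> bounded Q \<Longrightarrow> finite (meeting_cubes Q h)"
proof (rule finite_subset)
  show "meeting_cubes Q h \<subseteq> {z. cube h z \<inter> Q \<noteq> {}}"
  proof
    fix z assume "z \<in> meeting_cubes Q h"
    then have "interior (Q \<inter> cube h z) \<noteq> {}" by (simp add: meeting_cubes_def)
    then have "Q \<inter> cube h z \<noteq> {}" using interior_subset[of "Q \<inter> cube h z"] by blast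
    then show "z \<in> {z. cube h z \<inter> Q \<noteq> {}}" by (simp add: Int_commute)
  qed
qed (rule finite_cubes_meeting)

lemma finite_inner_centers: "0 < h \<Longrightarrow> bounded Q \<Longrightarrow> finite (inner_centers Q h)"
  unfolding inner_centers_def inner_cubes_def by (intro finite_imageI finite_cubes)

lemma half_step_pos: "0 < measure lebesgue Q \<Longrightarrow> 0 < n \<Longrightarrow> 0 < half_step Q n"
  by (simp add: half_step_def)

lemma half_step_volume:
  assumes "0 < measure lebesgue (Q::(real^'d) set)" "0 < n"
  shows "real n * (2 * half_step Q n) ^ CARD('d) = measure lebesgue Q"
proof -
  have "(2 * half_step Q n) ^ CARD('d) = ((measure lebesgue Q / real n) powr (1 / real CARD('d))) powr real CARD('d)"
    using assms by (simp add: half_step_def powr_realpow)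
  also have "\<dots> = measure lebesgue Q / real n" using assms by (simp add: powr_powr)
  finally show ?thesis using assms by simp
qed

lemma half_step_tendsto_0: "(\<lambda>n. half_step (Q::(real^'d) set) n) \<longlonglongrightarrow> 0"
proof -
  have "(\<lambda>n. measure lebesgue Q / real n) \<longlonglongrightarrow> 0" by (rule lim_const_over_n)
  then have "(\<lambda>n. (measure lebesgue Q / real n) powr (1 / real CARD('d))) \<longlonglongrightarrow> 0 powr (1 / real CARD('d))"
    by (rule tendsto_powr2) auto
  then have "(\<lambda>n. 1 / 2 * (measure lebesgue Q / real n) powr (1 / real CARD('d))) \<longlonglongrightarrow> 1 / 2 * 0"
    by (intro tendsto_mult tendsto_const) simp
  then show ?thesis by (simp add: half_step_def[abs_def])
qed

text \<open>
  A node that is not the centre of an inner cube lies in a cube of side \<open>6h\<close> that is not contained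
  in \<open>Q\<close>. If it were at distance less than \<open>h\<close> from a point of a cube with centre \<open>c\<close>, then the cube
  of the node would be within distance \<open>3h + h + 6h\<close> of \<open>c\<close>; hence the radius \<open>10h\<close>.
\<close>

definition bad_cubes :: "(real^'d) set \<Rightarrow> real \<Rightarrow> (int^'d) set" where
  "bad_cubes Q h = {z \<in> meeting_cubes Q (3 * h). \<not> icube (cube_center (3 * h) z) (10 * h) \<subseteq> Q}"

text \<open>The cube of radius 10 h about the centre is connected, meets Q and is not contained in
  Q, so it contains a frontier point; 13 h = 3 h + 10 h.\<close>

lemma bad_cubes_near_frontier:
  assumes h: "0 < h" and z: "z \<in> bad_cubes Q h"
  shows "cube (3 * h) z \<subseteq> thick (frontier Q) (13 * h)"
proof
  let ?c = "cube_center (3 * h) z"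
  fix x assume x: "x \<in> cube (3 * h) z"
  have "interior (Q \<inter> cube (3 * h) z) \<noteq> {}" using z by (simp add: bad_cubes_def meeting_cubes_def)
  then obtain y where y: "y \<in> Q" "y \<in> cube (3 * h) z" using interior_subset by blast
  then have "y \<in> icube ?c (10 * h)" using h by (simp add: cube_eq_icube icube_def)
  then have "icube ?c (10 * h) \<inter> Q \<noteq> {}" using y by blast
  moreover have "icube ?c (10 * h) - Q \<noteq> {}" using z by (auto simp: bad_cubes_def)
  moreover have "connected (icube ?c (10 * h))" unfolding icube_eq_cbox by (rule convex_connected) simp
  ultimately obtain w where w: "w \<in> icube ?c (10 * h)" "w \<in> frontier Q"
    using connected_Int_frontier by blast
  have "infnorm (x - w) \<le> 13 * h"
    using infnorm_triangle_diff[of x w ?c] infnorm_sub[of w ?c] x w(1) by (simp add: cube_eq_icube icube_def)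
  then show "x \<in> thick (frontier Q) (13 * h)" using w by (auto simp: thick_def)
qed

lemma finite_bad_cubes: "0 < h \<Longrightarrow> bounded Q \<Longrightarrow> finite (bad_cubes Q h)"
  unfolding bad_cubes_def by (intro finite_Collect_conjI disjI1) (simp add: finite_meeting_cubes)

lemma power_double_triple: "(2 * (3 * h)) ^ k = 3 ^ k * (2 * h) ^ k" for h :: real
proof -
  have "2 * (3 * h) = 3 * (2 * h)" by simp
  then show ?thesis by (simp only: power_mult_distrib)
qed

lemma star_domain_measure_pos:
  assumes Q: "star_domain (Q :: (real^'d) set)"
  shows "0 < measure lebesgue Q"
proof -
  from Q have op: "open Q" "bounded Q" by (auto simp: star_domain_def)
  obtain c r D where c: "0 < r" "icube c r \<subseteq> Q" using star_domainE[OF Q] by metis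
  have "0 < measure lborel (icube c r)" using c by (simp add: measure_icube)
  also have "\<dots> \<le> measure lborel Q"
  proof (rule measure_mono_fmeasurable[OF c(2)])
    show "Q \<in> fmeasurable lborel" using op emeasure_bounded_finite[OF op(2)] by (simp add: fmeasurable_def)
  qed simp
  finally show ?thesis using op by simp
qed

text \<open>The bad cubes do not overlap, up to null sets, and lie in the neighbourhood of the
  frontier of radius 13 h. Its measure tends to 0 because the frontier is compact and null, whereas
  each cube has volume 3^d meas Q / n.\<close>

lemma card_bad_cubes:
  assumes Q: "star_domain (Q :: (real^'d) set)" and \<theta>: "0 < \<theta>"
  shows "\<forall>\<^sub>F n in sequentially. real (card (bad_cubes Q (half_step Q n))) \<le> \<theta> * real n"
proof -
  have op: "open Q" "bounded Q" using Q by (auto simp: star_domain_def)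
  have m: "0 < measure lebesgue Q" by (rule star_domain_measure_pos[OF Q])
  let ?F = "frontier Q"
  have F: "compact ?F" using op by (simp add: compact_frontier_bounded)
  have F0: "emeasure lborel ?F = 0" by (rule star_domain_frontier_null[OF Q])
  have bt: "bounded (thick ?F e)" for e using thick_compact[OF F] compact_imp_bounded by blast
  have bo: "thick ?F e \<in> sets borel" for e using thick_compact[OF F] borel_compact by blast
  have "(\<lambda>n. \<integral>\<^sup>+x\<in>thick ?F (1 / real (Suc n)). 1 \<partial>lborel) \<longlonglongrightarrow> (\<integral>\<^sup>+x\<in>?F. 1 \<partial>lborel)"
    using emeasure_bounded_finite[OF bt[of 1]] bo by (intro thick_approx[OF F]) auto
  then have "(\<lambda>n. emeasure lborel (thick ?F (1 / real (Suc n)))) \<longlonglongrightarrow> 0"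
    using bo F F0 by (simp add: borel_compact)
  then have "\<forall>\<^sub>F k in sequentially. emeasure lborel (thick ?F (1 / real (Suc k))) < ennreal (\<theta> * measure lebesgue Q)"
    using \<theta> m by (intro order_tendstoD(2)) auto
  then obtain k where k: "emeasure lborel (thick ?F (1 / real (Suc k))) < ennreal (\<theta> * measure lebesgue Q)"
    using eventually_happens'[OF sequentially_bot] by blast
  define \<eta> where "\<eta> = 1 / real (Suc k)"
  have \<eta>: "0 < \<eta>" by (simp add: \<eta>_def)
  note k = k[folded \<eta>_def]
  have "\<forall>\<^sub>F n in sequentially. half_step Q n < \<eta> / 13"
    by (rule order_tendstoD(2)[OF half_step_tendsto_0]) (simp add: \<eta>)
  then show ?thesis using eventually_gt_at_top[of 0]
  proof eventually_elim
    case (elim n)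
    let ?h = "half_step Q n"
    have h: "0 < ?h" using half_step_pos[OF m] elim by simp
    have "real (card (bad_cubes Q ?h)) * (2 * (3 * ?h)) ^ CARD('d) \<le> measure lborel (thick ?F \<eta>)"
    proof (rule card_cubes_le)
      fix z assume "z \<in> bad_cubes Q ?h"
      then have "cube (3 * ?h) z \<subseteq> thick ?F (13 * ?h)" by (rule bad_cubes_near_frontier[OF h])
      also have "\<dots> \<subseteq> thick ?F \<eta>"
      proof (rule thick_mono)
        have "?h < \<eta> / 13" using elim by blast
        then show "13 * ?h \<le> \<eta>" by linarith
      qed
      finally show "cube (3 * ?h) z \<subseteq> thick ?F \<eta>" .
    qed (use h finite_bad_cubes[OF h op(2)] bo bt in auto)
    also have "\<dots> \<le> \<theta> * measure lebesgue Q"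
    proof -
      have eq: "ennreal (measure lborel (thick ?F \<eta>)) = emeasure lborel (thick ?F \<eta>)"
        using emeasure_bounded_finite[OF bt] by (intro emeasure_eq_ennreal_measure[symmetric]) (simp add: less_top)
      have "ennreal (measure lborel (thick ?F \<eta>)) < ennreal (\<theta> * measure lebesgue Q)"
        unfolding eq by (rule k)
      then show ?thesis by (simp only: ennreal_less_iff[OF measure_nonneg] less_imp_le)
    qed
    also have "\<dots> = \<theta> * (real n * (2 * ?h) ^ CARD('d))" using half_step_volume[OF m] elim by simp
    finally have "(real (card (bad_cubes Q ?h)) * 3 ^ CARD('d)) * (2 * ?h) ^ CARD('d) \<le> (\<theta> * real n) * (2 * ?h) ^ CARD('d)"
      unfolding power_double_triple by (simp only: mult_ac)
    then have "real (card (bad_cubes Q ?h)) * 3 ^ CARD('d) \<le> \<theta> * real n" using h by simp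
    moreover have "real (card (bad_cubes Q ?h)) * 1 \<le> real (card (bad_cubes Q ?h)) * 3 ^ CARD('d)"
      by (intro mult_left_mono) auto
    ultimately show ?case by linarith
  qed
qed

section \<open>Fine and coarse cubes, and the choice of the nodes\<close>

lemma sub_cube:
  fixes m :: "int^'d"
  assumes h: "0 < h"
  defines "z \<equiv> (\<chi> i. m $ i div 3)"
  shows "infnorm (cube_center h m - cube_center (3 * h) z) \<le> 2 * h" "cube h m \<subseteq> cube (3 * h) z"
proof -
  \<comment> \<open>The remainder of m modulo 3 is 0, 1 or 2; subtracting 1 measures it from the
    middle fine cube, which has the same centre as the coarse one.\<close>
  have ex: "\<bar>of_int (m $ i) - 3 * of_int (z $ i) - (1::real)\<bar> \<le> 1" for i
  proof -
    have "m $ i - 3 * (m $ i div 3) - 1 \<in> {-1..1}" by auto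
    then have "of_int (m $ i - 3 * (m $ i div 3) - 1) \<le> (1::real)" "(-1::real) \<le> of_int (m $ i - 3 * (m $ i div 3) - 1)"
      by auto
    then show ?thesis by (simp add: z_def abs_le_iff)
  qed
  show le: "infnorm (cube_center h m - cube_center (3 * h) z) \<le> 2 * h"
    unfolding infnorm_le_iff
  proof
    fix i
    have "(cube_center h m - cube_center (3 * h) z) $ i = 2 * h * (of_int (m $ i) - 3 * of_int (z $ i) - 1)"
      by (simp add: cube_center_def algebra_simps)
    then have "\<bar>(cube_center h m - cube_center (3 * h) z) $ i\<bar> = 2 * h * \<bar>of_int (m $ i) - 3 * of_int (z $ i) - 1\<bar>"
      using h by (simp add: abs_mult)
    also have "\<dots> \<le> 2 * h * 1" using h by (intro mult_left_mono ex) auto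
    finally show "\<bar>(cube_center h m - cube_center (3 * h) z) $ i\<bar> \<le> 2 * h" by simp
  qed
  show "cube h m \<subseteq> cube (3 * h) z"
  proof
    fix x assume "x \<in> cube h m"
    then have "infnorm (x - cube_center h m) \<le> h" by (simp add: cube_eq_icube icube_def)
    then have "infnorm (x - cube_center (3 * h) z) \<le> 3 * h"
      using infnorm_triangle_diff[of x "cube_center (3 * h) z" "cube_center h m"] le by linarith
    then show "x \<in> cube (3 * h) z" by (simp add: cube_eq_icube icube_def)
  qed
qed

lemma cube_center_3: "cube_center (3 * h) z = cube_center h (\<chi> i. 3 * z $ i + 1)"
  by (simp add: cube_center_def vec_eq_iff algebra_simps)

text \<open>As 3 is odd, the centre of a coarse cube is the centre of a fine cube. Hence the first
  choice in the construction of S1 applies to every coarse cube contained in Q.\<close>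

lemma cube_center_3_inner:
  assumes h: "0 < h" and z: "cube (3 * h) z \<subseteq> Q"
  shows "cube_center (3 * h) z \<in> inner_centers Q h"
proof -
  have "(3 * z $ i + 1) div 3 = z $ i" for i by presburger
  then have "cube h (\<chi> i. 3 * z $ i + 1) \<subseteq> cube (3 * h) z"
    using sub_cube(2)[OF h, of "\<chi> i. 3 * z $ i + 1"] by simp
  then show ?thesis using z unfolding cube_center_3 inner_centers_def inner_cubes_def by blast
qed

lemma inner_center_cell:
  assumes h: "0 < h" and y: "y \<in> inner_centers Q h"
  shows "infnorm (y - cube_center (3 * h) (cell (3 * h) y)) < 3 * h" "cell (3 * h) y \<in> meeting_cubes Q (3 * h)"
    "icube y h \<subseteq> Q" "y = cube_center h (cell h y)" "y \<in> Q"
proof -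
  obtain m where m: "y = cube_center h m" "cube h m \<subseteq> Q" using y by (auto simp: inner_centers_def inner_cubes_def)
  let ?z = "\<chi> i. m $ i div 3"
  have le: "infnorm (y - cube_center (3 * h) ?z) < 3 * h" using sub_cube(1)[OF h, of m] h m by simp
  then have cell: "cell (3 * h) y = ?z" using h by (intro cell_open_cube) auto
  show "infnorm (y - cube_center (3 * h) (cell (3 * h) y)) < 3 * h" using le cell by simp
  have "y \<in> interior (cube h m)" using h m by (simp add: interior_cube infnorm_0)
  moreover have "interior (cube h m) \<subseteq> interior (Q \<inter> cube (3 * h) ?z)"
    using sub_cube(2)[OF h, of m] m by (intro interior_mono) auto
  ultimately show "cell (3 * h) y \<in> meeting_cubes Q (3 * h)" unfolding cell meeting_cubes_def by blast
  show "icube y h \<subseteq> Q" using m by (simp add: cube_eq_icube)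
  show "y = cube_center h (cell h y)" using cell_open_cube[of h y m] h m by (simp add: infnorm_0)
  show "y \<in> Q" using \<open>icube y h \<subseteq> Q\<close> h by (auto simp: icube_def infnorm_0)
qed

lemma card_inner_centers_le:
  fixes Q :: "(real^'d) set"
  assumes h: "0 < h" and Q: "open Q" "bounded Q" and n: "real n * (2 * h) ^ CARD('d) = measure lebesgue Q"
  shows "card (inner_centers Q h) \<le> n"
proof -
  have fin: "finite (inner_cubes Q h)" unfolding inner_cubes_def by (rule finite_cubes[OF h Q(2)])
  have "real (card (inner_cubes Q h)) * (2 * h) ^ CARD('d) \<le> measure lborel Q"
    using Q by (intro card_cubes_le[OF h fin]) (auto simp: inner_cubes_def)
  also have "\<dots> = real n * (2 * h) ^ CARD('d)" using n Q by simp
  finally have "card (inner_cubes Q h) \<le> n" using h by simp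
  then show ?thesis unfolding inner_centers_def using card_image_le[OF fin, of "cube_center h"] by linarith
qed

text \<open>Coarse cubes that are not bad lie in Q and have volume 3^d meas Q / n, so there are at
  most n / 3 of them; together with at most n / 2 bad ones there are fewer than n. This is why the
  subtraction in \<open>is_S\<close> does not truncate.\<close>

lemma card_meeting_cubes_less:
  fixes Q :: "(real^'d) set"
  assumes d: "1 \<le> CARD('d)" and h: "0 < h" and Q: "open Q" "bounded Q" and n: "real n * (2 * h) ^ CARD('d) = measure lebesgue Q"
    and bad: "2 * card (bad_cubes Q h) \<le> n" and n0: "0 < n"
  shows "card (meeting_cubes Q (3 * h)) < n"
proof -
  let ?B = "meeting_cubes Q (3 * h)"
  have fin: "finite ?B" using h Q by (intro finite_meeting_cubes) auto
  have "real (card (?B - bad_cubes Q h)) * (2 * (3 * h)) ^ CARD('d) \<le> measure lborel Q"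
  proof (rule card_cubes_le)
    fix z assume "z \<in> ?B - bad_cubes Q h"
    then have "icube (cube_center (3 * h) z) (10 * h) \<subseteq> Q" by (auto simp: bad_cubes_def)
    then show "cube (3 * h) z \<subseteq> Q" using h by (auto simp: cube_eq_icube icube_def subset_iff)
  qed (use h Q fin in auto)
  also have "\<dots> = real n * (2 * h) ^ CARD('d)" using n Q by simp
  finally have "(real (card (?B - bad_cubes Q h)) * 3 ^ CARD('d)) * (2 * h) ^ CARD('d) \<le> real n * (2 * h) ^ CARD('d)"
    unfolding power_double_triple by (simp only: mult_ac)
  then have "real (card (?B - bad_cubes Q h)) * 3 ^ CARD('d) \<le> real n" using h by simp
  moreover have "real (card (?B - bad_cubes Q h)) * 3 ^ 1 \<le> real (card (?B - bad_cubes Q h)) * 3 ^ CARD('d)"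
    using d by (intro mult_left_mono power_increasing) auto
  ultimately have "real (3 * card (?B - bad_cubes Q h)) \<le> real n" by (simp add: mult.commute)
  then have "3 * card (?B - bad_cubes Q h) \<le> n" by (simp only: of_nat_le_iff)
  moreover have "card ?B = card (?B - bad_cubes Q h) + card (bad_cubes Q h)"
  proof -
    have "?B = (?B - bad_cubes Q h) \<union> bad_cubes Q h" by (auto simp: bad_cubes_def)
    then show ?thesis using fin finite_bad_cubes[OF h Q(2)] by (metis card_Un_disjoint Diff_disjoint finite_Diff inf_commute)
  qed
  ultimately show ?thesis using bad n0 by linarith
qed

text \<open>If S2 is all of a - S1, nothing is missed. Otherwise S1 and S2 have exactly n points
  together, while a has at most n; so every missed point of a is made up for by a point of S1
  outside a.\<close>

lemma card_missed_centers:
  fixes a S1 S2 :: "'a set"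
  assumes fin: "finite a" "finite S1" and a: "card a \<le> n" and S1: "card S1 < n"
    and S2: "if card (a - S1) < n - card S1 then S2 = a - S1 else S2 \<subseteq> a - S1 \<and> card S2 = n - card S1"
  shows "card (S1 \<union> S2) \<le> n" "card (a - (S1 \<union> S2)) \<le> card (S1 - a)" "S2 \<subseteq> a"
proof -
  have sub: "S2 \<subseteq> a - S1" using S2 by (auto split: if_splits)
  then show "S2 \<subseteq> a" by auto
  have fin2: "finite S2" using sub fin by (auto intro: finite_subset)
  have c2: "card S2 \<le> n - card S1" using S2 by (auto split: if_splits)
  have U: "card (S1 \<union> S2) = card S1 + card S2" using sub fin fin2 by (intro card_Un_disjoint) auto
  then show "card (S1 \<union> S2) \<le> n" using c2 S1 by linarith
  show "card (a - (S1 \<union> S2)) \<le> card (S1 - a)"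
  proof (cases "card (a - S1) < n - card S1")
    case True
    then have "a - (S1 \<union> S2) = {}" using S2 by auto
    then show ?thesis by (metis card.empty le0)
  next
    case False
    then have S2': "card S2 = n - card S1" using S2 by simp
    have "card (a - (S1 \<union> S2)) = card (a - S1) - card S2"
    proof -
      have "a - (S1 \<union> S2) = (a - S1) - S2" by auto
      then show ?thesis using sub fin2 by (simp only: card_Diff_subset)
    qed
    moreover have "card (a - S1) + card (a \<inter> S1) = card a"
      using fin by (metis card_Diff_subset_Int card_mono finite_Int inf_le1 le_add_diff_inverse2)
    moreover have "card (S1 - a) + card (a \<inter> S1) = card S1"
      using fin by (metis card_Diff_subset_Int card_mono finite_Int inf_le1 inf_commute le_add_diff_inverse2)
    ultimately show ?thesis using S2' a S1 by linarith
  qed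
qed

text \<open>The assumption \<open>few_bad\<close> expresses that n is large enough for the
  construction of the nodes.\<close>

locale node_set =
  fixes Q :: "(real^'d) set" and n :: nat and S :: "(real^'d) set" and h :: real
  assumes h_def: "h = half_step Q n" and Q: "open Q" "bounded Q" and h: "0 < h"
    and vol: "real n * (2 * h) ^ CARD('d) = measure lebesgue Q"
    and few_bad: "2 * card (bad_cubes Q h) \<le> n" and n: "0 < n"
    and S: "is_S Q n S"
begin

abbreviation "a \<equiv> inner_centers Q h"
abbreviation "B \<equiv> meeting_cubes Q (3 * h)"

lemma node_structure:
  shows S_finite: "finite S" and S_card: "card S \<le> n" and S_sub: "S \<subseteq> Q"
    and S_interior: "\<And>y. y \<in> S \<Longrightarrow> infnorm (y - cube_center (3 * h) (cell (3 * h) y)) < 3 * h"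
    and S_cell: "\<And>y. y \<in> S \<Longrightarrow> cell (3 * h) y \<in> B"
    and S_off: "\<And>y. y \<in> S \<Longrightarrow> y \<notin> a \<Longrightarrow> \<not> cube (3 * h) (cell (3 * h) y) \<subseteq> Q"
    and missed: "card (a - S) \<le> card (bad_cubes Q h)"
    and S_covers: "\<And>z. z \<in> B \<Longrightarrow> \<exists>y\<in>S. cell (3 * h) y = z"
proof -
  obtain S1 S2 \<sigma> where S1: "S1 = \<sigma> ` B"
    and \<sigma>: "\<And>z. z \<in> B \<Longrightarrow> if cube_center (3 * h) z \<in> a then \<sigma> z = cube_center (3 * h) z
          else if cube (3 * h) z \<inter> a \<noteq> {} then \<sigma> z \<in> cube (3 * h) z \<inter> a
          else \<sigma> z \<in> interior (Q \<inter> cube (3 * h) z)"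
    and S2: "if card (a - S1) < n - card S1 then S2 = a - S1 else S2 \<subseteq> a - S1 \<and> card S2 = n - card S1"
    and SU: "S = S1 \<union> S2"
    using S unfolding is_S_def is_S1_def Let_def h_def[symmetric] by blast
  have finB: "finite B" using h Q by (intro finite_meeting_cubes) auto
  have fina: "finite a" using h Q by (intro finite_inner_centers) auto
  have fin1: "finite S1" using finB S1 by simp
  have "card S1 \<le> card B" unfolding S1 by (rule card_image_le[OF finB])
  also have "\<dots> < n" by (rule card_meeting_cubes_less[OF _ h Q vol few_bad n]) (simp add: Suc_le_eq)
  finally have c1: "card S1 < n" .
  note cm = card_missed_centers[OF fina fin1 card_inner_centers_le[OF h Q vol] c1 S2]
  show "finite S" using SU fin1 cm(3) fina by (auto intro: finite_subset)
  show "card S \<le> n" using SU cm(1) by simp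
  have \<sigma>in: "infnorm (\<sigma> z - cube_center (3 * h) z) < 3 * h" and \<sigma>Q: "\<sigma> z \<in> Q" if z: "z \<in> B" for z
  proof -
    consider "\<sigma> z = cube_center (3 * h) z" "\<sigma> z \<in> a" | "\<sigma> z \<in> cube (3 * h) z" "\<sigma> z \<in> a" | "\<sigma> z \<in> interior (Q \<inter> cube (3 * h) z)"
      using \<sigma>[OF z] by (auto split: if_splits)
    then have "infnorm (\<sigma> z - cube_center (3 * h) z) < 3 * h \<and> \<sigma> z \<in> Q"
    proof cases
      case 1 then show ?thesis using h inner_center_cell(5)[OF h 1(2)] by (simp add: infnorm_0)
    next
      case 2
      have "z = cell (3 * h) (\<sigma> z)"
        using cube_unique[OF _ inner_center_cell(1)[OF h 2(2)] 2(1)] h by simp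
      then show ?thesis using inner_center_cell(1,5)[OF h 2(2)] by simp
    next
      case 3
      then have "\<sigma> z \<in> interior (cube (3 * h) z)" "\<sigma> z \<in> Q" using interior_subset by auto
      then show ?thesis by (simp add: interior_cube)
    qed
    then show "infnorm (\<sigma> z - cube_center (3 * h) z) < 3 * h" "\<sigma> z \<in> Q" by auto
  qed
  have \<sigma>cell: "cell (3 * h) (\<sigma> z) = z" if "z \<in> B" for z using h \<sigma>in[OF that] by (intro cell_open_cube) auto
  show "S \<subseteq> Q" using SU S1 \<sigma>Q cm(3) inner_center_cell(5)[OF h] by auto
  show "infnorm (y - cube_center (3 * h) (cell (3 * h) y)) < 3 * h" if "y \<in> S" for y
    using that SU S1 \<sigma>in \<sigma>cell cm(3) inner_center_cell(1)[OF h, of y Q] by auto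
  show "cell (3 * h) y \<in> B" if "y \<in> S" for y
    using that SU S1 \<sigma>cell cm(3) inner_center_cell(2)[OF h, of y Q] by auto
  show off: "\<not> cube (3 * h) (cell (3 * h) y) \<subseteq> Q" if y: "y \<in> S" "y \<notin> a" for y
  proof
    assume sub: "cube (3 * h) (cell (3 * h) y) \<subseteq> Q"
    \<comment> \<open>S2 consists of inner centres, so y was chosen for some coarse cube z. If this
      cube lay in Q, its centre would be an inner centre and would have been chosen instead.\<close>
    obtain z where z: "z \<in> B" "y = \<sigma> z" using y SU S1 cm(3) by auto
    then have "cube_center (3 * h) z \<in> a" using cube_center_3_inner[OF h] sub \<sigma>cell by simp
    then show False using \<sigma>[OF z(1)] z y by simp
  qed
  \<comment> \<open>Chosen points outside \<open>a\<close> belong to cubes not contained in Q; these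
    are bad, which bounds the number of missed centres as well.\<close>
  have "S1 - a \<subseteq> \<sigma> ` bad_cubes Q h"
  proof
    fix y assume y: "y \<in> S1 - a"
    then obtain z where z: "z \<in> B" "y = \<sigma> z" using S1 by auto
    then have "\<not> cube (3 * h) z \<subseteq> Q" using off[of y] y SU \<sigma>cell by auto
    moreover have "cube (3 * h) z \<subseteq> icube (cube_center (3 * h) z) (10 * h)"
      using h by (auto simp: cube_eq_icube icube_def)
    ultimately have "z \<in> bad_cubes Q h" using z by (auto simp: bad_cubes_def)
    then show "y \<in> \<sigma> ` bad_cubes Q h" using z by blast
  qed
  then have "card (S1 - a) \<le> card (bad_cubes Q h)"
    by (rule surj_card_le[OF finite_bad_cubes[OF h Q(2)]])
  then show "card (a - S) \<le> card (bad_cubes Q h)" using cm(2) SU by simp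
  show "\<exists>y\<in>S. cell (3 * h) y = z" if "z \<in> B" for z using that SU S1 \<sigma>cell by blast
qed

lemma cube_of_eq: "y \<in> S \<Longrightarrow> cube_of Q n y = cube (3 * h) (cell (3 * h) y)"
proof -
  assume y: "y \<in> S"
  have "(THE z. z \<in> B \<and> y \<in> cube (3 * h) z) = cell (3 * h) y"
  proof (rule the_equality)
    show "cell (3 * h) y \<in> B \<and> y \<in> cube (3 * h) (cell (3 * h) y)"
      using S_cell[OF y] S_interior[OF y] by (simp add: cube_eq_icube icube_def)
    show "z = cell (3 * h) y" if "z \<in> B \<and> y \<in> cube (3 * h) z" for z
      using cube_unique[OF _ S_interior[OF y]] that h by simp
  qed
  then show ?thesis by (simp add: cube_of_def h_def)
qed

text \<open>Besides the cubes near the frontier these are the coarse cubes in which an inner centre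
  has been left out of S, so that the cell of some other node may extend beyond radius h.\<close>

definition exceptional :: "(int^'d) set" where
  "exceptional = bad_cubes Q h \<union> cell (3 * h) ` (a - S)"

lemma card_exceptional: "finite exceptional" "card exceptional \<le> 2 * card (bad_cubes Q h)"
proof -
  have f: "finite (bad_cubes Q h)" "finite (a - S)"
    using finite_bad_cubes[OF h Q(2)] finite_inner_centers[OF h Q(2)] by auto
  then show "finite exceptional" by (simp add: exceptional_def)
  have "card exceptional \<le> card (bad_cubes Q h) + card (cell (3 * h) ` (a - S))"
    unfolding exceptional_def by (rule card_Un_le)
  also have "\<dots> \<le> card (bad_cubes Q h) + card (a - S)" using f by (intro add_left_mono card_image_le)
  finally show "card exceptional \<le> 2 * card (bad_cubes Q h)" using missed by linarith
qed

text \<open>Off the grid, a point x of the cell lies in the interior of a fine cube in Q, whose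
  centre is a node since none is missed in this coarse cube. All other nodes are at distance at
  least h from x: inner centres because fine cubes do not overlap, the remaining nodes because they
  are too close to the frontier. So x belongs to the Voronoi cell of that centre, and disjointness
  identifies it with the given node.\<close>

lemma regular_node:
  assumes xs: "distinct xs" "set xs = S" and W: "completed_voronoi Q n xs W"
    and k: "k < length xs" and reg: "cell (3 * h) (xs ! k) \<notin> exceptional"
  shows "xs ! k \<in> a" "W k \<subseteq> icube (xs ! k) h \<union> grid h"
proof -
  let ?z = "cell (3 * h) (xs ! k)"
  let ?c = "cube_center (3 * h) ?z"
  have kS: "xs ! k \<in> S" using k xs by auto
  have "?z \<in> B" using S_cell[OF kS] .
  then have big: "icube ?c (10 * h) \<subseteq> Q" using reg by (auto simp: exceptional_def bad_cubes_def)
  have PQ: "cube (3 * h) ?z \<subseteq> Q" using big h by (auto simp: cube_eq_icube icube_def subset_iff)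
  show "xs ! k \<in> a" using S_off[OF kS] PQ by auto
  show "W k \<subseteq> icube (xs ! k) h \<union> grid h"
  proof
    fix x assume xW: "x \<in> W k"
    show "x \<in> icube (xs ! k) h \<union> grid h"
    proof (cases "x \<in> grid h")
      case False
      have xP: "x \<in> cube (3 * h) ?z" "x \<in> Q" using W xW k cube_of_eq[OF kS] by (auto simp: completed_voronoi_def)
      let ?m = "cell h x"
      have xm: "infnorm (x - cube_center h ?m) < h" by (rule cell_off_grid[OF h False])
      then have xm': "x \<in> cube h ?m" by (simp add: cube_eq_icube icube_def)
      let ?y = "cube_center h ?m"
      \<comment> \<open>x is interior to the coarse cube that contains its fine cube, and it lies in
        the coarse cube of the node; so the two coarse cubes coincide.\<close>
      have mz: "(\<chi> i. ?m $ i div 3) = ?z"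
      proof (rule cube_unique[symmetric])
        show "infnorm (x - cube_center (3 * h) (\<chi> i. ?m $ i div 3)) < 3 * h"
          using infnorm_triangle_diff[of x "cube_center (3 * h) (\<chi> i. ?m $ i div 3)" ?y] sub_cube(1)[OF h, of ?m] xm by linarith
      qed (use h xP in auto)
      have "cube h ?m \<subseteq> Q" using sub_cube(2)[OF h, of ?m] mz PQ by auto
      then have ya: "?y \<in> a" by (auto simp: inner_centers_def inner_cubes_def)
      have "cell (3 * h) ?y = ?z"
        using sub_cube(1)[OF h, of ?m] mz h by (intro cell_open_cube) auto
      then have yS: "?y \<in> S" using ya reg by (metis DiffI UnI2 exceptional_def imageI)
      then obtain j where j: "j < length xs" "xs ! j = ?y" using xs by (metis in_set_conv_nth)
      have cj: "cube_of Q n (xs ! j) = cube (3 * h) ?z" using cube_of_eq[OF yS] \<open>cell (3 * h) ?y = ?z\<close> j by simp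
      have far: "h \<le> infnorm (x - xs ! s)" if s: "s < length xs" "s \<noteq> j" for s
      proof (rule ccontr)
        assume "\<not> h \<le> infnorm (x - xs ! s)"
        then have near: "infnorm (x - xs ! s) < h" by simp
        have sS: "xs ! s \<in> S" using s xs by auto
        show False
        proof (cases "xs ! s \<in> a")
          case True
          then have e: "xs ! s = cube_center h (cell h (xs ! s))" by (rule inner_center_cell(4)[OF h])
          have "?m = cell h (xs ! s)"
            by (rule cell_open_cube[OF h]) (use near e in simp)
          then have "xs ! s = xs ! j" using e j by simp
          then show False using nth_eq_iff_index_eq[OF xs(1) s(1) j(1)] s(2) by simp
        next
          case False
          \<comment> \<open>10 h = 3 h + 3 h + h + 3 h along the points w, \<open>?c'\<close>, the
            node, x and \<open>?c\<close>.\<close>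
          have "cube (3 * h) (cell (3 * h) (xs ! s)) \<subseteq> Q"
          proof
            fix w assume w: "w \<in> cube (3 * h) (cell (3 * h) (xs ! s))"
            let ?c' = "cube_center (3 * h) (cell (3 * h) (xs ! s))"
            have "infnorm (w - ?c') \<le> 3 * h" using w by (simp add: cube_eq_icube icube_def)
            moreover have "infnorm (xs ! s - ?c') < 3 * h" by (rule S_interior[OF sS])
            moreover have "infnorm (x - ?c) \<le> 3 * h" using xP by (simp add: cube_eq_icube icube_def)
            ultimately have "infnorm (w - ?c) \<le> 10 * h"
              using near infnorm_triangle_diff[of w ?c ?c'] infnorm_triangle_diff[of ?c' ?c "xs ! s"]
                infnorm_triangle_diff[of "xs ! s" ?c x] infnorm_sub[of ?c' "xs ! s"] infnorm_sub[of "xs ! s" x] by linarith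
            then show "w \<in> Q" using big by (auto simp: icube_def)
          qed
          then show False using S_off[OF sS False] by simp
        qed
      qed
      have "x \<in> voronoi Q n xs j"
        unfolding voronoi_def using xP cj far xm j by fastforce
      then have "x \<in> W j" using W j by (auto simp: completed_voronoi_def)
      then have "j = k"
        using W j k xW unfolding completed_voronoi_def disjoint_family_on_def by blast
      then show ?thesis using xm j by (simp add: icube_def)
    qed simp
  qed
qed

end

subsection \<open>Quadrature error of the Voronoi method\<close>

text \<open>The upper bound on the optimal error needs at least one outcome of the construction of
  the nodes, whereas the second claim of the theorem quantifies over all of them.\<close>

lemma is_S_exists:
  assumes "0 < half_step Q n" "bounded (Q :: (real^'d) set)"
  shows "\<exists>S. is_S Q n S"
proof -
  let ?h = "half_step Q n"
  let ?a = "inner_centers Q ?h"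
  let ?B = "meeting_cubes Q (3 * ?h)"
  define \<sigma> where "\<sigma> z = (if cube_center (3 * ?h) z \<in> ?a then cube_center (3 * ?h) z
      else if cube (3 * ?h) z \<inter> ?a \<noteq> {} then SOME y. y \<in> cube (3 * ?h) z \<inter> ?a
      else SOME y. y \<in> interior (Q \<inter> cube (3 * ?h) z))" for z
  let ?S1 = "\<sigma> ` ?B"
  have "is_S1 Q n ?S1"
    unfolding is_S1_def Let_def
  proof (intro exI[of _ \<sigma>] conjI refl ballI)
    fix z assume "z \<in> ?B"
    then have ex: "\<exists>y. y \<in> interior (Q \<inter> cube (3 * ?h) z)" by (auto simp: meeting_cubes_def)
    have ex2: "\<exists>y. y \<in> cube (3 * ?h) z \<inter> ?a" if "cube (3 * ?h) z \<inter> ?a \<noteq> {}" using that by auto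
    show "if cube_center (3 * ?h) z \<in> ?a then \<sigma> z = cube_center (3 * ?h) z
          else if cube (3 * ?h) z \<inter> ?a \<noteq> {} then \<sigma> z \<in> cube (3 * ?h) z \<inter> ?a
          else \<sigma> z \<in> interior (Q \<inter> cube (3 * ?h) z)"
      using someI_ex[OF ex] someI_ex[OF ex2] unfolding \<sigma>_def by presburger
  qed
  moreover have "\<exists>S2. if card (?a - ?S1) < n - card ?S1 then S2 = ?a - ?S1
        else S2 \<subseteq> ?a - ?S1 \<and> card S2 = n - card ?S1"
  proof (cases "card (?a - ?S1) < n - card ?S1")
    case False
    then show ?thesis using obtain_subset_with_card_n[of "n - card ?S1" "?a - ?S1"] by (metis not_less)
  qed auto
  ultimately show ?thesis unfolding is_S_def Let_def by blast
qed

lemma voronoi_borel: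
  assumes "open Q" shows "voronoi Q n xs k \<in> sets borel"
proof -
  have [measurable]: "Q \<in> sets borel" using assms by simp
  have [measurable]: "cube_of Q n (xs ! k) \<in> sets borel" by (simp add: cube_of_def)
  have "voronoi Q n xs k = (Q \<inter> cube_of Q n (xs ! k)) \<inter> {x. \<forall>s<length xs. s \<noteq> k \<longrightarrow> infnorm (x - xs ! k) < infnorm (x - xs ! s)}"
    by (auto simp: voronoi_def)
  also have "\<dots> \<in> sets borel" by measurable
  finally show ?thesis .
qed

text \<open>A left-over point is given to the first node whose coarse cube contains it. Off the
  coarse grid there is such a node, since every coarse cube that meets Q contains one.\<close>

lemma (in node_set) completed_voronoi_exists:
  assumes xs: "distinct xs" "set xs = S"
  shows "\<exists>W. completed_voronoi Q n xs W"
proof -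
  let ?V = "voronoi Q n xs" and ?C = "\<lambda>k. cube_of Q n (xs ! k)"
  define W where "W k = ?V k \<union> ((Q \<inter> ?C k - (\<Union>j<length xs. ?V j)) - (\<Union>j<k. ?C j))" for k
  have VC: "?V k \<subseteq> Q \<inter> ?C k" for k by (auto simp: voronoi_def)
  have "completed_voronoi Q n xs W"
    unfolding completed_voronoi_def
  proof (intro conjI allI impI)
    fix k assume k: "k < length xs"
    have [measurable]: "Q \<in> sets borel" "?C j \<in> sets borel" "?V j \<in> sets borel" for j
      using Q voronoi_borel[OF Q(1)] by (auto simp: cube_of_def)
    have "W k \<in> sets borel" unfolding W_def by measurable
    then show "W k \<in> sets lebesgue" by simp
    show "?V k \<subseteq> W k" by (simp add: W_def)
    show "W k \<subseteq> Q \<inter> ?C k" using VC by (auto simp: W_def)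
  next
    show "disjoint_family_on W {..<length xs}"
      unfolding disjoint_family_on_def
    proof (intro ballI impI)
      fix i j assume ij: "i \<in> {..<length xs}" "j \<in> {..<length xs}" "i \<noteq> j"
      have "?V i \<inter> ?V j = {}" using ij by (fastforce simp: voronoi_def)
      moreover have "((Q \<inter> ?C i - (\<Union>j<length xs. ?V j)) - (\<Union>j<i. ?C j)) \<inter> ((Q \<inter> ?C j - (\<Union>j<length xs. ?V j)) - (\<Union>i<j. ?C i)) = {}"
        using ij(3) by (cases "i < j") (auto simp: not_less le_less)
      ultimately show "W i \<inter> W j = {}" using ij by (auto simp: W_def)
    qed
    have "Q - (\<Union>k<length xs. W k) \<subseteq> grid (3 * h)"
    proof (rule subsetI, rule ccontr)
      fix x assume x: "x \<in> Q - (\<Union>k<length xs. W k)" "x \<notin> grid (3 * h)"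
      let ?z = "cell (3 * h) x"
      have xz: "infnorm (x - cube_center (3 * h) ?z) < 3 * h" using x h by (intro cell_off_grid) auto
      then have "x \<in> interior (Q \<inter> cube (3 * h) ?z)" using x Q by (simp add: interior_cube interior_open)
      then have "?z \<in> B" by (auto simp: meeting_cubes_def)
      then obtain y where y: "y \<in> S" "cell (3 * h) y = ?z" using S_covers by blast
      then obtain j where j: "j < length xs" "xs ! j = y" using xs by (metis in_set_conv_nth)
      have "x \<in> ?C j" using cube_of_eq[OF y(1)] j y xz by (simp add: cube_eq_icube icube_def)
      define k where "k = (LEAST k. x \<in> ?C k)"
      have k: "x \<in> ?C k" "k \<le> j" "\<And>i. i < k \<Longrightarrow> x \<notin> ?C i"
        unfolding k_def using \<open>x \<in> ?C j\<close> by (auto intro: LeastI Least_le dest: not_less_Least)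
      have nV: "x \<notin> ?V i" if "i < length xs" for i using x that by (auto simp: W_def)
      have "x \<in> W k" unfolding W_def using x k nV by auto
      moreover have "k < length xs" using k j by linarith
      ultimately show False using x by auto
    qed
    moreover have "negligible (grid (3 * h) :: (real^'d) set)"
      using null_sets_completionI[OF grid_null[of "3 * h"]] by (simp only: negligible_iff_null_sets)
    ultimately show "negligible (Q - (\<Union>k<length xs. W k))" by (rule negligible_subset[rotated])
  qed
  then show ?thesis by blast
qed

text \<open>If x lies in the enlarged cube of z, then the original cube of z lies in the cube of
  radius (\<kappa> + 1) h about x. Comparing volumes, at most (\<kappa> + 1)^d enlarged cubes
  contain x.\<close>

lemma overlap_le:
  fixes F :: "real^'d \<Rightarrow> ennreal"
  assumes h: "0 < h" and Z: "finite Z" and \<kappa>: "0 \<le> \<kappa>"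
    and [measurable]: "F \<in> borel_measurable borel" "Q \<in> sets borel"
  shows "(\<Sum>z\<in>Z. \<integral>\<^sup>+x\<in>Q \<inter> icube (cube_center h z) (\<kappa> * h). F x \<partial>lborel)
     \<le> ennreal ((\<kappa> + 1) ^ CARD('d)) * (\<integral>\<^sup>+x\<in>Q. F x \<partial>lborel)"
proof -
  have "(\<Sum>z\<in>Z. \<integral>\<^sup>+x\<in>Q \<inter> icube (cube_center h z) (\<kappa> * h). F x \<partial>lborel)
     = (\<integral>\<^sup>+x. (\<Sum>z\<in>Z. F x * indicator (Q \<inter> icube (cube_center h z) (\<kappa> * h)) x) \<partial>lborel)"
    by (rule nn_integral_sum[symmetric]) measurable
  also have "\<dots> \<le> (\<integral>\<^sup>+x. ennreal ((\<kappa> + 1) ^ CARD('d)) * (F x * indicator Q x) \<partial>lborel)"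
  proof (rule nn_integral_mono)
    fix x
    let ?Y = "{z \<in> Z. x \<in> icube (cube_center h z) (\<kappa> * h)}"
    have "real (card ?Y) * (2 * h) ^ CARD('d) \<le> measure lborel (icube x ((\<kappa> + 1) * h))"
    proof (rule card_cubes_le[OF h])
      fix z assume "z \<in> ?Y"
      then have "infnorm (x - cube_center h z) \<le> \<kappa> * h" by (simp add: icube_def)
      then show "cube h z \<subseteq> icube x ((\<kappa> + 1) * h)"
        unfolding cube_eq_icube icube_def
      proof (intro subsetI CollectI, elim CollectE)
        fix y assume "infnorm (y - cube_center h z) \<le> h"
        then show "infnorm (y - x) \<le> (\<kappa> + 1) * h"
          using infnorm_triangle_diff[of y x "cube_center h z"] infnorm_sub[of x "cube_center h z"]
            \<open>infnorm (x - cube_center h z) \<le> \<kappa> * h\<close> by (simp add: algebra_simps)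
      qed
    qed (use Z compact_imp_bounded[OF icube_compact] in auto)
    also have "\<dots> = (\<kappa> + 1) ^ CARD('d) * (2 * h) ^ CARD('d)"
      using h \<kappa> by (simp add: measure_icube power_mult_distrib)
    finally have "real (card ?Y) \<le> (\<kappa> + 1) ^ CARD('d)" using h by simp
    then have c: "of_nat (card ?Y) \<le> ennreal ((\<kappa> + 1) ^ CARD('d))"
      by (metis ennreal_leI ennreal_of_nat_eq_real_of_nat)
    have "(\<Sum>z\<in>Z. F x * indicator (Q \<inter> icube (cube_center h z) (\<kappa> * h)) x) = (\<Sum>z\<in>?Y. F x * indicator Q x)"
      using Z by (intro sum.mono_neutral_cong_right) (auto simp: indicator_def)
    also have "\<dots> = of_nat (card ?Y) * (F x * indicator Q x)" by simp
    also have "\<dots> \<le> ennreal ((\<kappa> + 1) ^ CARD('d)) * (F x * indicator Q x)" by (intro mult_right_mono c) simp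
    finally show "(\<Sum>z\<in>Z. F x * indicator (Q \<inter> icube (cube_center h z) (\<kappa> * h)) x) \<le> ennreal ((\<kappa> + 1) ^ CARD('d)) * (F x * indicator Q x)" .
  qed
  also have "\<dots> = ennreal ((\<kappa> + 1) ^ CARD('d)) * (\<integral>\<^sup>+x\<in>Q. F x \<partial>lborel)"
    by (rule nn_integral_cmult) measurable
  finally show ?thesis .
qed

locale quadrature = node_set Q n S h
  for Q :: "(real^'d) set" and n S h +
  fixes xs :: "(real^'d) list" and W :: "nat \<Rightarrow> (real^'d) set"
  assumes xs: "distinct xs" "set xs = S" and W: "completed_voronoi Q n xs W"
begin

lemma W_props:
  assumes "k < length xs"
  shows "W k \<in> sets lebesgue" "W k \<subseteq> Q" "W k \<subseteq> cube (3 * h) (cell (3 * h) (xs ! k))" "xs ! k \<in> S"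
proof -
  show kS: "xs ! k \<in> S" using assms xs by auto
  have "W k \<in> sets lebesgue \<and> W k \<subseteq> Q \<inter> cube_of Q n (xs ! k)"
    using W assms by (simp add: completed_voronoi_def)
  then show "W k \<in> sets lebesgue" "W k \<subseteq> Q" "W k \<subseteq> cube (3 * h) (cell (3 * h) (xs ! k))"
    using cube_of_eq[OF kS] by auto
qed

definition regular :: "nat set" where "regular = {k. k < length xs \<and> cell (3 * h) (xs ! k) \<notin> exceptional}"
definition irregular :: "nat set" where "irregular = {k. k < length xs \<and> cell (3 * h) (xs ! k) \<in> exceptional}"

lemma regular_irregular: "{..<length xs} = regular \<union> irregular" "regular \<inter> irregular = {}"
  "finite regular" "finite irregular"
  by (auto simp: regular_def irregular_def)

text \<open>The kernel terms are all equal and at most n in number. The \<Gamma> terms are integrals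
  over different fine cubes inside Q, so they add up to at most the integral over Q, with no
  constant lost.\<close>

lemma regular_error:
  assumes "dominated_gradient Q f G g \<Gamma> \<alpha> \<beta> q"
  shows "(\<Sum>k\<in>regular. \<integral>\<^sup>+x\<in>W k. ennreal \<bar>f x - f (xs ! k)\<bar> \<partial>lebesgue)
    \<le> ennreal \<alpha> * (of_nat n * (\<integral>\<^sup>+y\<in>icube (0::real^'d) h. ennreal (kern h y powr q) \<partial>lborel))
       + ennreal \<beta> * (\<integral>\<^sup>+y\<in>Q. ennreal (\<Gamma> y) \<partial>lborel)"
proof -
  interpret dg: dominated_gradient Q f G g \<Gamma> \<alpha> \<beta> q by fact
  note [measurable] = dg.\<Gamma>_meas dg.Q_borel dg.f0_measurable
  let ?K = "\<integral>\<^sup>+y\<in>icube (0::real^'d) h. ennreal (kern h y powr q) \<partial>lborel"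
  let ?m = "\<lambda>k. cell h (xs ! k)"
  have ak: "xs ! k \<in> a" "W k \<subseteq> icube (xs ! k) h \<union> grid h" if "k \<in> regular" for k
    using regular_node[OF xs W, of k] that by (auto simp: regular_def)
  have cb: "icube (xs ! k) h = cube h (?m k)" if "k \<in> regular" for k
    using inner_center_cell(4)[OF h ak(1)[OF that]] by (simp add: cube_eq_icube)
  have inj: "inj_on ?m regular"
  proof (rule inj_onI)
    fix i j assume ij: "i \<in> regular" "j \<in> regular" "?m i = ?m j"
    then have "xs ! i = xs ! j" using inner_center_cell(4)[OF h ak(1)] by metis
    then show "i = j" using ij xs by (auto simp: regular_def nth_eq_iff_index_eq)
  qed
  have "(\<integral>\<^sup>+x\<in>W k. ennreal \<bar>f x - f (xs ! k)\<bar> \<partial>lebesgue) \<le> ennreal \<alpha> * ?K + ennreal \<beta> * (\<integral>\<^sup>+y\<in>cube h (?m k). ennreal (\<Gamma> y) \<partial>lborel)"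
    if k: "k \<in> regular" for k
  proof -
    have "(\<integral>\<^sup>+x\<in>W k. ennreal \<bar>f x - f (xs ! k)\<bar> \<partial>lebesgue) = (\<integral>\<^sup>+x\<in>W k. ennreal \<bar>f x - f (xs ! k)\<bar> \<partial>lborel)"
      by (rule nn_integral_completion)
    also have "\<dots> \<le> (\<integral>\<^sup>+x\<in>icube (xs ! k) h. ennreal \<bar>f x - f (xs ! k)\<bar> \<partial>lborel)"
      using AE_off_grid[of h] ak(2)[OF k]
      by (intro nn_integral_mono_AE) (auto elim!: eventually_mono simp: indicator_def)
    also have "\<dots> \<le> ennreal \<alpha> * (\<integral>\<^sup>+y\<in>icube (xs ! k) h. ennreal (kern h (y - xs ! k) powr q) \<partial>lborel) + ennreal \<beta> * (\<integral>\<^sup>+y\<in>icube (xs ! k) h. ennreal (\<Gamma> y) \<partial>lborel)"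
    proof (rule dg.star_poincare)
      show "icube (xs ! k) h \<subseteq> Q" by (rule inner_center_cell(3)[OF h ak(1)[OF k]])
      fix z s assume "z \<in> icube (xs ! k) h" and s: "0 \<le> s" "s \<le> (1::real)"
      then have "s * infnorm (z - xs ! k) \<le> 1 * h" by (intro mult_mono infnorm_pos_le) (auto simp: icube_def)
      then show "xs ! k + s *\<^sub>R (z - xs ! k) \<in> icube (xs ! k) h" using s by (simp add: icube_def infnorm_mul)
    qed (use h in auto)
    also have "(\<integral>\<^sup>+y\<in>icube (xs ! k) h. ennreal (kern h (y - xs ! k) powr q) \<partial>lborel) = ?K"
      by (rule nn_integral_icube_translate) measurable
    finally show ?thesis by (simp add: cb[OF k])
  qed
  then have "(\<Sum>k\<in>regular. \<integral>\<^sup>+x\<in>W k. ennreal \<bar>f x - f (xs ! k)\<bar> \<partial>lebesgue)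
     \<le> (\<Sum>k\<in>regular. ennreal \<alpha> * ?K + ennreal \<beta> * (\<integral>\<^sup>+y\<in>cube h (?m k). ennreal (\<Gamma> y) \<partial>lborel))"
    by (rule sum_mono)
  also have "\<dots> = of_nat (card regular) * (ennreal \<alpha> * ?K) + ennreal \<beta> * (\<Sum>z\<in>?m ` regular. \<integral>\<^sup>+y\<in>cube h z. ennreal (\<Gamma> y) \<partial>lborel)"
    by (simp add: sum.distrib sum_distrib_left sum.reindex[OF inj])
  also have "\<dots> \<le> of_nat n * (ennreal \<alpha> * ?K) + ennreal \<beta> * (\<integral>\<^sup>+y\<in>Q. ennreal (\<Gamma> y) \<partial>lborel)"
  proof (intro add_mono mult_left_mono mult_right_mono)
    have "card regular \<le> card {..<length xs}" by (rule card_mono) (auto simp: regular_def)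
    also have "\<dots> \<le> n" using S_card xs distinct_card[OF xs(1)] by simp
    finally show "of_nat (card regular) \<le> (of_nat n :: ennreal)" by simp
    show "(\<Sum>z\<in>?m ` regular. \<integral>\<^sup>+y\<in>cube h z. ennreal (\<Gamma> y) \<partial>lborel) \<le> (\<integral>\<^sup>+y\<in>Q. ennreal (\<Gamma> y) \<partial>lborel)"
      using inner_center_cell(3)[OF h ak(1)] cb by (intro sum_cubes_le h) (auto simp: regular_irregular)
  qed auto
  finally show ?thesis by (simp add: mult.left_commute)
qed

text \<open>Two points of one coarse cube are at distance at most 6 h, so \<open>oscillation\<close>
  with \<rho> = 6 h bounds the error of all nodes of the cube z by the same \<open>E z\<close>; this
  is the origin of R and of \<open>12 * h \<le> r\<close>. After that only the number of exceptional
  cubes and the overlap of their enlargements matter.\<close>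

lemma irregular_error:
  assumes dg: "dominated_gradient Q f G g \<Gamma> \<alpha> \<beta> q"
    and r: "0 < r" "\<And>x y s. x \<in> Q \<Longrightarrow> y \<in> icube c r \<Longrightarrow> 0 \<le> s \<Longrightarrow> s \<le> 1 \<Longrightarrow> x + s *\<^sub>R (y - x) \<in> Q"
    and D: "0 < D" "\<And>x. x \<in> Q \<Longrightarrow> infnorm (x - c) \<le> D"
    and hr: "12 * h \<le> r"
  defines "R \<equiv> 12 * (r + D) / r * h"
  shows "(\<Sum>k\<in>irregular. \<integral>\<^sup>+x\<in>W k. ennreal \<bar>f x - f (xs ! k)\<bar> \<partial>lebesgue)
    \<le> 2 * (ennreal \<alpha> * (of_nat (2 * card (bad_cubes Q h)) * (\<integral>\<^sup>+y\<in>icube (0::real^'d) R. ennreal (kern R y powr q) \<partial>lborel))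
       + ennreal \<beta> * (ennreal ((4 * (r + D) / r + 4) ^ CARD('d)) * (\<integral>\<^sup>+y\<in>Q. ennreal (\<Gamma> y) \<partial>lborel)))"
proof -
  interpret dg: dominated_gradient Q f G g \<Gamma> \<alpha> \<beta> q by fact
  note [measurable] = dg.\<Gamma>_meas dg.Q_borel dg.f0_measurable
  let ?K = "\<integral>\<^sup>+y\<in>icube (0::real^'d) R. ennreal (kern R y powr q) \<partial>lborel"
  \<comment> \<open>Chosen so that \<kappa> (3 h) = R + 6 h + 3 h: \<open>oscillation\<close> uses
    the cube of radius R + \<rho> about a point at distance at most 3 h from the centre.\<close>
  let ?\<kappa> = "4 * (r + D) / r + 3"
  define E where "E z = 2 * (ennreal \<alpha> * ?K + ennreal \<beta> * (\<integral>\<^sup>+y\<in>Q \<inter> icube (cube_center (3 * h) z) (?\<kappa> * (3 * h)). ennreal (\<Gamma> y) \<partial>lborel))" for z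
  let ?w = "(12 * h) ^ CARD('d)"
  let ?Z = "\<lambda>z. {k \<in> irregular. cell (3 * h) (xs ! k) = z}"
  have osc: "ennreal ?w * ennreal \<bar>f x - f y\<bar> \<le> E z" if x: "x \<in> Q" "x \<in> cube (3 * h) z" and y: "y \<in> Q" "y \<in> cube (3 * h) z" for x y z
  proof -
    have xz: "infnorm (x - cube_center (3 * h) z) \<le> 3 * h" and yz: "infnorm (y - cube_center (3 * h) z) \<le> 3 * h"
      using x y by (auto simp: cube_eq_icube icube_def)
    have "infnorm (x - y) \<le> 6 * h"
      using infnorm_triangle_diff[of x y "cube_center (3 * h) z"] infnorm_sub[of y "cube_center (3 * h) z"] xz yz by linarith
    moreover have "2 * (6 * h) / r * (r + D) = R" by (simp add: R_def)
    ultimately have "ennreal ((2 * (6 * h)) ^ CARD('d) * \<bar>f x - f y\<bar>) \<le> 2 * (ennreal \<alpha> * ?K + ennreal \<beta> * (\<integral>\<^sup>+y\<in>Q \<inter> icube x (R + 6 * h). ennreal (\<Gamma> y) \<partial>lborel))"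
      using dg.oscillation[OF r D, of "6 * h" x y] h hr x y by simp
    also have "\<dots> \<le> E z"
      unfolding E_def
    proof (intro mult_left_mono add_left_mono nn_integral_mono)
      have "icube x (R + 6 * h) \<subseteq> icube (cube_center (3 * h) z) (?\<kappa> * (3 * h))"
      proof
        fix w assume "w \<in> icube x (R + 6 * h)"
        then have "infnorm (w - cube_center (3 * h) z) \<le> R + 6 * h + 3 * h"
          using infnorm_triangle_diff[of w "cube_center (3 * h) z" x] xz by (simp add: icube_def)
        also have "\<dots> = ?\<kappa> * (3 * h)" by (simp add: R_def algebra_simps add_divide_distrib)
        finally show "w \<in> icube (cube_center (3 * h) z) (?\<kappa> * (3 * h))" by (simp add: icube_def)
      qed
      then show "indicator (Q \<inter> icube x (R + 6 * h)) y \<le> (indicator (Q \<inter> icube (cube_center (3 * h) z) (?\<kappa> * (3 * h))) y :: ennreal)" for y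
        by (auto simp: indicator_def)
    qed auto
    finally show ?thesis using h by (simp add: ennreal_mult)
  qed
  have one: "ennreal ?w * (\<integral>\<^sup>+x\<in>W k. ennreal \<bar>f x - f (xs ! k)\<bar> \<partial>lebesgue) \<le> E z * emeasure lebesgue (W k)"
    if k: "k \<in> ?Z z" for k z
  proof -
    have kl: "k < length xs" and z: "z = cell (3 * h) (xs ! k)" using k by (auto simp: irregular_def)
    note Wk = W_props[OF kl]
    have xk: "xs ! k \<in> Q" "xs ! k \<in> cube (3 * h) z"
      using Wk(4) S_sub S_interior[OF Wk(4)] z by (auto simp: cube_eq_icube icube_def)
    have [measurable]: "W k \<in> sets lebesgue" by fact
    have "(\<integral>\<^sup>+x\<in>W k. ennreal \<bar>f x - f (xs ! k)\<bar> \<partial>lebesgue) = (\<integral>\<^sup>+x\<in>W k. ennreal \<bar>dg.f0 x - f (xs ! k)\<bar> \<partial>lebesgue)"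
      using Wk by (intro nn_integral_cong) (auto simp: dg.f0_def indicator_def)
    moreover have [measurable]: "dg.f0 \<in> borel_measurable lebesgue" using dg.f0_measurable by (intro measurable_completion) simp
    ultimately have "ennreal ?w * (\<integral>\<^sup>+x\<in>W k. ennreal \<bar>f x - f (xs ! k)\<bar> \<partial>lebesgue) = (\<integral>\<^sup>+x. ennreal ?w * (ennreal \<bar>dg.f0 x - f (xs ! k)\<bar> * indicator (W k) x) \<partial>lebesgue)"
      by (simp add: nn_integral_cmult)
    also have "\<dots> \<le> (\<integral>\<^sup>+x. E z * indicator (W k) x \<partial>lebesgue)"
      using osc[OF _ _ xk] Wk z by (intro nn_integral_mono) (auto simp: indicator_def dg.f0_def)
    also have "\<dots> = E z * emeasure lebesgue (W k)" by (rule nn_integral_cmult_indicator) measurable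
    finally show ?thesis .
  qed
  \<comment> \<open>The cells of one coarse cube are disjoint parts of it, so their volumes add up
    to at most (6 h)^d. This is below (12 h)^d, the factor (2 \<rho>)^d on the left of
    \<open>oscillation\<close>, which therefore can be cancelled.\<close>
  have vol6: "(\<Sum>k\<in>?Z z. emeasure lebesgue (W k)) \<le> ennreal ?w" for z
  proof -
    have "(\<Sum>k\<in>?Z z. emeasure lebesgue (W k)) = emeasure lebesgue (\<Union>k\<in>?Z z. W k)"
    proof (rule sum_emeasure)
      show "W ` ?Z z \<subseteq> sets lebesgue" using W_props(1) by (auto simp: irregular_def)
      show "disjoint_family_on W (?Z z)"
        using W unfolding completed_voronoi_def by (auto simp: irregular_def disjoint_family_on_def)
      show "finite (?Z z)" using regular_irregular by auto
    qed
    also have "\<dots> \<le> emeasure lebesgue (cube (3 * h) z)"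
    proof (rule emeasure_mono)
      show "(\<Union>k\<in>?Z z. W k) \<subseteq> cube (3 * h) z" using W_props(3) by (auto simp: irregular_def)
    qed simp
    also have "\<dots> = ennreal ((2 * (3 * h)) ^ CARD('d))" using h by (simp add: cube_eq_icube emeasure_icube)
    also have "\<dots> \<le> ennreal ?w" using h by (intro ennreal_leI power_mono) auto
    finally show ?thesis .
  qed
  have "ennreal ?w * (\<Sum>k\<in>irregular. \<integral>\<^sup>+x\<in>W k. ennreal \<bar>f x - f (xs ! k)\<bar> \<partial>lebesgue)
     = (\<Sum>z\<in>exceptional. \<Sum>k\<in>?Z z. ennreal ?w * (\<integral>\<^sup>+x\<in>W k. ennreal \<bar>f x - f (xs ! k)\<bar> \<partial>lebesgue))"
  proof -
    have "(\<lambda>k. cell (3 * h) (xs ! k)) ` irregular \<subseteq> exceptional" by (auto simp: irregular_def)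
    from sum.group[OF regular_irregular(4) card_exceptional(1) this, of "\<lambda>k. ennreal ?w * (\<integral>\<^sup>+x\<in>W k. ennreal \<bar>f x - f (xs ! k)\<bar> \<partial>lebesgue)"]
    show ?thesis by (simp add: sum_distrib_left)
  qed
  also have "\<dots> \<le> (\<Sum>z\<in>exceptional. \<Sum>k\<in>?Z z. E z * emeasure lebesgue (W k))"
    by (intro sum_mono one)
  also have "\<dots> = (\<Sum>z\<in>exceptional. E z * (\<Sum>k\<in>?Z z. emeasure lebesgue (W k)))"
    by (simp add: sum_distrib_left)
  also have "\<dots> \<le> (\<Sum>z\<in>exceptional. E z * ennreal ?w)"
    by (intro sum_mono mult_left_mono vol6) simp
  also have "\<dots> = ennreal ?w * (\<Sum>z\<in>exceptional. E z)" by (simp only: sum_distrib_right[symmetric] mult.commute)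
  finally have "(\<Sum>k\<in>irregular. \<integral>\<^sup>+x\<in>W k. ennreal \<bar>f x - f (xs ! k)\<bar> \<partial>lebesgue) \<le> (\<Sum>z\<in>exceptional. E z)"
    using h by (subst (asm) ennreal_mult_le_mult_iff) auto
  also have "\<dots> = 2 * (ennreal \<alpha> * (of_nat (card exceptional) * ?K) + ennreal \<beta> * (\<Sum>z\<in>exceptional. (\<integral>\<^sup>+y\<in>Q \<inter> icube (cube_center (3 * h) z) (?\<kappa> * (3 * h)). ennreal (\<Gamma> y) \<partial>lborel)))"
    unfolding E_def by (simp add: sum_distrib_left[symmetric] sum.distrib mult.left_commute)
  also have "\<dots> \<le> 2 * (ennreal \<alpha> * (of_nat (2 * card (bad_cubes Q h)) * ?K)
       + ennreal \<beta> * (ennreal ((?\<kappa> + 1) ^ CARD('d)) * (\<integral>\<^sup>+y\<in>Q. ennreal (\<Gamma> y) \<partial>lborel)))"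
    using h r D card_exceptional by (intro mult_left_mono add_mono mult_right_mono overlap_le of_nat_mono) auto
  finally show ?thesis by (simp add: add.assoc)
qed

text \<open>As the sets W k partition Q up to a null set and the weights are their measures, the
  error is the sum of the integrals of f x - f (xs ! k) over W k.\<close>

lemma weighted_error:
  assumes dg: "dominated_gradient Q f G g \<Gamma> \<alpha> \<beta> q"
  shows "ennreal \<bar>(LINT x|lebesgue_on Q. f x) - weighted_sum W (map f xs)\<bar>
     \<le> (\<Sum>k\<in>regular. \<integral>\<^sup>+x\<in>W k. ennreal \<bar>f x - f (xs ! k)\<bar> \<partial>lebesgue)
      + (\<Sum>k\<in>irregular. \<integral>\<^sup>+x\<in>W k. ennreal \<bar>f x - f (xs ! k)\<bar> \<partial>lebesgue)"
proof -
  interpret dg: dominated_gradient Q f G g \<Gamma> \<alpha> \<beta> q by fact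
  note [measurable] = dg.\<Gamma>_meas dg.Q_borel dg.f0_measurable
  let ?I = "{..<length xs}"
  have f0L [measurable]: "dg.f0 \<in> borel_measurable lebesgue" using dg.f0_measurable by (intro measurable_completion) simp
  have f0int: "integrable lebesgue dg.f0" using dg.f0_integrable dg.f0_measurable by (simp add: integrable_completion)
  have WL [measurable]: "W k \<in> sets lebesgue" if "k \<in> ?I" for k using W_props that by auto
  have Wfin: "emeasure lebesgue (W k) < \<infinity>" if "k \<in> ?I" for k
  proof -
    have "emeasure lebesgue (W k) \<le> emeasure lebesgue Q" using W_props(2) that Q by (intro emeasure_mono) auto
    also have "\<dots> < \<infinity>" using Q emeasure_bounded_finite[OF Q(2)] by simp
    finally show ?thesis .
  qed
  have i1: "integrable lebesgue (\<lambda>x. indicator (W k) x * dg.f0 x)" if "k \<in> ?I" for k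
    using integrable_mult_indicator[OF WL[OF that] f0int] by simp
  have i2: "integrable lebesgue (\<lambda>x. indicator (W k) x * c)" if "k \<in> ?I" for k and c :: real
    using WL[OF that] Wfin[OF that] by (intro integrable_mult_left) (auto simp: integrable_indicator_iff)
  have "(LINT x|lebesgue_on Q. f x) = (LINT x|lebesgue. dg.f0 x)"
    using integral_restrict_space[OF dg.Q_lebesgue, of f] by (simp add: dg.f0_def[abs_def])
  also have "\<dots> = (LINT x|lebesgue. (\<Sum>k\<in>?I. indicator (W k) x * dg.f0 x))"
  proof (rule integral_cong_AE)
    have "negligible (Q - (\<Union>k<length xs. W k))" using W by (simp add: completed_voronoi_def)
    then have "AE x in lebesgue. x \<notin> Q - (\<Union>k<length xs. W k)"
      by (intro AE_not_in) (simp add: negligible_iff_null_sets)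
    then show "AE x in lebesgue. dg.f0 x = (\<Sum>k\<in>?I. indicator (W k) x * dg.f0 x)"
    proof eventually_elim
      case (elim x)
      show ?case
      proof (cases "x \<in> Q")
        case True
        then obtain j where j: "j \<in> ?I" "x \<in> W j" using elim by auto
        have "x \<notin> W k" if "k \<in> ?I" "k \<noteq> j" for k
          using W j that unfolding completed_voronoi_def disjoint_family_on_def by blast
        then have "(\<Sum>k\<in>?I. indicator (W k) x * dg.f0 x) = (\<Sum>k\<in>?I. if k = j then dg.f0 x else 0)"
          using j by (intro sum.cong) (auto simp: indicator_def)
        then show ?thesis using j by simp
      qed (simp add: dg.f0_def)
    qed
    show "(\<lambda>x. \<Sum>k\<in>?I. indicator (W k) x * dg.f0 x) \<in> borel_measurable lebesgue"
      using i1 by (intro borel_measurable_sum) blast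
  qed measurable
  finally have lhs: "(LINT x|lebesgue_on Q. f x) = (LINT x|lebesgue. (\<Sum>k\<in>?I. indicator (W k) x * dg.f0 x))" .
  have "weighted_sum W (map f xs) = (\<Sum>k\<in>?I. LINT x|lebesgue. indicator (W k) x * f (xs ! k))"
    unfolding weighted_sum_def using WL by (intro sum.cong) auto
  also have "\<dots> = (LINT x|lebesgue. (\<Sum>k\<in>?I. indicator (W k) x * f (xs ! k)))"
    using i2 by (intro Bochner_Integration.integral_sum[symmetric]) auto
  finally have rhs: "weighted_sum W (map f xs) = (LINT x|lebesgue. (\<Sum>k\<in>?I. indicator (W k) x * f (xs ! k)))" .
  have "(LINT x|lebesgue_on Q. f x) - weighted_sum W (map f xs) =
     (LINT x|lebesgue. (\<Sum>k\<in>?I. indicator (W k) x * dg.f0 x) - (\<Sum>k\<in>?I. indicator (W k) x * f (xs ! k)))"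
    unfolding lhs rhs
    by (rule Bochner_Integration.integral_diff[symmetric]; intro Bochner_Integration.integrable_sum i1 i2)
  also have "\<dots> = (LINT x|lebesgue. (\<Sum>k\<in>?I. indicator (W k) x * (dg.f0 x - f (xs ! k))))"
    by (simp only: sum_subtractf[symmetric] right_diff_distrib)
  finally have "ennreal \<bar>(LINT x|lebesgue_on Q. f x) - weighted_sum W (map f xs)\<bar>
     = ennreal (norm (LINT x|lebesgue. (\<Sum>k\<in>?I. indicator (W k) x * (dg.f0 x - f (xs ! k)))))" by simp
  also have "\<dots> \<le> (\<integral>\<^sup>+x. ennreal (norm (\<Sum>k\<in>?I. indicator (W k) x * (dg.f0 x - f (xs ! k)))) \<partial>lebesgue)"
    using i1 i2 by (intro integral_norm_bound_ennreal Bochner_Integration.integrable_sum) (auto simp: right_diff_distrib)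
  also have "\<dots> \<le> (\<integral>\<^sup>+x. (\<Sum>k\<in>?I. ennreal \<bar>dg.f0 x - f (xs ! k)\<bar> * indicator (W k) x) \<partial>lebesgue)"
  proof (rule nn_integral_mono)
    fix x
    have "ennreal (norm (\<Sum>k\<in>?I. indicator (W k) x * (dg.f0 x - f (xs ! k)))) \<le> ennreal (\<Sum>k\<in>?I. indicator (W k) x * \<bar>dg.f0 x - f (xs ! k)\<bar>)"
      by (intro ennreal_leI sum_norm_le) (simp add: abs_mult)
    also have "\<dots> = (\<Sum>k\<in>?I. ennreal \<bar>dg.f0 x - f (xs ! k)\<bar> * indicator (W k) x)"
      by (subst sum_ennreal[symmetric]) (auto simp: indicator_def intro!: sum.cong)
    finally show "ennreal (norm (\<Sum>k\<in>?I. indicator (W k) x * (dg.f0 x - f (xs ! k)))) \<le> (\<Sum>k\<in>?I. ennreal \<bar>dg.f0 x - f (xs ! k)\<bar> * indicator (W k) x)" .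
  qed
  also have "\<dots> = (\<Sum>k\<in>?I. \<integral>\<^sup>+x\<in>W k. ennreal \<bar>dg.f0 x - f (xs ! k)\<bar> \<partial>lebesgue)"
    using WL by (intro nn_integral_sum) measurable
  also have "\<dots> = (\<Sum>k\<in>?I. \<integral>\<^sup>+x\<in>W k. ennreal \<bar>f x - f (xs ! k)\<bar> \<partial>lebesgue)"
    using W_props(2) by (intro sum.cong refl nn_integral_cong) (auto simp: dg.f0_def indicator_def)
  also have "\<dots> = (\<Sum>k\<in>regular. \<integral>\<^sup>+x\<in>W k. ennreal \<bar>f x - f (xs ! k)\<bar> \<partial>lebesgue)
      + (\<Sum>k\<in>irregular. \<integral>\<^sup>+x\<in>W k. ennreal \<bar>f x - f (xs ! k)\<bar> \<partial>lebesgue)"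
    unfolding regular_irregular(1) by (rule sum.union_disjoint) (auto simp: regular_irregular)
  finally show ?thesis .
qed

end

subsection \<open>From the Sobolev class to Young pairs\<close>

lemma integrable_const_bounded:
  assumes "open (Q :: (real^'d) set)" "bounded Q"
  shows "integrable (lebesgue_on Q) (\<lambda>_. c :: real)"
proof -
  have "emeasure (lebesgue_on Q) (space (lebesgue_on Q)) < \<infinity>"
    using assms(1) emeasure_bounded_finite[OF assms(2)] by (simp add: emeasure_restrict_space space_restrict_space)
  then show ?thesis by (simp add: finite_measure.integrable_const finite_measureI less_top)
qed

lemma Lp_integrable:
  assumes Q: "open (Q :: (real^'d) set)" "bounded Q" and p: "1 \<le> p" and g: "g \<in> Lp_space p Q"
  shows "integrable (lebesgue_on Q) g"
proof -
  have meas: "g \<in> borel_measurable (lebesgue_on Q)" using g by (simp add: Lp_space_def)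
  note const = integrable_const_bounded[OF Q]
  show ?thesis
  proof (cases "p = \<infinity>")
    case True
    then have "esssup (lebesgue_on Q) (\<lambda>x. ereal \<bar>g x\<bar>) < \<infinity>" using g by (simp add: Lp_space_def)
    then obtain C :: real where C: "esssup (lebesgue_on Q) (\<lambda>x. ereal \<bar>g x\<bar>) \<le> ereal C"
      by (cases "esssup (lebesgue_on Q) (\<lambda>x. ereal \<bar>g x\<bar>)") auto
    have "AE x in lebesgue_on Q. norm (g x) \<le> norm (max C 0)"
      using esssup_AE[of "\<lambda>x. ereal \<bar>g x\<bar>" "lebesgue_on Q"]
    proof eventually_elim
      case (elim x)
      then have "ereal \<bar>g x\<bar> \<le> ereal C" using C by (rule order_trans)
      then show ?case by simp
    qed
    then show ?thesis by (rule Bochner_Integration.integrable_bound[OF const meas])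
  next
    case False
    then obtain P where P: "p = ereal P" "1 \<le> P" using p by (cases p) auto
    have int: "integrable (lebesgue_on Q) (\<lambda>x. \<bar>g x\<bar> powr P)" using g P by (simp add: Lp_space_def)
    have "norm (g x) \<le> norm (1 + \<bar>g x\<bar> powr P)" for x
    proof (cases "\<bar>g x\<bar> \<le> 1")
      case False
      then have "\<bar>g x\<bar> powr 1 \<le> \<bar>g x\<bar> powr P" using P by (intro powr_mono) auto
      then show ?thesis using False by simp
    qed (auto intro: add_increasing2)
    then show ?thesis
      by (intro Bochner_Integration.integrable_bound[OF Bochner_Integration.integrable_add[OF const[of 1] int] meas]) auto
  qed
qed

text \<open>A crude constant suffices: the inequality only serves to show that the l1 norm of the
  gradient is P-integrable if its components are.\<close>

lemma powr_sum_le: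
  fixes x :: "'d::finite \<Rightarrow> real"
  assumes "0 < P"
  shows "(\<Sum>i\<in>UNIV. \<bar>x i\<bar>) powr P \<le> real CARD('d) powr P * (\<Sum>i\<in>UNIV. \<bar>x i\<bar> powr P)"
proof -
  have "Max (range (\<lambda>i. \<bar>x i\<bar>)) \<in> range (\<lambda>i. \<bar>x i\<bar>)" by (rule Max_in) auto
  then obtain j where j: "Max (range (\<lambda>i. \<bar>x i\<bar>)) = \<bar>x j\<bar>" by (metis imageE)
  have le: "\<bar>x i\<bar> \<le> \<bar>x j\<bar>" for i unfolding j[symmetric] by (rule Max_ge) auto
  have "(\<Sum>i\<in>UNIV. \<bar>x i\<bar>) \<le> real CARD('d) * \<bar>x j\<bar>"
    using sum_bounded_above[of UNIV "\<lambda>i. \<bar>x i\<bar>" "\<bar>x j\<bar>"] le by simp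
  then have "(\<Sum>i\<in>UNIV. \<bar>x i\<bar>) powr P \<le> (real CARD('d) * \<bar>x j\<bar>) powr P"
    using assms by (intro powr_mono2) (auto simp: sum_nonneg)
  also have "\<dots> = real CARD('d) powr P * \<bar>x j\<bar> powr P" by (rule powr_mult)
  also have "\<dots> \<le> real CARD('d) powr P * (\<Sum>i\<in>UNIV. \<bar>x i\<bar> powr P)"
    by (intro mult_left_mono member_le_sum) auto
  finally show ?thesis .
qed

lemma young_scaled:
  fixes t P q a b :: real
  assumes P: "1 < P" "1 < q" "1 / P + 1 / q = 1" and t: "0 < t" and a: "0 \<le> a" and b: "0 \<le> b"
  shows "a * b \<le> t powr q / q * a powr q + t powr (- P) / P * b powr P"
proof -
  have "(t * a) * (b / t) \<le> (t * a) powr q / q + (b / t) powr P / P"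
    using assms by (intro Youngs_inequality) auto
  also have "(t * a) powr q = t powr q * a powr q" by (rule powr_mult)
  also have "(b / t) powr P = t powr (- P) * b powr P" using t b by (simp add: powr_divide powr_minus field_simps)
  finally show ?thesis using t by simp
qed

text \<open>t minimises the left-hand side: a vanishing derivative means t^(P+q) = 1 / X. The
  minimum is the value given by Hoelder's inequality, so nothing is lost by passing through Young's
  inequality.\<close>

lemma young_optimal:
  fixes X P q :: real
  assumes P: "1 < P" "1 < q" "1 / P + 1 / q = 1" and X: "0 < X"
  defines "t \<equiv> X powr (- 1 / (P + q))"
  shows "0 < t" "t powr q / q * X + t powr (- P) / P = X powr (1 / q)"
proof -
  have pq: "P + q = P * q" using P by (simp add: field_simps)
  show "0 < t" using X by (simp add: t_def)
  have "t powr q * X = X powr (- q / (P + q)) * X powr 1" using X by (simp add: t_def powr_powr)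
  also have "\<dots> = X powr (- q / (P + q) + 1)" by (rule powr_add[symmetric])
  also have "- q / (P + q) + 1 = 1 / q" using P unfolding pq by (simp add: field_simps pq)
  finally have 1: "t powr q * X = X powr (1 / q)" .
  have "t powr (- P) = X powr (P / (P + q))" by (simp add: t_def powr_powr)
  also have "P / (P + q) = 1 / q" using P unfolding pq by simp
  finally have 2: "t powr (- P) = X powr (1 / q)" .
  have "t powr q / q * X + t powr (- P) / P = X powr (1 / q) * (1 / P + 1 / q)"
    unfolding 2 using 1 by (simp add: algebra_simps)
  then show "t powr q / q * X + t powr (- P) / P = X powr (1 / q)" using P by simp
qed

lemma conjugate_cases:
  fixes p :: ereal and p' d :: real
  assumes "1 \<le> d" "ereal d < p" "1 / p + 1 / ereal p' = 1"
  obtains "p = \<infinity>" "p' = 1" | P where "p = ereal P" "d < P" "1 < p'" "1 / P + 1 / p' = 1"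
proof (cases p)
  case PInf
  then show ?thesis using assms that(1) by (cases "p' = 0") (auto simp: zero_ereal_def one_ereal_def divide_ereal_def)
next
  case (real P)
  then have P: "d < P" using assms by simp
  have "p' \<noteq> 0" using assms real P by (auto simp: one_ereal_def)
  then have eq: "1 / P + 1 / p' = 1" using assms real P by (auto simp: one_ereal_def)
  have "1 / P < 1" "0 < 1 / P" using P assms(1) by auto
  then have "0 < 1 / p'" "1 / p' < 1" using eq by linarith+
  then have "1 < p'" by (simp add: divide_less_eq_1 split: if_splits)
  then show ?thesis using that(2) real P eq by blast
qed (use assms in auto)

text \<open>Only \<Gamma>, \<alpha> and \<beta> enter the estimates, so the gradient and its bound
  are hidden under the quantifier.\<close>

definition young_pair :: "(real^'d) set \<Rightarrow> (real^'d \<Rightarrow> real) \<Rightarrow> (real^'d \<Rightarrow> real) \<Rightarrow> real \<Rightarrow> real \<Rightarrow> real \<Rightarrow> bool" where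
  "young_pair Q f \<Gamma> q \<alpha> \<beta> \<longleftrightarrow> 0 \<le> \<alpha> \<and> 0 \<le> \<beta> \<and> (\<exists>G g. dominated_gradient Q f G g \<Gamma> \<alpha> \<beta> q)"

text \<open>\<Gamma> is fixed before X, because pairs are needed for two values of X with the same
  f. For finite p it is the p-th power of a bound of the gradient, and the pair comes from the
  optimal scaling. For p = \<infinity> the conjugate exponent is 1, and \<Gamma> = 0, \<alpha> = 1,
  \<beta> = 0 serve for every X.\<close>

lemma sobolev_young:
  fixes Q :: "(real^'d) set"
  assumes Q: "open Q" "bounded Q" and d: "1 \<le> real CARD('d)" and p: "ereal (real CARD('d)) < p" "1 / p + 1 / ereal p' = 1"
    and f: "f \<in> sobolev_class p Q"
  obtains \<Gamma> where "(\<integral>\<^sup>+x\<in>Q. ennreal (\<Gamma> x) \<partial>lborel) \<le> 1"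
    "\<And>X. 0 < X \<Longrightarrow> \<exists>\<alpha> \<beta>. young_pair Q f \<Gamma> p' \<alpha> \<beta> \<and> \<alpha> * X + \<beta> = X powr (1 / p')"
proof -
  obtain G where G: "sobolev_gradient p Q f G" "Lp_norm p Q (\<lambda>x. \<Sum>i\<in>UNIV. \<bar>G x $ i\<bar>) \<le> 1"
    and fL: "f \<in> Lp_space p Q" and fc: "continuous_on Q f"
    using f by (auto simp: sobolev_class_def sobolev_space_def)
  have GL: "(\<lambda>x. G x $ i) \<in> Lp_space p Q" and weak: "weak_partial Q i f (\<lambda>x. G x $ i)" for i
    using G by (auto simp: sobolev_gradient_def)
  have p1: "1 \<le> p"
  proof -
    have "ereal 1 \<le> ereal (real CARD('d))" using d by simp
    then show ?thesis using p by (metis less_imp_le one_ereal_def order_trans)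
  qed
  have fint: "integrable (lebesgue_on Q) f" by (rule Lp_integrable[OF Q p1 fL])
  have Gint: "integrable (lebesgue_on Q) (\<lambda>x. G x $ i)" for i by (rule Lp_integrable[OF Q p1 GL])
  let ?s = "\<lambda>x. \<Sum>i\<in>UNIV. \<bar>G x $ i\<bar>"
  have Gm [measurable]: "(\<lambda>x. G x $ i) \<in> borel_measurable (lebesgue_on Q)" for i
    using GL by (simp add: Lp_space_def)
  have sm [measurable]: "?s \<in> borel_measurable (lebesgue_on Q)" by measurable
  have QL: "Q \<inter> space lebesgue \<in> sets lebesgue" using Q by simp
  show ?thesis
  proof (rule conjugate_cases[OF d p])
    assume pinf: "p = \<infinity>" and p'1: "p' = 1"
    let ?E = "esssup (lebesgue_on Q) (\<lambda>x. ereal \<bar>?s x\<bar>)"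
    have "?E < \<infinity>"
    proof -
      have "\<exists>C::real. esssup (lebesgue_on Q) (\<lambda>x. ereal \<bar>G x $ i\<bar>) \<le> ereal C" for i
        using GL[of i] pinf unfolding Lp_space_def
        by (cases "esssup (lebesgue_on Q) (\<lambda>x. ereal \<bar>G x $ i\<bar>)") auto
      then obtain C where C: "\<And>i. esssup (lebesgue_on Q) (\<lambda>x. ereal \<bar>G x $ i\<bar>) \<le> ereal (C i)" by metis
      have "AE x in lebesgue_on Q. \<forall>i. \<bar>G x $ i\<bar> \<le> C i"
      proof (rule AE_finite_allI[of UNIV, simplified])
        fix i
        show "AE x in lebesgue_on Q. \<bar>G x $ i\<bar> \<le> C i"
          using esssup_AE[of "\<lambda>x. ereal \<bar>G x $ i\<bar>" "lebesgue_on Q"]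
          by eventually_elim (use C[of i] order_trans in fastforce)
      qed simp
      then have "?E \<le> ereal (sum C UNIV)"
        by (intro esssup_I) (auto elim!: eventually_mono simp: sum_nonneg intro!: sum_mono)
      then show ?thesis by auto
    qed
    then have E1: "?E \<le> 1" using G(2) pinf unfolding Lp_norm_def
      by (cases ?E) (auto simp: one_ereal_def)
    have bound: "AE x in lebesgue_on Q. ?s x \<le> 1"
      using esssup_AE[of "\<lambda>x. ereal \<bar>?s x\<bar>" "lebesgue_on Q"]
    proof eventually_elim
      case (elim x)
      then have "ereal \<bar>?s x\<bar> \<le> ereal 1" using E1 unfolding one_ereal_def by (rule order_trans)
      then show ?case by simp
    qed
    have dg: "dominated_gradient Q f (\<lambda>i x. G x $ i) (\<lambda>_. 1) (\<lambda>_. 0) 1 0 p'"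
      by unfold_locales (use Q fc fint Gint weak bound p'1 in auto)
    show ?thesis
    proof (rule that[of "\<lambda>_. 0"])
      fix X :: real assume "0 < X"
      then show "\<exists>\<alpha> \<beta>. young_pair Q f (\<lambda>_. 0) p' \<alpha> \<beta> \<and> \<alpha> * X + \<beta> = X powr (1 / p')"
        using dg p'1 by (intro exI[of _ 1] exI[of _ 0]) (auto simp: young_pair_def)
    qed simp
  next
    fix P assume P: "p = ereal P" "real CARD('d) < P" "1 < p'" "1 / P + 1 / p' = 1"
    have P1: "1 < P" using P d by linarith
    \<comment> \<open>The gradient is only Lebesgue measurable, whereas
      \<open>dominated_gradient\<close> wants a Borel bound; so its l1 norm is replaced by a Borel
      function that agrees with it almost everywhere.\<close>
    have "(\<lambda>x. indicator Q x *\<^sub>R ?s x) \<in> borel_measurable lebesgue"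
      using sm by (subst (asm) borel_measurable_restrict_space_iff[OF QL]) simp
    then obtain g' where g'[measurable]: "g' \<in> borel_measurable lborel" and g'eq: "AE x in lborel. indicator Q x *\<^sub>R ?s x = g' x"
      using completion_ex_borel_measurable_real by blast
    define g where "g x = \<bar>g' x\<bar>" for x
    have [measurable]: "g \<in> borel_measurable borel" using g' unfolding g_def by simp
    have geq: "AE x in lebesgue. indicator Q x *\<^sub>R ?s x = g' x" using g'eq by (rule AE_completion)
    have geQ: "AE x in lebesgue_on Q. ?s x = g x"
      unfolding AE_restrict_space_iff[OF QL] using geq
    proof eventually_elim
      case (elim x)
      show ?case
      proof
        assume "x \<in> Q"
        then have "?s x = g' x" using elim by simp
        moreover have "0 \<le> ?s x" by (simp add: sum_nonneg)
        ultimately show "?s x = g x" by (simp add: g_def)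
      qed
    qed
    have int: "integrable (lebesgue_on Q) (\<lambda>x. \<bar>?s x\<bar> powr P)"
    proof (rule Bochner_Integration.integrable_bound)
      show "integrable (lebesgue_on Q) (\<lambda>x. real CARD('d) powr P * (\<Sum>i\<in>UNIV. \<bar>G x $ i\<bar> powr P))"
        using GL P by (intro integrable_mult_right Bochner_Integration.integrable_sum) (simp add: Lp_space_def)
      show "AE x in lebesgue_on Q. norm (\<bar>?s x\<bar> powr P) \<le> norm (real CARD('d) powr P * (\<Sum>i\<in>UNIV. \<bar>G x $ i\<bar> powr P))"
        using powr_sum_le[of P "\<lambda>i. G _ $ i"] P1 by (auto simp: sum_nonneg)
    qed measurable
    have "(LINT x|lebesgue_on Q. \<bar>?s x\<bar> powr P) powr (1 / P) \<le> 1"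
      using G(2) P by (simp add: Lp_norm_def)
    then have I1: "(LINT x|lebesgue_on Q. \<bar>?s x\<bar> powr P) \<le> 1"
      using P1 by (smt (verit) divide_pos_pos gr_one_powr)
    have "(\<integral>\<^sup>+x\<in>Q. ennreal (g x powr P) \<partial>lborel) = (\<integral>\<^sup>+x\<in>Q. ennreal (g x powr P) \<partial>lebesgue)"
      by (rule nn_integral_completion[symmetric])
    also have "\<dots> = (\<integral>\<^sup>+x. ennreal (g x powr P) \<partial>lebesgue_on Q)"
      by (rule nn_integral_restrict_space[OF QL, symmetric])
    also have "\<dots> = (\<integral>\<^sup>+x. ennreal (\<bar>?s x\<bar> powr P) \<partial>lebesgue_on Q)"
      using geQ by (intro nn_integral_cong_AE) (auto elim!: eventually_mono simp: g_def)
    also have "\<dots> = ennreal (LINT x|lebesgue_on Q. \<bar>?s x\<bar> powr P)"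
      by (rule nn_integral_eq_integral[OF int]) auto
    also have "\<dots> \<le> 1" using I1 by (simp add: ennreal_le_1)
    finally have \<Gamma>1: "(\<integral>\<^sup>+x\<in>Q. ennreal (g x powr P) \<partial>lborel) \<le> 1" .
    have dg: "dominated_gradient Q f (\<lambda>i x. G x $ i) g (\<lambda>x. g x powr P) (t powr p' / p') (t powr (- P) / P) p'" if "0 < t" for t
    proof unfold_locales
      show "(\<integral>\<^sup>+x\<in>Q. ennreal (g x powr P) \<partial>lborel) < \<infinity>" using \<Gamma>1 by (rule order_le_less_trans) simp
      show "AE x in lebesgue_on Q. (\<Sum>i\<in>UNIV. \<bar>G x $ i\<bar>) \<le> g x" using geQ by eventually_elim simp
      fix x and a :: real assume "0 \<le> a"
      then show "a * g x \<le> t powr p' / p' * a powr p' + t powr (- P) / P * g x powr P"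
        using P P1 that by (intro young_scaled) (auto simp: g_def)
    qed (use Q fc fint Gint weak P P1 in \<open>auto simp: g_def\<close>)
    show ?thesis
    proof (rule that[OF \<Gamma>1])
      fix X :: real assume X: "0 < X"
      let ?t = "X powr (- 1 / (P + p'))"
      note yo = young_optimal[OF P1 P(3,4) X]
      have "young_pair Q f (\<lambda>x. g x powr P) p' (?t powr p' / p') (?t powr (- P) / P)"
        unfolding young_pair_def using dg[OF yo(1)] P1 P(3) by (intro conjI exI) auto
      then show "\<exists>\<alpha> \<beta>. young_pair Q f (\<lambda>x. g x powr P) p' \<alpha> \<beta> \<and> \<alpha> * X + \<beta> = X powr (1 / p')"
        using yo(2) by blast
    qed
  qed
qed

text \<open>The L_q norm of the kernel taken over n disjoint cubes of radius h together, which is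
  Hoelder's bound against a gradient of norm 1.\<close>

definition sharp_bound :: "(real^'d) set \<Rightarrow> real \<Rightarrow> nat \<Rightarrow> real" where
  "sharp_bound Q q n = (real n * (half_step Q n powr (q + real CARD('d)) * kmass TYPE('d) q)) powr (1 / q)"

text \<open>The pair \<open>ab1\<close> is optimal for n cubes and yields the sharp bound on the
  regular nodes. The pair \<open>ab2\<close> is optimal for \<open>\<theta> * ?X\<close>, so that
  both of its terms are at most \<theta>^(1/q) times the sharp bound; this makes even the \<Gamma>
  term small, although it is only estimated by the whole integral of \<Gamma>.\<close>

lemma (in quadrature) quadrature_bound:
  assumes d: "2 \<le> CARD('d)" and q: "1 \<le> q" "(real CARD('d) - 1) * q < real CARD('d)"
    and r: "0 < r" "\<And>x y s. x \<in> Q \<Longrightarrow> y \<in> icube c r \<Longrightarrow> 0 \<le> s \<Longrightarrow> s \<le> 1 \<Longrightarrow> x + s *\<^sub>R (y - x) \<in> Q"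
    and D: "0 < D" "\<And>x. x \<in> Q \<Longrightarrow> infnorm (x - c) \<le> D" and hr: "12 * h \<le> r"
    and \<theta>: "0 < \<theta>" "real (card (bad_cubes Q h)) \<le> \<theta> * real n"
    and \<Gamma>1: "(\<integral>\<^sup>+x\<in>Q. ennreal (\<Gamma> x) \<partial>lborel) \<le> 1"
    and Y: "\<And>X. 0 < X \<Longrightarrow> \<exists>\<alpha> \<beta>. young_pair Q f \<Gamma> q \<alpha> \<beta> \<and> \<alpha> * X + \<beta> = X powr (1 / q)"
  defines "C \<equiv> 4 * (12 * (r + D) / r) powr (q + real CARD('d)) + 2 * (4 * (r + D) / r + 4) ^ CARD('d)"
  shows "\<bar>(LINT x|lebesgue_on Q. f x) - weighted_sum W (map f xs)\<bar> \<le> (1 + C * \<theta> powr (1 / q)) * sharp_bound Q q n"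
proof -
  let ?A = "kmass TYPE('d) q" and ?e = "q + real CARD('d)"
  let ?\<kappa> = "12 * (r + D) / r" and ?M = "(4 * (r + D) / r + 4) ^ CARD('d)"
  let ?X = "real n * (h powr ?e * ?A)"
  have A: "0 < ?A" by (rule kmass_pos[OF d q])
  have X: "0 < ?X" using n h A by simp
  have \<kappa>: "0 < ?\<kappa>" "0 \<le> ?M" using r D by auto
  have SB: "sharp_bound Q q n = ?X powr (1 / q)" by (simp add: sharp_bound_def h_def)
  obtain \<alpha>1 \<beta>1 G1 g1 where ab1: "dominated_gradient Q f G1 g1 \<Gamma> \<alpha>1 \<beta>1 q" "0 \<le> \<alpha>1" "0 \<le> \<beta>1"
    "\<alpha>1 * ?X + \<beta>1 = sharp_bound Q q n"
    using Y[OF X] unfolding SB young_pair_def by blast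
  obtain \<alpha>2 \<beta>2 G2 g2 where ab2: "dominated_gradient Q f G2 g2 \<Gamma> \<alpha>2 \<beta>2 q" "0 \<le> \<alpha>2" "0 \<le> \<beta>2"
    "\<alpha>2 * (\<theta> * ?X) + \<beta>2 = \<theta> powr (1 / q) * sharp_bound Q q n"
  proof -
    have "(\<theta> * ?X) powr (1 / q) = \<theta> powr (1 / q) * sharp_bound Q q n" unfolding SB by (rule powr_mult)
    then show ?thesis using Y[of "\<theta> * ?X"] X \<theta>(1) that unfolding young_pair_def by fastforce
  qed
  have K: "(\<integral>\<^sup>+y\<in>icube (0::real^'d) R. ennreal (kern R y powr q) \<partial>lborel) = ennreal (R powr ?e * ?A)" if "0 < R" for R
    using nn_integral_kern[OF d q that, of 0] by simp
  have reg: "(\<Sum>k\<in>regular. \<integral>\<^sup>+x\<in>W k. ennreal \<bar>f x - f (xs ! k)\<bar> \<partial>lebesgue) \<le> ennreal (\<alpha>1 * ?X + \<beta>1)"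
  proof -
    have "(\<Sum>k\<in>regular. \<integral>\<^sup>+x\<in>W k. ennreal \<bar>f x - f (xs ! k)\<bar> \<partial>lebesgue)
       \<le> ennreal \<alpha>1 * (of_nat n * ennreal (h powr ?e * ?A)) + ennreal \<beta>1 * (\<integral>\<^sup>+y\<in>Q. ennreal (\<Gamma> y) \<partial>lborel)"
      using regular_error[OF ab1(1)] by (simp add: K[OF h])
    also have "\<dots> \<le> ennreal \<alpha>1 * (of_nat n * ennreal (h powr ?e * ?A)) + ennreal \<beta>1 * 1"
      by (intro add_left_mono mult_left_mono \<Gamma>1) auto
    also have "\<dots> = ennreal (\<alpha>1 * ?X + \<beta>1)"
      using ab1(2,3) A by (simp add: ennreal_mult ennreal_of_nat_eq_real_of_nat)
    finally show ?thesis .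
  qed
  let ?b = "real (card (bad_cubes Q h))"
  have irr: "(\<Sum>k\<in>irregular. \<integral>\<^sup>+x\<in>W k. ennreal \<bar>f x - f (xs ! k)\<bar> \<partial>lebesgue)
     \<le> ennreal (2 * (\<alpha>2 * (2 * ?b * ((?\<kappa> * h) powr ?e * ?A)) + \<beta>2 * ?M))"
  proof -
    have Kp: "0 < ?\<kappa> * h" by (rule mult_pos_pos[OF \<kappa>(1) h])
    have "(\<Sum>k\<in>irregular. \<integral>\<^sup>+x\<in>W k. ennreal \<bar>f x - f (xs ! k)\<bar> \<partial>lebesgue)
     \<le> 2 * (ennreal \<alpha>2 * (of_nat (2 * card (bad_cubes Q h)) * ennreal ((?\<kappa> * h) powr ?e * ?A))
       + ennreal \<beta>2 * (ennreal ?M * (\<integral>\<^sup>+y\<in>Q. ennreal (\<Gamma> y) \<partial>lborel)))"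
      using irregular_error[OF ab2(1) r D hr] unfolding K[OF Kp] .
    also have "\<dots> \<le> 2 * (ennreal \<alpha>2 * (of_nat (2 * card (bad_cubes Q h)) * ennreal ((?\<kappa> * h) powr ?e * ?A))
       + ennreal \<beta>2 * (ennreal ?M * 1))"
      by (intro mult_left_mono add_left_mono \<Gamma>1) auto
    also have "\<dots> = ennreal 2 * (ennreal \<alpha>2 * (ennreal (2 * ?b) * ennreal ((?\<kappa> * h) powr ?e * ?A))
       + ennreal \<beta>2 * ennreal ?M)"
      by (simp add: ennreal_of_nat_eq_real_of_nat[symmetric] ennreal_mult)
    also have "\<dots> = ennreal (2 * (\<alpha>2 * (2 * ?b * ((?\<kappa> * h) powr ?e * ?A)) + \<beta>2 * ?M))"
      using ab2 A \<kappa> by (simp only: ennreal_mult[symmetric] ennreal_plus[symmetric] mult_nonneg_nonneg add_nonneg_nonneg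
          powr_ge_zero less_imp_le of_nat_0_le_iff zero_le_numeral)
    finally show ?thesis .
  qed
  \<comment> \<open>In C the factor 4 is 2 from the two uses of \<open>star_poincare\<close> in
    \<open>oscillation\<close> times 2 from \<open>card_exceptional\<close>; the second summand
    comes from the overlap of the enlarged cubes.\<close>
  have "2 * (\<alpha>2 * (2 * ?b * ((?\<kappa> * h) powr ?e * ?A)) + \<beta>2 * ?M) \<le> C * (\<alpha>2 * (\<theta> * ?X) + \<beta>2)"
  proof -
    have "(?\<kappa> * h) powr ?e = ?\<kappa> powr ?e * h powr ?e" by (rule powr_mult)
    then have "2 * (\<alpha>2 * (2 * ?b * ((?\<kappa> * h) powr ?e * ?A))) = 4 * ?\<kappa> powr ?e * (\<alpha>2 * (?b * (h powr ?e * ?A)))" by simp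
    also have "\<dots> \<le> 4 * ?\<kappa> powr ?e * (\<alpha>2 * ((\<theta> * real n) * (h powr ?e * ?A)))"
      using A by (intro mult_left_mono mult_right_mono \<theta> ab2) auto
    also have "\<dots> \<le> C * (\<alpha>2 * ((\<theta> * real n) * (h powr ?e * ?A)))"
      unfolding C_def using \<kappa> ab2 A \<theta> by (intro mult_right_mono) auto
    finally have 1: "2 * (\<alpha>2 * (2 * ?b * ((?\<kappa> * h) powr ?e * ?A))) \<le> C * (\<alpha>2 * (\<theta> * ?X))" by (simp add: mult_ac)
    have "2 * ?M * \<beta>2 \<le> C * \<beta>2" unfolding C_def using ab2 by (intro mult_right_mono) auto
    then show ?thesis using 1 by (simp add: algebra_simps)
  qed
  also have "\<dots> = C * \<theta> powr (1 / q) * sharp_bound Q q n" using ab2(4) by simp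
  finally have fin: "2 * (\<alpha>2 * (2 * ?b * ((?\<kappa> * h) powr ?e * ?A)) + \<beta>2 * ?M) \<le> C * \<theta> powr (1 / q) * sharp_bound Q q n" .
  have nonneg: "0 \<le> \<alpha>1 * ?X + \<beta>1" "0 \<le> 2 * (\<alpha>2 * (2 * ?b * ((?\<kappa> * h) powr ?e * ?A)) + \<beta>2 * ?M)"
    using ab1(2,3) ab2(2,3) A \<kappa> by (intro add_nonneg_nonneg mult_nonneg_nonneg; simp)+
  have "ennreal \<bar>(LINT x|lebesgue_on Q. f x) - weighted_sum W (map f xs)\<bar>
     \<le> ennreal (\<alpha>1 * ?X + \<beta>1) + ennreal (2 * (\<alpha>2 * (2 * ?b * ((?\<kappa> * h) powr ?e * ?A)) + \<beta>2 * ?M))"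
    using weighted_error[OF ab1(1)] add_mono[OF reg irr] by (rule order_trans)
  also have "\<dots> = ennreal (\<alpha>1 * ?X + \<beta>1 + 2 * (\<alpha>2 * (2 * ?b * ((?\<kappa> * h) powr ?e * ?A)) + \<beta>2 * ?M))"
    using nonneg by (simp only: ennreal_plus)
  finally have "\<bar>(LINT x|lebesgue_on Q. f x) - weighted_sum W (map f xs)\<bar>
     \<le> \<alpha>1 * ?X + \<beta>1 + 2 * (\<alpha>2 * (2 * ?b * ((?\<kappa> * h) powr ?e * ?A)) + \<beta>2 * ?M)"
    by (subst (asm) ennreal_le_iff) (use nonneg in linarith)
  also have "\<dots> \<le> sharp_bound Q q n + C * \<theta> powr (1 / q) * sharp_bound Q q n"
    unfolding ab1(4)[symmetric] using fin unfolding ab1(4)[symmetric] by (rule add_left_mono)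
  finally show ?thesis by (simp add: algebra_simps)
qed

section \<open>Asymptotic upper bound\<close>

lemma node_setI:
  assumes "star_domain Q" "0 < n" "2 * card (bad_cubes Q (half_step Q n)) \<le> n" "is_S Q n S"
  shows "node_set Q n S (half_step Q n)"
proof unfold_locales
  note m = star_domain_measure_pos[OF assms(1)]
  show "open Q" "bounded Q" using assms by (auto simp: star_domain_def)
  show "0 < half_step Q n" by (rule half_step_pos[OF m assms(2)])
  show "real n * (2 * half_step Q n) ^ CARD('a) = measure lebesgue Q" by (rule half_step_volume[OF m assms(2)])
qed (use assms in auto)

lemma eventually_few_bad:
  assumes "star_domain Q"
  shows "\<forall>\<^sub>F n in sequentially. 2 * card (bad_cubes Q (half_step Q n)) \<le> n"
proof -
  have "\<forall>\<^sub>F n in sequentially. real (card (bad_cubes Q (half_step Q n))) \<le> 1 / 2 * real n"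
    by (rule card_bad_cubes[OF assms]) simp
  then show ?thesis by eventually_elim linarith
qed

lemma recovery_upper:
  fixes Q :: "(real^'d) set"
  assumes d: "2 \<le> CARD('d)" and q: "1 \<le> q" "(real CARD('d) - 1) * q < real CARD('d)"
    and p: "ereal (real CARD('d)) < p" "1 / p + 1 / ereal q = 1" and Q: "star_domain Q" and \<delta>: "0 < \<delta>"
  shows "\<forall>\<^sub>F n in sequentially. \<forall>xs W. distinct xs \<and> is_S Q n (set xs) \<and> completed_voronoi Q n xs W \<longrightarrow>
     recovery_error Q (sobolev_class p Q) (weighted_sum W) xs \<le> ereal ((1 + \<delta>) * sharp_bound Q q n)"
proof -
  have op: "open Q" "bounded Q" using Q by (auto simp: star_domain_def)
  obtain c r D where r: "0 < r" "\<And>x y s. x \<in> Q \<Longrightarrow> y \<in> icube c r \<Longrightarrow> 0 \<le> s \<Longrightarrow> s \<le> 1 \<Longrightarrow> x + s *\<^sub>R (y - x) \<in> Q"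
    and D: "0 < D" "\<And>x. x \<in> Q \<Longrightarrow> infnorm (x - c) \<le> D"
    using star_domainE[OF Q] by metis
  define C where "C = 4 * (12 * (r + D) / r) powr (q + real CARD('d)) + 2 * (4 * (r + D) / r + 4) ^ CARD('d)"
  have "0 < 4 * (r + D) / r + 4" using r D by (intro add_pos_pos divide_pos_pos mult_pos_pos) auto
  from zero_less_power[OF this, of "CARD('d)"] have C: "0 < C"
    unfolding C_def by (intro add_nonneg_pos mult_nonneg_nonneg powr_ge_zero) simp_all
  \<comment> \<open>The solution of C \<theta>^(1/q) = \<delta>.\<close>
  define \<theta> where "\<theta> = (\<delta> / C) powr q"
  have \<theta>: "0 < \<theta>" using \<delta> C by (simp add: \<theta>_def)
  have C\<theta>: "C * \<theta> powr (1 / q) = \<delta>" using \<delta> C q by (simp add: \<theta>_def powr_powr)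
  have "\<forall>\<^sub>F n in sequentially. half_step Q n < r / 12"
    by (rule order_tendstoD(2)[OF half_step_tendsto_0]) (use r in simp)
  then show ?thesis
    using card_bad_cubes[OF Q \<theta>] eventually_few_bad[OF Q] eventually_gt_at_top[of 0]
  proof eventually_elim
    case (elim n)
    show ?case
    proof (intro allI impI)
      fix xs W assume *: "distinct xs \<and> is_S Q n (set xs) \<and> completed_voronoi Q n xs W"
      interpret node_set Q n "set xs" "half_step Q n"
        by (rule node_setI) (use Q elim * in auto)
      interpret quadrature Q n "set xs" "half_step Q n" xs W
        by unfold_locales (use * in auto)
      show "recovery_error Q (sobolev_class p Q) (weighted_sum W) xs \<le> ereal ((1 + \<delta>) * sharp_bound Q q n)"
        unfolding recovery_error_def
      proof (rule SUP_least)
        fix f assume f: "f \<in> sobolev_class p Q"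
        have d1: "1 \<le> real CARD('d)" using d by linarith
        obtain \<Gamma> where \<Gamma>: "(\<integral>\<^sup>+x\<in>Q. ennreal (\<Gamma> x) \<partial>lborel) \<le> 1"
          "\<And>X. 0 < X \<Longrightarrow> \<exists>\<alpha> \<beta>. young_pair Q f \<Gamma> q \<alpha> \<beta> \<and> \<alpha> * X + \<beta> = X powr (1 / q)"
          using sobolev_young[OF op d1 p f] by blast
        have "12 * half_step Q n \<le> r" using elim by simp
        from quadrature_bound[OF d q r D this \<theta> elim(2) \<Gamma>] show "ereal \<bar>(LINT x|lebesgue_on Q. f x) - weighted_sum W (map f xs)\<bar> \<le> ereal ((1 + \<delta>) * sharp_bound Q q n)"
          by (simp only: ereal_less_eq C_def[symmetric] C\<theta>)
      qed
    qed
  qed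
qed

text \<open>A list with fewer than n nodes is padded with an arbitrary point of Q, and the method
  ignores the additional values.\<close>

lemma optimal_le_recovery:
  assumes "length xs \<le> n" "set xs \<subseteq> Q" "Q \<noteq> {}"
  shows "optimal_error Q X n \<le> recovery_error Q X \<Phi> xs"
proof -
  obtain x where x: "x \<in> Q" using assms by auto
  let ?ys = "xs @ replicate (n - length xs) x"
  let ?\<Psi> = "\<lambda>vs. \<Phi> (take (length xs) vs)"
  have "optimal_error Q X n \<le> recovery_error Q X ?\<Psi> ?ys"
    unfolding optimal_error_def
    by (rule INF_lower2[of ?ys]) (use assms x in \<open>auto intro: INF_lower\<close>)
  also have "recovery_error Q X ?\<Psi> ?ys = recovery_error Q X \<Phi> xs"
    by (simp add: recovery_error_def)
  finally show ?thesis .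
qed

lemma optimal_upper:
  fixes Q :: "(real^'d) set"
  assumes d: "2 \<le> CARD('d)" and q: "1 \<le> q" "(real CARD('d) - 1) * q < real CARD('d)"
    and p: "ereal (real CARD('d)) < p" "1 / p + 1 / ereal q = 1" and Q: "star_domain Q" and \<delta>: "0 < \<delta>"
  shows "\<forall>\<^sub>F n in sequentially. optimal_error Q (sobolev_class p Q) n \<le> ereal ((1 + \<delta>) * sharp_bound Q q n)"
  using recovery_upper[OF assms] eventually_few_bad[OF Q] eventually_gt_at_top[of 0]
proof eventually_elim
  case (elim n)
  have op: "bounded Q" "Q \<noteq> {}" using Q by (auto simp: star_domain_def)
  have "0 < half_step Q n" by (rule half_step_pos[OF star_domain_measure_pos[OF Q] elim(3)])
  then obtain S where S: "is_S Q n S" using is_S_exists op by blast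
  interpret node_set Q n S "half_step Q n" by (rule node_setI[OF Q elim(3,2) S])
  obtain xs where xs: "set xs = S" "distinct xs" using finite_distinct_list[OF S_finite] by blast
  obtain W where W: "completed_voronoi Q n xs W" using completed_voronoi_exists xs by blast
  have "optimal_error Q (sobolev_class p Q) n \<le> recovery_error Q (sobolev_class p Q) (weighted_sum W) xs"
    using S_card S_sub op xs distinct_card[OF xs(2)] by (intro optimal_le_recovery) auto
  then show ?case using elim(1) xs S W by (meson order_trans)
qed

subsection \<open>Profiles of the distance to the nodes\<close>

definition mindist :: "(real^'d) set \<Rightarrow> real^'d \<Rightarrow> real" where
  "mindist P x = Min ((\<lambda>y. infnorm (x - y)) ` P)"

text \<open>A triple (i, s, a) stands for the affine function s (x_i - a); for s = 1, -1 and a = y_i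
  the maximum of these functions is the distance to y. In \<open>pieces\<close> the number y_i is
  recorded instead of y, so nodes with a common coordinate share a piece. Thus distinct triples are
  distinct functions, which agree only on a null set.\<close>

definition piece :: "'d \<times> real \<times> real \<Rightarrow> real^'d \<Rightarrow> real" where
  "piece t x = fst (snd t) * (x $ fst t - snd (snd t))"

definition pieces :: "(real^'d) set \<Rightarrow> ('d \<times> real \<times> real) set" where
  "pieces P = (\<lambda>(i, s, y). (i, s, y $ i)) ` (UNIV \<times> {1, -1} \<times> P)"

text \<open>Off the creases, the distance to \<open>P\<close> locally coincides with a single affine piece.\<close>

definition creases :: "(real^'d) set \<Rightarrow> (real^'d) set" where
  "creases P = (\<Union>t\<in>pieces P. \<Union>t'\<in>pieces P - {t}. {x. piece t x = piece t' x})"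

lemma finite_pieces: "finite P \<Longrightarrow> finite (pieces P)"
  by (simp add: pieces_def)

lemma piece_continuous: "continuous_on A (piece t)"
  unfolding piece_def by (intro continuous_intros)

lemma piece_sign: "t \<in> pieces P \<Longrightarrow> \<bar>fst (snd t)\<bar> = 1"
  by (auto simp: pieces_def)

lemma creases_null: "finite P \<Longrightarrow> creases P \<in> null_sets (lborel :: (real^'d) measure)"
proof -
  assume P: "finite (P :: (real^'d) set)"
  have "{x::real^'d. piece t x = piece t' x} \<in> null_sets lborel"
    if t: "t \<in> pieces P" and t': "t' \<in> pieces P - {t}" for t t'
  proof -
    obtain i s a j s' a' where e: "t = (i, s, a)" "t' = (j, s', a')" by (metis prod_cases3)
    let ?v = "s *\<^sub>R axis i 1 - s' *\<^sub>R axis j (1::real)"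
    have eq: "{x. piece t x = piece t' x} = {x. ?v \<bullet> x = s * a - s' * a'}"
      by (auto simp: e piece_def inner_diff_left inner_axis' algebra_simps)
    have borel: "{x::real^'d. piece t x = piece t' x} \<in> sets borel"
      by (intro borel_closed closed_Collect_eq piece_continuous)
    have "negligible {x. piece t x = piece t' x}"
    \<comment> \<open>If the linear parts differ, the pieces agree on a hyperplane; if they are
      equal, the offsets differ and the pieces agree nowhere.\<close>
    proof (cases "?v = 0")
      case False
      then show ?thesis unfolding eq by (intro negligible_hyperplane) simp
    next
      case True
      have s: "s \<noteq> 0" using piece_sign[OF t] e by auto
      have vi: "?v $ i = 0" using True by simp
      have ij: "i = j" using vi s by (auto simp: axis_def split: if_splits)
      then have "s = s'" using vi by (simp add: axis_def)
      then have "a \<noteq> a'" using t' ij e by auto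
      then have "{x. piece t x = piece t' x} = {}" using ij \<open>s = s'\<close> s by (auto simp: e piece_def)
      then show ?thesis by simp
    qed
    then show ?thesis using borel by (simp add: negligible_iff_null_sets null_sets_completion_iff)
  qed
  then show ?thesis unfolding creases_def
    by (intro null_sets_UN' countable_finite finite_Diff finite_pieces P) auto
qed

context
  fixes P :: "(real^'d) set"
  assumes P: "finite P" "P \<noteq> {}"
begin

lemma mindist_le: "y \<in> P \<Longrightarrow> mindist P x \<le> infnorm (x - y)"
  unfolding mindist_def using P by (intro Min_le) auto

lemma mindist_attained: obtains y where "y \<in> P" "mindist P x = infnorm (x - y)"
proof -
  have "mindist P x \<in> (\<lambda>y. infnorm (x - y)) ` P" unfolding mindist_def using P by (intro Min_in) auto
  then show ?thesis using that by blast
qed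

lemma mindist_nonneg: "0 \<le> mindist P x"
  by (metis mindist_attained infnorm_pos_le)

lemma mindist_point: "y \<in> P \<Longrightarrow> mindist P y = 0"
  using mindist_le[of y y] mindist_nonneg[of y] by (simp add: infnorm_0)

lemma mindist_lipschitz: "\<bar>mindist P x - mindist P z\<bar> \<le> infnorm (x - z)"
proof -
  have "mindist P x \<le> mindist P z + infnorm (x - z)" for x z
  proof -
    obtain y where y: "y \<in> P" "mindist P z = infnorm (z - y)" by (rule mindist_attained)
    then show ?thesis using mindist_le[OF y(1), of x] infnorm_triangle_diff[of x y z] by linarith
  qed
  from this[of x z] this[of z x] show ?thesis by (simp add: infnorm_sub abs_le_iff)
qed

lemma mindist_continuous: "continuous_on A (mindist P)"
  unfolding continuous_on_iff
proof (intro ballI allI impI)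
  fix x e assume "0 < (e::real)"
  show "\<exists>d>0. \<forall>x'\<in>A. dist x' x < d \<longrightarrow> dist (mindist P x') (mindist P x) < e"
  proof (intro exI[of _ e] conjI ballI impI)
    fix x' assume "dist x' x < e"
    then show "dist (mindist P x') (mindist P x) < e"
      using mindist_lipschitz[of x' x] infnorm_le_norm[of "x' - x"] by (simp add: dist_norm)
  qed fact
qed

lemma mindist_piece: obtains t where "t \<in> pieces P" "mindist P x = piece t x"
proof -
  obtain y where y: "y \<in> P" "mindist P x = infnorm (x - y)" by (rule mindist_attained)
  obtain i where i: "infnorm (x - y) = \<bar>(x - y) $ i\<bar>" by (rule infnorm_attained)
  define s :: real where "s = (if 0 \<le> (x - y) $ i then 1 else -1)"
  have "(i, s, y $ i) \<in> pieces P" using y by (auto simp: pieces_def s_def image_iff)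
  moreover have "mindist P x = piece (i, s, y $ i) x" using y i by (auto simp: piece_def s_def)
  ultimately show ?thesis using that by blast
qed

text \<open>Off the creases, the finitely many other pieces differ from the distance at x, hence
  also near x by continuity. As the distance equals some piece at every point, only t
  remains.\<close>

lemma mindist_locally_piece:
  assumes x: "x \<notin> creases P" and t: "t \<in> pieces P" "mindist P x = piece t x"
  obtains U where "open U" "x \<in> U" "\<And>z. z \<in> U \<Longrightarrow> mindist P z = piece t z"
proof (rule that)
  let ?U = "\<Inter>t'\<in>pieces P - {t}. {z. piece t' z \<noteq> mindist P z}"
  show "open ?U"
    using finite_pieces[OF P(1)] by (intro open_INT ballI open_Collect_neq piece_continuous mindist_continuous) auto
  show "x \<in> ?U" using x t by (auto simp: creases_def)
  fix z assume z: "z \<in> ?U"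
  obtain t' where "t' \<in> pieces P" "mindist P z = piece t' z" by (rule mindist_piece)
  then show "mindist P z = piece t z" using z by auto
qed

lemma mindist_unique_piece:
  assumes x: "x \<notin> creases P" shows "\<exists>!t. t \<in> pieces P \<and> mindist P x = piece t x"
proof -
  obtain t where t: "t \<in> pieces P" "mindist P x = piece t x" by (rule mindist_piece)
  show ?thesis
  proof (rule ex1I[of _ t])
    show "t' = t" if "t' \<in> pieces P \<and> mindist P x = piece t' x" for t'
      using that t x by (auto simp: creases_def)
  qed (use t in auto)
qed

context
  fixes g \<gamma> :: "real \<Rightarrow> real" and L :: real
  assumes g: "\<And>r. (g has_real_derivative \<gamma> r) (at r)" and \<gamma>: "continuous_on UNIV \<gamma>" "\<And>r. \<bar>\<gamma> r\<bar> \<le> L"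
begin

text \<open>Off the creases exactly one summand is active. A sum over all pieces replaces the choice
  of the active one, which makes measurability immediate; on the creases the value is 0.\<close>

definition mindist_grad :: "real^'d \<Rightarrow> real^'d" where
  "mindist_grad x = (\<chi> j. \<Sum>t\<in>pieces P. if x \<notin> creases P \<and> mindist P x = piece t x then \<gamma> (mindist P x) * (if fst t = j then fst (snd t) else 0) else 0)"

lemma mindist_grad_eq:
  assumes x: "x \<notin> creases P" and t: "t \<in> pieces P" "mindist P x = piece t x"
  shows "mindist_grad x $ j = \<gamma> (mindist P x) * (if fst t = j then fst (snd t) else 0)"
proof -
  have "mindist_grad x $ j = (\<Sum>t'\<in>pieces P. if t' = t then \<gamma> (mindist P x) * (if fst t = j then fst (snd t) else 0) else 0)"
    unfolding mindist_grad_def vec_lambda_beta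
  proof (rule sum.cong[OF refl])
    fix t' assume "t' \<in> pieces P"
    then have "x \<notin> creases P \<and> mindist P x = piece t' x \<longleftrightarrow> t' = t"
      using mindist_unique_piece[OF x] x t by blast
    then show "(if x \<notin> creases P \<and> mindist P x = piece t' x then \<gamma> (mindist P x) * (if fst t' = j then fst (snd t') else 0) else 0)
      = (if t' = t then \<gamma> (mindist P x) * (if fst t = j then fst (snd t) else 0) else 0)" by simp
  qed
  then show ?thesis using t finite_pieces[OF P(1)] by simp
qed

text \<open>Only the coordinate of the active piece contributes, and its sign has modulus 1.\<close>

lemma mindist_grad_bound: "(\<Sum>j\<in>UNIV. \<bar>mindist_grad x $ j\<bar>) \<le> \<bar>\<gamma> (mindist P x)\<bar>"
proof (cases "x \<in> creases P")
  case False
  obtain t where t: "t \<in> pieces P" "mindist P x = piece t x" by (rule mindist_piece)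
  have "(\<Sum>j\<in>UNIV. \<bar>mindist_grad x $ j\<bar>) = (\<Sum>j\<in>UNIV. if fst t = j then \<bar>\<gamma> (mindist P x)\<bar> else 0)"
    using piece_sign[OF t(1)] by (intro sum.cong) (auto simp: mindist_grad_eq[OF False t] abs_mult)
  then show ?thesis by simp
qed (simp add: mindist_grad_def)

lemma mindist_grad_component_bound: "\<bar>mindist_grad x $ j\<bar> \<le> L"
  using member_le_sum[of j UNIV "\<lambda>j. \<bar>mindist_grad x $ j\<bar>"] mindist_grad_bound[of x] \<gamma>(2)[of "mindist P x"] by simp

lemma mindist_borel: "mindist P \<in> borel_measurable borel"
  by (intro borel_measurable_continuous_onI mindist_continuous)

lemma profile_deriv_borel: "\<gamma> \<in> borel_measurable borel"
  by (intro borel_measurable_continuous_onI \<gamma>)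

lemma mindist_grad_borel: "(\<lambda>x. mindist_grad x $ j) \<in> borel_measurable borel"
proof -
  note [measurable] = mindist_borel profile_deriv_borel
  have [measurable]: "creases P \<in> sets borel" using creases_null[OF P(1)] by auto
  have [measurable]: "piece t \<in> borel_measurable borel" for t :: "'d \<times> real \<times> real"
    by (intro borel_measurable_continuous_onI piece_continuous)
  show ?thesis unfolding mindist_grad_def vec_lambda_beta by measurable
qed

lemma profile_continuous: "continuous_on A g"
  using g by (meson DERIV_isCont continuous_at_imp_continuous_on)

lemma comp_mindist_continuous: "continuous_on A (\<lambda>x. g (mindist P x))"
  by (intro continuous_on_compose2[OF profile_continuous[of UNIV] mindist_continuous]) auto

lemma profile_lipschitz: "\<bar>g r - g s\<bar> \<le> L * \<bar>r - s\<bar>"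
  using field_differentiable_bound[of UNIV g \<gamma> L r s] g \<gamma>(2) by (auto intro: has_field_derivative_at_within)

lemma comp_mindist_lipschitz: "\<bar>g (mindist P x) - g (mindist P z)\<bar> \<le> L * infnorm (x - z)"
proof -
  have "0 \<le> L" using \<gamma>(2)[of 0] by linarith
  then show ?thesis using profile_lipschitz[of "mindist P x" "mindist P z"] mindist_lipschitz[of x z]
    by (meson mult_left_mono order_trans)
qed

lemma comp_mindist_directional:
  assumes x: "x \<notin> creases P"
  shows "((\<lambda>\<tau>. g (mindist P (x + \<tau> *\<^sub>R axis j 1))) has_real_derivative mindist_grad x $ j) (at 0)"
proof -
  obtain t where t: "t \<in> pieces P" "mindist P x = piece t x" by (rule mindist_piece)
  obtain U where U: "open U" "x \<in> U" "\<And>z. z \<in> U \<Longrightarrow> mindist P z = piece t z"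
    using mindist_locally_piece[OF x t] by blast
  let ?c = "\<lambda>\<tau>. x + \<tau> *\<^sub>R axis j (1::real)"
  have op: "open (?c -` U)" by (rule open_vimage[OF U(1)]) (intro continuous_intros)
  have c0: "0 \<in> ?c -` U" using U(2) by simp
  have comp: "(axis j 1 :: real^'d) $ fst t = (if fst t = j then 1 else 0)" by (simp add: axis_def)
  have "((\<lambda>\<tau>. piece t (?c \<tau>)) has_real_derivative (if fst t = j then fst (snd t) else 0)) (at 0)"
    unfolding piece_def vector_add_component vector_scaleR_component comp
    by (auto intro!: derivative_eq_intros)
  then have "((\<lambda>\<tau>. g (piece t (?c \<tau>))) has_real_derivative \<gamma> (piece t (?c 0)) * (if fst t = j then fst (snd t) else 0)) (at 0)"
    by (rule DERIV_chain2[OF g])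
  then have "((\<lambda>\<tau>. g (mindist P (?c \<tau>))) has_real_derivative \<gamma> (piece t (?c 0)) * (if fst t = j then fst (snd t) else 0)) (at 0)"
    by (rule has_field_derivative_transform_within_open[OF _ op c0]) (simp add: U(3))
  then show ?thesis by (simp add: mindist_grad_eq[OF x t] t(2))
qed

text \<open>
  The difference quotients of \<open>u = g(mindist P) \<phi>\<close> in a coordinate direction have integral zero by
  translation invariance, are uniformly bounded with common compact support, and converge off the
  creases.
\<close>

lemma mindist_grad_weak_lborel:
  assumes tf: "test_function Q \<phi>"
  shows "(LINT x|lborel. g (mindist P x) * partial_deriv j \<phi> x) = - (LINT x|lborel. mindist_grad x $ j * \<phi> x)"
    "integrable lborel (\<lambda>x. g (mindist P x) * partial_deriv j \<phi> x)" "integrable lborel (\<lambda>x. mindist_grad x $ j * \<phi> x)"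
proof -
  note [measurable] = mindist_grad_borel
  let ?f = "\<lambda>x. g (mindist P x)" and ?K = "closure {x. \<phi> x \<noteq> 0}" and ?e = "axis j 1 :: real^'d"
  have K: "compact ?K" using tf by (simp add: test_function_def)
  obtain B where B: "\<And>x. \<bar>\<phi> x\<bar> \<le> B" "\<And>i x. \<bar>partial_deriv i \<phi> x\<bar> \<le> B" "0 \<le> B"
    using test_function_bounded[OF tf] by metis
  have \<phi>0: "\<phi> x = 0" if "x \<notin> ?K" for x using that closure_subset[of "{x. \<phi> x \<noteq> 0}"] by auto
  have d0: "partial_deriv j \<phi> x = 0" if "x \<notin> ?K" for x by (rule test_function_partial_0[OF that])
  have [measurable]: "\<phi> \<in> borel_measurable borel" "partial_deriv j \<phi> \<in> borel_measurable borel" "?f \<in> borel_measurable borel"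
    by (intro borel_measurable_continuous_onI test_function_continuous[OF tf] comp_mindist_continuous)+
  have L: "0 \<le> L" using \<gamma>(2)[of 0] by linarith
  \<comment> \<open>Steps of length at most 1 move the support of \<phi> within this neighbourhood,
    so it carries all difference quotients; f is needed one step further, on
    \<open>thick ?K' 1\<close>.\<close>
  let ?K' = "thick ?K 1"
  have K': "compact ?K'" by (rule thick_compact[OF K])
  have KK': "?K \<subseteq> ?K'" by (rule subset_thick) simp
  have [measurable]: "?K' \<in> sets borel" using K' by (rule borel_compact)
  have "bounded (?f ` thick ?K' 1)"
    by (intro compact_imp_bounded compact_continuous_image comp_mindist_continuous thick_compact K')
  then obtain M where M: "\<And>x. x \<in> thick ?K' 1 \<Longrightarrow> \<bar>?f x\<bar> \<le> M" by (auto simp: bounded_iff)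
  define M' where "M' = max M 0"
  have M': "0 \<le> M'" "\<And>x. x \<in> ?K' \<Longrightarrow> \<bar>?f x\<bar> \<le> M'" "\<And>x. x \<in> thick ?K' 1 \<Longrightarrow> \<bar>?f x\<bar> \<le> M'"
  proof -
    show "0 \<le> M'" by (simp add: M'_def)
    show *: "\<bar>?f x\<bar> \<le> M'" if "x \<in> thick ?K' 1" for x using M[OF that] by (simp add: M'_def)
    have "?K' \<subseteq> thick ?K' 1" by (rule subset_thick) simp
    then show "\<bar>?f x\<bar> \<le> M'" if "x \<in> ?K'" for x using that by (intro *) auto
  qed
  have indK: "integrable lborel (\<lambda>x. C * indicator ?K' x :: real)" for C
    using emeasure_bounded_finite[OF compact_imp_bounded[OF K']]
    by (intro integrable_mult_right) (auto simp: integrable_indicator_iff less_top)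
  have dom: "integrable lborel k"
    if k: "k \<in> borel_measurable borel" "\<And>x. x \<in> ?K' \<Longrightarrow> \<bar>k x\<bar> \<le> C" "\<And>x. x \<notin> ?K \<Longrightarrow> k x = 0" for k :: "real^'d \<Rightarrow> real" and C
  proof (rule Bochner_Integration.integrable_bound[OF indK[of C]])
    show "AE x in lborel. norm (k x) \<le> norm (C * indicator ?K' x)"
    proof (rule AE_I2)
      fix x
      show "norm (k x) \<le> norm (C * indicator ?K' x)"
      proof (cases "x \<in> ?K'")
        case True
        then show ?thesis using k(2)[OF True] by simp
      next
        case False
        then have "x \<notin> ?K" using KK' by blast
        from k(3)[OF this] show ?thesis by simp
      qed
    qed
  qed (use k(1) in simp)
  let ?u = "\<lambda>x. ?f x * \<phi> x"
  have abs_le: "\<bar>s * t\<bar> \<le> S * T" if "\<bar>s\<bar> \<le> S" "\<bar>t\<bar> \<le> T" for s t S T :: real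
    unfolding abs_mult using that by (intro mult_mono) auto
  show int1: "integrable lborel (\<lambda>x. ?f x * partial_deriv j \<phi> x)"
  proof (rule dom[OF _ abs_le[OF M'(2) B(2)]])
    show "(\<lambda>x. ?f x * partial_deriv j \<phi> x) \<in> borel_measurable borel" by measurable
  qed (assumption, simp only: mult_eq_0_iff, rule disjI2[OF d0], assumption)
  show int2: "integrable lborel (\<lambda>x. mindist_grad x $ j * \<phi> x)"
  proof (rule dom[OF _ abs_le[OF mindist_grad_component_bound B(1)]])
    show "(\<lambda>x. mindist_grad x $ j * \<phi> x) \<in> borel_measurable borel" by measurable
  qed (simp only: mult_eq_0_iff, rule disjI2[OF \<phi>0], assumption)
  have intu: "integrable lborel ?u"
  proof (rule dom[OF _ abs_le[OF M'(2) B(1)]])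
    show "(\<lambda>x. ?u x) \<in> borel_measurable borel" by measurable
  qed (assumption, simp only: mult_eq_0_iff, rule disjI2[OF \<phi>0], assumption)
  let ?\<tau> = "\<lambda>n. 1 / real (Suc n)"
  let ?w = "\<lambda>n x. (?u (x + ?\<tau> n *\<^sub>R ?e) - ?u x) / ?\<tau> n"
  have ein: "infnorm (c *\<^sub>R ?e) = \<bar>c\<bar>" for c
  proof -
    have "infnorm ?e \<le> 1" unfolding infnorm_le_iff by (simp add: axis_def)
    moreover have "1 \<le> infnorm ?e" using component_le_infnorm_cart[of ?e j] by (simp add: axis_def)
    ultimately show ?thesis by (simp add: infnorm_mul)
  qed
  have w0: "(LINT x|lborel. ?w n x) = 0" for n
  proof -
    have "integrable lborel (\<lambda>x. ?u (x + ?\<tau> n *\<^sub>R ?e))" using shift_lborel(1)[of ?u "?\<tau> n *\<^sub>R ?e"] intu by simp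
    then show ?thesis using shift_lborel(2)[of ?u "?\<tau> n *\<^sub>R ?e"] intu by simp
  qed
  have \<phi>diff: "\<bar>\<phi> (x + \<tau> *\<^sub>R ?e) - \<phi> x\<bar> \<le> B * \<bar>\<tau>\<bar>" for x \<tau>
  proof -
    have der: "((\<lambda>\<tau>. \<phi> (x + \<tau> *\<^sub>R ?e)) has_real_derivative partial_deriv j \<phi> (x + \<tau> *\<^sub>R ?e)) (at \<tau>)" for \<tau>
    proof -
      let ?D = "frechet_derivative \<phi> (at (x + \<tau> *\<^sub>R ?e))"
      have d: "\<phi> differentiable (at (x + \<tau> *\<^sub>R ?e))" by (rule test_function_differentiable(1)[OF tf])
      then have "(\<phi> has_derivative ?D) (at (x + \<tau> *\<^sub>R ?e))" by (simp add: frechet_derivative_works)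
      then have "((\<lambda>\<tau>. \<phi> (x + \<tau> *\<^sub>R ?e)) has_derivative (\<lambda>h. ?D (h *\<^sub>R ?e))) (at \<tau>)"
        by (rule has_derivative_compose[where f = "\<lambda>\<tau>. x + \<tau> *\<^sub>R ?e", rotated]) (auto intro!: derivative_eq_intros)
      moreover have "?D (h *\<^sub>R ?e) = partial_deriv j \<phi> (x + \<tau> *\<^sub>R ?e) * h" for h
        using linear_frechet_derivative[OF d] by (simp add: linear_scale partial_deriv_def)
      ultimately show ?thesis by (simp add: has_field_derivative_def)
    qed
    have "norm (\<phi> (x + \<tau> *\<^sub>R ?e) - \<phi> (x + 0 *\<^sub>R ?e)) \<le> B * norm (\<tau> - 0)"
      by (rule field_differentiable_bound[where S = UNIV and f = "\<lambda>\<tau>. \<phi> (x + \<tau> *\<^sub>R ?e)"])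
         (use der B in \<open>auto intro: has_field_derivative_at_within\<close>)
    then show ?thesis by simp
  qed
  let ?C = "M' * B + B * L"
  have wbound: "norm (?w n x) \<le> ?C * indicator ?K' x" for n x
  proof -
    have \<tau>: "0 < ?\<tau> n" "?\<tau> n \<le> 1" by auto
    let ?y = "x + ?\<tau> n *\<^sub>R ?e"
    have yx: "infnorm (?y - x) \<le> 1" "infnorm (x - ?y) \<le> 1" using \<tau> ein[of "?\<tau> n"] by (simp_all add: infnorm_neg)
    show ?thesis
    proof (cases "x \<in> ?K'")
      case True
      have yT: "?y \<in> thick ?K' 1" unfolding thick_def[of ?K'] using True yx(1) by blast
      \<comment> \<open>A discrete product rule: both differences are at most a constant times the
        step, and division by the step leaves the bound \<open>?C\<close>.\<close>
      have eq: "?u ?y - ?u x = ?f ?y * (\<phi> ?y - \<phi> x) + \<phi> x * (?f ?y - ?f x)" by (simp add: algebra_simps)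
      then have "\<bar>?u ?y - ?u x\<bar> \<le> \<bar>?f ?y\<bar> * \<bar>\<phi> ?y - \<phi> x\<bar> + \<bar>\<phi> x\<bar> * \<bar>?f ?y - ?f x\<bar>"
        using abs_triangle_ineq[of "?f ?y * (\<phi> ?y - \<phi> x)" "\<phi> x * (?f ?y - ?f x)"] by (simp only: abs_mult)
      also have "\<dots> \<le> M' * (B * ?\<tau> n) + B * (L * ?\<tau> n)"
        using M'(3)[OF yT] \<phi>diff[of x "?\<tau> n"] B(1)[of x] comp_mindist_lipschitz[of ?y x] M' B L \<tau> ein[of "?\<tau> n"]
        by (intro add_mono mult_mono) auto
      also have "\<dots> = ?C * ?\<tau> n" by (simp add: algebra_simps)
      finally have "\<bar>?u ?y - ?u x\<bar> / ?\<tau> n \<le> ?C" using \<tau> by (simp only: pos_divide_le_eq)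
      then show ?thesis using True \<tau> by (simp only: abs_divide real_norm_def indicator_simps mult_1_right abs_of_pos)
    next
      case False
      then have "x \<notin> ?K" using KK' by blast
      moreover have "?y \<notin> ?K" using False yx(2) by (auto simp: thick_def)
      ultimately have "\<phi> x = 0 \<and> \<phi> ?y = 0" using \<phi>0 by blast
      then show ?thesis using False by simp
    qed
  qed
  have wlim: "(\<lambda>n. ?w n x) \<longlonglongrightarrow> ?f x * partial_deriv j \<phi> x + mindist_grad x $ j * \<phi> x" if x: "x \<notin> creases P" for x
  proof -
    let ?D = "frechet_derivative \<phi> (at x)"
    have d: "\<phi> differentiable (at x)" by (rule test_function_differentiable(1)[OF tf])
    then have "(\<phi> has_derivative ?D) (at (x + 0 *\<^sub>R ?e))" by (simp add: frechet_derivative_works)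
    then have "((\<lambda>\<tau>. \<phi> (x + \<tau> *\<^sub>R ?e)) has_derivative (\<lambda>h. ?D (h *\<^sub>R ?e))) (at 0)"
      by (rule has_derivative_compose[where f = "\<lambda>\<tau>. x + \<tau> *\<^sub>R ?e", rotated]) (auto intro!: derivative_eq_intros)
    moreover have "?D (h *\<^sub>R ?e) = partial_deriv j \<phi> x * h" for h
      using linear_frechet_derivative[OF d] by (simp add: linear_scale partial_deriv_def)
    ultimately have "((\<lambda>\<tau>. \<phi> (x + \<tau> *\<^sub>R ?e)) has_real_derivative partial_deriv j \<phi> x) (at 0)"
      by (simp add: has_field_derivative_def)
    from DERIV_mult[OF comp_mindist_directional[OF x, of j] this]
    have "((\<lambda>\<tau>. ?u (x + \<tau> *\<^sub>R ?e)) has_real_derivative ?f x * partial_deriv j \<phi> x + mindist_grad x $ j * \<phi> x) (at 0)"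
      by (simp add: algebra_simps)
    then have "((\<lambda>\<tau>. (?u (x + (0 + \<tau>) *\<^sub>R ?e) - ?u (x + 0 *\<^sub>R ?e)) / \<tau>) \<longlongrightarrow> ?f x * partial_deriv j \<phi> x + mindist_grad x $ j * \<phi> x) (at 0)"
      unfolding DERIV_def .
    moreover have "filterlim ?\<tau> (at 0) sequentially"
      unfolding filterlim_at using LIMSEQ_inverse_real_of_nat by (simp add: inverse_eq_divide)
    ultimately have "((\<lambda>n. (?u (x + (0 + ?\<tau> n) *\<^sub>R ?e) - ?u (x + 0 *\<^sub>R ?e)) / ?\<tau> n) \<longlongrightarrow> ?f x * partial_deriv j \<phi> x + mindist_grad x $ j * \<phi> x) sequentially"
      by (rule filterlim_compose)
    then show ?thesis by simp
  qed
  have "(\<lambda>n. LINT x|lborel. ?w n x) \<longlonglongrightarrow> (LINT x|lborel. ?f x * partial_deriv j \<phi> x + mindist_grad x $ j * \<phi> x)"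
  proof (rule integral_dominated_convergence[where w = "\<lambda>x. ?C * indicator ?K' x"])
    show "AE x in lborel. (\<lambda>n. ?w n x) \<longlonglongrightarrow> ?f x * partial_deriv j \<phi> x + mindist_grad x $ j * \<phi> x"
      using AE_not_in[OF creases_null[OF P(1)]] by eventually_elim (rule wlim)
    show "AE x in lborel. norm (?w n x) \<le> ?C * indicator ?K' x" for n by (intro AE_I2 wbound)
  qed (use indK in measurable)
  then have "(LINT x|lborel. ?f x * partial_deriv j \<phi> x + mindist_grad x $ j * \<phi> x) = 0"
    unfolding w0 by (simp add: LIMSEQ_const_iff)
  then show "(LINT x|lborel. ?f x * partial_deriv j \<phi> x) = - (LINT x|lborel. mindist_grad x $ j * \<phi> x)"
    using int1 int2 by simp
qed

lemma mindist_grad_weak: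
  assumes Q: "open Q"
  shows "weak_partial Q j (\<lambda>x. g (mindist P x)) (\<lambda>x. mindist_grad x $ j)"
  unfolding weak_partial_def
proof (intro allI impI)
  fix \<phi> assume tf: "test_function Q \<phi>"
  have QL: "Q \<inter> space lebesgue \<in> sets lebesgue" using Q by simp
  have sub: "closure {x. \<phi> x \<noteq> 0} \<subseteq> Q" using tf by (simp add: test_function_def)
  have off: "\<phi> x = 0" "partial_deriv j \<phi> x = 0" if "x \<notin> Q" for x
    using that sub closure_subset[of "{x. \<phi> x \<noteq> 0}"] test_function_partial_0[of x \<phi> j] by auto
  have conv: "(LINT x|lebesgue_on Q. k x) = (LINT x|lborel. k x)"
    if "integrable lborel k" "\<And>x. x \<notin> Q \<Longrightarrow> k x = 0" for k :: "real^'d \<Rightarrow> real"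
  proof -
    have "(LINT x|lebesgue_on Q. k x) = (LINT x|lebesgue. indicator Q x *\<^sub>R k x)"
      by (rule integral_restrict_space[OF QL])
    also have "\<dots> = (LINT x|lebesgue. k x)" using that(2) by (intro Bochner_Integration.integral_cong) (auto simp: indicator_def)
    also have "\<dots> = (LINT x|lborel. k x)" using that(1) by (intro integral_completion) auto
    finally show ?thesis .
  qed
  note gw = mindist_grad_weak_lborel[OF tf, of j]
  have "(LINT x|lebesgue_on Q. g (mindist P x) * partial_deriv j \<phi> x) = (LINT x|lborel. g (mindist P x) * partial_deriv j \<phi> x)"
    by (rule conv[OF gw(2)]) (simp add: off)
  moreover have "(LINT x|lebesgue_on Q. mindist_grad x $ j * \<phi> x) = (LINT x|lborel. mindist_grad x $ j * \<phi> x)"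
    by (rule conv[OF gw(3)]) (simp add: off)
  ultimately show "(LINT x|lebesgue_on Q. g (mindist P x) * partial_deriv j \<phi> x) = - (LINT x|lebesgue_on Q. mindist_grad x $ j * \<phi> x)"
    using gw(1) by simp
qed

end

end

section \<open>Lower bound for the optimal error\<close>

lemma bounded_Lp:
  assumes Q: "open (Q :: (real^'d) set)" "bounded Q" and p: "0 \<le> p"
    and k: "k \<in> borel_measurable borel" "\<And>x. x \<in> Q \<Longrightarrow> \<bar>k x\<bar> \<le> C"
  shows "k \<in> Lp_space p Q"
proof -
  have meas [measurable]: "k \<in> borel_measurable (lebesgue_on Q)"
    using k(1) by (intro measurable_restrict_space1 measurable_completion) simp
  note const = integrable_const_bounded[OF Q]
  show ?thesis
  proof (cases "p = \<infinity>")
    case True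
    have "esssup (lebesgue_on Q) (\<lambda>x. ereal \<bar>k x\<bar>) \<le> ereal C"
      using k(2) by (intro esssup_I) (auto simp: space_restrict_space)
    then show ?thesis using True meas by (auto simp: Lp_space_def)
  next
    case False
    have e: "0 \<le> real_of_ereal p" using p by (rule real_of_ereal_pos)
    have "integrable (lebesgue_on Q) (\<lambda>x. \<bar>k x\<bar> powr real_of_ereal p)"
    proof (rule Bochner_Integration.integrable_bound[OF const[of "\<bar>C\<bar> powr real_of_ereal p"]])
      show "AE x in lebesgue_on Q. norm (\<bar>k x\<bar> powr real_of_ereal p) \<le> norm (\<bar>C\<bar> powr real_of_ereal p)"
      proof (rule AE_I2)
        fix x assume "x \<in> space (lebesgue_on Q)"
        then have "\<bar>k x\<bar> \<le> \<bar>C\<bar>" using k(2)[of x] by (auto simp: space_restrict_space)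
        then show "norm (\<bar>k x\<bar> powr real_of_ereal p) \<le> norm (\<bar>C\<bar> powr real_of_ereal p)"
          using e by (simp add: powr_mono2)
      qed
    qed measurable
    then show ?thesis using False meas by (simp add: Lp_space_def)
  qed
qed

text \<open>The l1 norm of the gradient is at most |\<gamma>| at the distance to P, so the
  assumption \<open>norm\<close> needs to speak of \<gamma> only. Boundedness of \<gamma> and of Q
  puts the function and its gradient into L_p.\<close>

lemma mindist_sobolev:
  fixes Q P :: "(real^'d) set" and g \<gamma> :: "real \<Rightarrow> real"
  assumes Q: "open Q" "bounded Q" and P: "finite P" "P \<noteq> {}"
    and g: "\<And>r. (g has_real_derivative \<gamma> r) (at r)" and \<gamma>: "continuous_on UNIV \<gamma>" "\<And>r. \<bar>\<gamma> r\<bar> \<le> L"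
    and p: "1 \<le> p"
    and norm: "p = \<infinity> \<and> (\<forall>r. \<bar>\<gamma> r\<bar> \<le> 1) \<or> (\<exists>e. p = ereal e \<and> (\<integral>\<^sup>+x\<in>Q. ennreal (\<bar>\<gamma> (mindist P x)\<bar> powr e) \<partial>lborel) \<le> 1)"
  shows "(\<lambda>x. g (mindist P x)) \<in> sobolev_class p Q"
proof -
  let ?G = "mindist_grad P \<gamma>"
  let ?s = "\<lambda>x. \<Sum>i\<in>UNIV. \<bar>?G x $ i\<bar>"
  have p0: "0 \<le> p" by (rule order_trans[OF _ p]) simp
  have Gm: "(\<lambda>x. ?G x $ i) \<in> borel_measurable borel" for i by (rule mindist_grad_borel[OF P g \<gamma>])
  have QL: "Q \<inter> space lebesgue \<in> sets lebesgue" using Q by simp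
  have sm [measurable]: "?s \<in> borel_measurable (lebesgue_on Q)"
    using Gm by (intro measurable_restrict_space1 measurable_completion) simp
  have GL: "(\<lambda>x. ?G x $ i) \<in> Lp_space p Q" for i
    by (rule bounded_Lp[OF Q p0 Gm mindist_grad_component_bound[OF P g \<gamma>]])
  have grad: "sobolev_gradient p Q (\<lambda>x. g (mindist P x)) ?G"
    unfolding sobolev_gradient_def using GL mindist_grad_weak[OF P g \<gamma> Q(1)] by blast
  have fc: "continuous_on A (\<lambda>x. g (mindist P x))" for A by (rule comp_mindist_continuous[OF P g \<gamma>])
  have fL: "(\<lambda>x. g (mindist P x)) \<in> Lp_space p Q"
  proof -
    have "compact ((\<lambda>x. g (mindist P x)) ` closure Q)"
      using Q by (intro compact_continuous_image fc) (simp add: compact_closure)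
    then obtain C where C: "\<forall>y\<in>(\<lambda>x. g (mindist P x)) ` closure Q. norm y \<le> C"
      by (meson compact_imp_bounded bounded_iff)
    show ?thesis
    proof (rule bounded_Lp[OF Q p0 borel_measurable_continuous_onI[OF fc]])
      fix x assume "x \<in> Q"
      then have "x \<in> closure Q" using closure_subset by blast
      then show "\<bar>g (mindist P x)\<bar> \<le> C" using C by auto
    qed
  qed
  have sb: "?s x \<le> \<bar>\<gamma> (mindist P x)\<bar>" for x by (rule mindist_grad_bound[OF P g \<gamma>])
  have s0: "0 \<le> ?s x" for x by (simp add: sum_nonneg)
  have "Lp_norm p Q ?s \<le> 1"
    using norm
  proof (elim disjE conjE exE)
    assume pinf: "p = \<infinity>" and le: "\<forall>r. \<bar>\<gamma> r\<bar> \<le> 1"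
    have "esssup (lebesgue_on Q) (\<lambda>x. ereal \<bar>?s x\<bar>) \<le> 1"
    proof (rule esssup_I)
      have "\<bar>?s x\<bar> \<le> 1" for x using sb[of x] s0[of x] le[rule_format, of "mindist P x"] by linarith
      then show "AE x in lebesgue_on Q. ereal \<bar>?s x\<bar> \<le> 1" by (simp add: one_ereal_def)
    qed measurable
    then show ?thesis using pinf unfolding Lp_norm_def
      by (cases "esssup (lebesgue_on Q) (\<lambda>x. ereal \<bar>?s x\<bar>)") (auto simp: one_ereal_def)
  next
    fix e assume e: "p = ereal e" and le: "(\<integral>\<^sup>+x\<in>Q. ennreal (\<bar>\<gamma> (mindist P x)\<bar> powr e) \<partial>lborel) \<le> 1"
    have e1: "1 \<le> e" using p e by simp
    have "(\<integral>\<^sup>+x. ennreal (\<bar>?s x\<bar> powr e) \<partial>lebesgue_on Q) = (\<integral>\<^sup>+x\<in>Q. ennreal (\<bar>?s x\<bar> powr e) \<partial>lebesgue)"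
      by (rule nn_integral_restrict_space[OF QL])
    also have "\<dots> = (\<integral>\<^sup>+x\<in>Q. ennreal (\<bar>?s x\<bar> powr e) \<partial>lborel)" by (rule nn_integral_completion)
    also have "\<dots> \<le> (\<integral>\<^sup>+x\<in>Q. ennreal (\<bar>\<gamma> (mindist P x)\<bar> powr e) \<partial>lborel)"
      using sb s0 e1 by (intro nn_integral_mono mult_right_mono ennreal_leI powr_mono2) auto
    also have "\<dots> \<le> 1" by (rule le)
    finally have "(\<integral>\<^sup>+x. ennreal (\<bar>?s x\<bar> powr e) \<partial>lebesgue_on Q) \<le> 1" .
    then have "enn2real (\<integral>\<^sup>+x. ennreal (\<bar>?s x\<bar> powr e) \<partial>lebesgue_on Q) \<le> enn2real 1"
      by (intro enn2real_mono) auto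
    then have "(LINT x|lebesgue_on Q. \<bar>?s x\<bar> powr e) \<le> 1"
      by (subst integral_eq_nn_integral) auto
    then have "(LINT x|lebesgue_on Q. \<bar>?s x\<bar> powr e) powr (1 / e) \<le> 1"
      using e1 by (intro powr_le1) auto
    then show ?thesis using e by (simp add: Lp_norm_def)
  qed
  then show ?thesis
    unfolding sobolev_class_def sobolev_space_def using fL fc grad by blast
qed

text \<open>Q is compared with n separate cubes of radius h, which have the same total volume. If y
  is the node nearest to x, then g h exceeds g (mindist P x) by at most the defect g h - g |x - y|,
  and only if x is in the cube about y. Integrating and summing the defects over at most n nodes
  leaves n times the integral of g over one cube; overlaps and parts of cubes outside Q are only
  counted in excess.\<close>

lemma mindist_integral_lower:
  fixes Q P :: "(real^'d) set" and g \<gamma> :: "real \<Rightarrow> real"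
  assumes P: "finite P" "P \<noteq> {}" "card P \<le> n"
    and g: "\<And>r. (g has_real_derivative \<gamma> r) (at r)" "g 0 = 0" and \<gamma>: "continuous_on UNIV \<gamma>" "\<And>r. 0 \<le> \<gamma> r"
    and Q: "open Q" "bounded Q" and h: "0 < h" and vol: "real n * (2 * h) ^ CARD('d) = measure lebesgue Q"
  shows "of_nat n * (\<integral>\<^sup>+y\<in>icube (0::real^'d) h. (ennreal (kern h y) * ennreal (\<gamma> (infnorm y))) \<partial>lborel)
    \<le> (\<integral>\<^sup>+x\<in>Q. ennreal (g (mindist P x)) \<partial>lborel)"
proof -
  have [measurable]: "\<gamma> \<in> borel_measurable borel" by (intro borel_measurable_continuous_onI \<gamma>)
  have "continuous_on UNIV g" using g(1) by (meson DERIV_isCont continuous_at_imp_continuous_on)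
  then have [measurable]: "g \<in> borel_measurable borel" by (rule borel_measurable_continuous_onI)
  have [measurable]: "mindist P \<in> borel_measurable borel" by (intro borel_measurable_continuous_onI mindist_continuous P)
  have [measurable]: "Q \<in> sets borel" using Q by simp
  have mono: "g r \<le> g s" if "r \<le> s" for r s
    by (rule DERIV_nonneg_imp_nondecreasing[OF that]) (use g \<gamma> in blast)
  have g0: "0 \<le> g r" if "0 \<le> r" for r using mono[OF that] g(2) by simp
  let ?J = "\<integral>\<^sup>+y\<in>icube (0::real^'d) h. ennreal (g (infnorm y)) \<partial>lborel"
  let ?B = "\<integral>\<^sup>+y\<in>icube (0::real^'d) h. ennreal (g h - g (infnorm y)) \<partial>lborel"
  \<comment> \<open>\<open>radial_kernel\<close> is read from right to left: since \<gamma> is the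
    derivative of g and g 0 = 0, the integral along the segment from 0 to z is g (infnorm
    z).\<close>
  have J: "(\<integral>\<^sup>+y\<in>icube (0::real^'d) h. (ennreal (kern h y) * ennreal (\<gamma> (infnorm y))) \<partial>lborel) = ?J"
  proof -
    have "(\<integral>\<^sup>+y\<in>icube (0::real^'d) h. (ennreal (kern h y) * ennreal (\<gamma> (infnorm y))) \<partial>lborel)
      = (\<integral>\<^sup>+z\<in>icube (0::real^'d) h. (ennreal (infnorm z) * (\<integral>\<^sup>+s\<in>{0<..<1}. ennreal (\<gamma> (infnorm (s *\<^sub>R z))) \<partial>lborel)) \<partial>lborel)"
      by (rule radial_kernel[symmetric]) (use h in measurable)
    also have "\<dots> = ?J"
    proof (rule nn_integral_cong)
      fix z :: "real^'d"
      have "ennreal (infnorm z) * (\<integral>\<^sup>+s\<in>{0<..<1}. ennreal (\<gamma> (infnorm (s *\<^sub>R z))) \<partial>lborel)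
        = (\<integral>\<^sup>+s. ennreal (infnorm z) * (ennreal (\<gamma> (infnorm (s *\<^sub>R z))) * indicator {0<..<1} s) \<partial>lborel)"
        by (rule nn_integral_cmult[symmetric]) measurable
      also have "\<dots> = (\<integral>\<^sup>+s. ennreal (infnorm z * \<gamma> (s * infnorm z)) * indicator {0..1} s \<partial>lborel)"
      proof (rule nn_integral_cong_AE)
        show "AE s in lborel. ennreal (infnorm z) * (ennreal (\<gamma> (infnorm (s *\<^sub>R z))) * indicator {0<..<1} s)
          = ennreal (infnorm z * \<gamma> (s * infnorm z)) * indicator {0..1} s"
          using AE_lborel_singleton[of "0::real"] AE_lborel_singleton[of "1::real"]
          by eventually_elim (auto simp: indicator_def infnorm_mul ennreal_mult infnorm_pos_le \<gamma>)
      qed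
      also have "\<dots> = ennreal (g (1 * infnorm z) - g (0 * infnorm z))"
      proof (rule nn_integral_FTC_Icc)
        fix s :: real
        have "((\<lambda>s. g (s * infnorm z)) has_real_derivative \<gamma> (s * infnorm z) * infnorm z) (at s)"
          by (rule DERIV_chain2[OF g(1)]) (auto intro!: derivative_eq_intros)
        then show "((\<lambda>s. g (s * infnorm z)) has_real_derivative infnorm z * \<gamma> (s * infnorm z)) (at s)"
          by (simp add: mult.commute)
      qed (auto simp: infnorm_pos_le \<gamma>)
      finally have "ennreal (infnorm z) * (\<integral>\<^sup>+s\<in>{0<..<1}. ennreal (\<gamma> (infnorm (s *\<^sub>R z))) \<partial>lborel) = ennreal (g (infnorm z))"
        using g(2) by simp
      then show "ennreal (infnorm z) * (\<integral>\<^sup>+s\<in>{0<..<1}. ennreal (\<gamma> (infnorm (s *\<^sub>R z))) \<partial>lborel) * indicator (icube 0 h) z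
        = ennreal (g (infnorm z)) * indicator (icube 0 h) z" by simp
    qed
    finally show ?thesis .
  qed
  have BJ: "?B + ?J = ennreal (g h * (2 * h) ^ CARD('d))"
  proof -
    have "?B + ?J = (\<integral>\<^sup>+y. ennreal (g h - g (infnorm y)) * indicator (icube (0::real^'d) h) y + ennreal (g (infnorm y)) * indicator (icube 0 h) y \<partial>lborel)"
      by (rule nn_integral_add[symmetric]) measurable
    also have "\<dots> = (\<integral>\<^sup>+y. ennreal (g h) * indicator (icube (0::real^'d) h) y \<partial>lborel)"
    proof (rule nn_integral_cong)
      fix y :: "real^'d"
      show "ennreal (g h - g (infnorm y)) * indicator (icube 0 h) y + ennreal (g (infnorm y)) * indicator (icube 0 h) y = ennreal (g h) * indicator (icube 0 h) y"
      proof (cases "infnorm y \<le> h")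
        case True
        have "ennreal (g h - g (infnorm y)) + ennreal (g (infnorm y)) = ennreal (g h)"
          using mono[OF True] g0[OF infnorm_pos_le] by (subst ennreal_plus[symmetric]) auto
        then show ?thesis by (simp add: indicator_def)
      qed (simp add: icube_def)
    qed
    also have "\<dots> = ennreal (g h * (2 * h) ^ CARD('d))"
      using h g0 by (subst nn_integral_cmult_indicator) (auto simp: emeasure_icube ennreal_mult)
    finally show ?thesis .
  qed
  have B: "?B < \<infinity>"
  proof -
    have "?B \<le> ?B + ?J" by simp
    also have "\<dots> < \<infinity>" unfolding BJ by simp
    finally show ?thesis .
  qed
  have "of_nat n * (?B + ?J) = ennreal (g h) * emeasure lborel Q"
  proof -
    have "emeasure lborel Q = ennreal (measure lborel Q)"
      using emeasure_bounded_finite[OF Q(2)] by (intro emeasure_eq_ennreal_measure) (simp add: less_top)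
    also have "measure lborel Q = real n * (2 * h) ^ CARD('d)" using vol Q by simp
    finally show ?thesis unfolding BJ using g0[of h] h
      by (simp add: ennreal_mult ennreal_of_nat_eq_real_of_nat mult_ac)
  qed
  also have "\<dots> = (\<integral>\<^sup>+x\<in>Q. ennreal (g h) \<partial>lborel)" by (simp add: nn_integral_cmult_indicator)
  also have "\<dots> \<le> (\<integral>\<^sup>+x. ennreal (g (mindist P x)) * indicator Q x + (\<Sum>y\<in>P. ennreal (g h - g (infnorm (x - y))) * indicator (icube y h) x) \<partial>lborel)"
  proof (rule nn_integral_mono)
    fix x
    obtain y where y: "y \<in> P" "mindist P x = infnorm (x - y)" by (rule mindist_attained[OF P(1,2)])
    have "ennreal (g h) \<le> ennreal (g (mindist P x)) + ennreal (g h - g (infnorm (x - y))) * indicator (icube y h) x"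
    proof (cases "infnorm (x - y) \<le> h")
      case True
      have "ennreal (g h) = ennreal (g (infnorm (x - y))) + ennreal (g h - g (infnorm (x - y)))"
        using mono[OF True] g0[OF infnorm_pos_le] by (subst ennreal_plus[symmetric]) auto
      then show ?thesis using True y by (simp add: icube_def)
    next
      case False
      then show ?thesis using y mono[of h "infnorm (x - y)"] by (simp add: icube_def ennreal_leI)
    qed
    also have "\<dots> \<le> ennreal (g (mindist P x)) + (\<Sum>y\<in>P. ennreal (g h - g (infnorm (x - y))) * indicator (icube y h) x)"
      using y(1) P by (intro add_left_mono member_le_sum) auto
    finally show "ennreal (g h) * indicator Q x \<le> ennreal (g (mindist P x)) * indicator Q x + (\<Sum>y\<in>P. ennreal (g h - g (infnorm (x - y))) * indicator (icube y h) x)"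
      by (cases "x \<in> Q") auto
  qed
  also have "\<dots> = (\<integral>\<^sup>+x\<in>Q. ennreal (g (mindist P x)) \<partial>lborel) + (\<Sum>y\<in>P. \<integral>\<^sup>+x\<in>icube y h. ennreal (g h - g (infnorm (x - y))) \<partial>lborel)"
    by (subst nn_integral_add) (auto simp: nn_integral_sum)
  also have "(\<Sum>y\<in>P. \<integral>\<^sup>+x\<in>icube y h. ennreal (g h - g (infnorm (x - y))) \<partial>lborel) = (\<Sum>y\<in>P. ?B)"
  proof (rule sum.cong[OF refl])
    fix y :: "real^'d"
    show "(\<integral>\<^sup>+x\<in>icube y h. ennreal (g h - g (infnorm (x - y))) \<partial>lborel) = ?B"
      by (rule nn_integral_icube_translate) measurable
  qed
  also have "(\<integral>\<^sup>+x\<in>Q. ennreal (g (mindist P x)) \<partial>lborel) + (\<Sum>y\<in>P. ?B) \<le> (\<integral>\<^sup>+x\<in>Q. ennreal (g (mindist P x)) \<partial>lborel) + of_nat n * ?B"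
    using P(3) by (simp add: add_left_mono mult_right_mono)
  finally have "of_nat n * ?B + of_nat n * ?J \<le> of_nat n * ?B + (\<integral>\<^sup>+x\<in>Q. ennreal (g (mindist P x)) \<partial>lborel)"
    by (simp add: distrib_left add.commute)
  moreover have "of_nat n * ?B < \<infinity>" using B by (simp add: ennreal_mult_less_top less_top of_nat_less_top)
  ultimately show ?thesis unfolding J by (simp add: ennreal_add_left_cancel_le) (auto simp: less_top)
qed

text \<open>The functions f and -f produce the same data, namely zeros, so every method is wrong by
  at least the integral of f on one of them.\<close>

lemma recovery_error_lower:
  assumes f: "f \<in> X" "(\<lambda>x. - f x) \<in> X" "\<And>x. x \<in> set xs \<Longrightarrow> f x = 0"
  shows "ereal (LINT x|lebesgue_on Q. f x) \<le> recovery_error Q X \<Phi> xs"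
proof -
  have m: "map f xs = map (\<lambda>x. - f x) xs" using f(3) by simp
  let ?I = "LINT x|lebesgue_on Q. f x" and ?c = "\<Phi> (map f xs)"
  have "ereal \<bar>?I - ?c\<bar> \<le> recovery_error Q X \<Phi> xs"
    unfolding recovery_error_def by (rule SUP_upper[OF f(1)])
  moreover have "ereal \<bar>- ?I - ?c\<bar> \<le> recovery_error Q X \<Phi> xs"
    unfolding recovery_error_def using SUP_upper[OF f(2), of "\<lambda>f. ereal \<bar>(LINT x|lebesgue_on Q. f x) - \<Phi> (map f xs)\<bar>"]
    by (simp add: m)
  moreover have "?I \<le> \<bar>?I - ?c\<bar> \<or> ?I \<le> \<bar>- ?I - ?c\<bar>" by linarith
  ultimately show ?thesis by (meson ereal_less_eq(3) order_trans)
qed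

lemma antiderivative_exists:
  assumes "continuous_on UNIV (\<gamma> :: real \<Rightarrow> real)"
  obtains g where "\<And>r. (g has_real_derivative \<gamma> r) (at r)" "g 0 = 0"
proof -
  have "\<exists>F. \<forall>x::real. - \<infinity> < ereal x \<longrightarrow> ereal x < \<infinity> \<longrightarrow> (F has_vector_derivative \<gamma> x) (at x)"
    using assms by (intro einterval_antiderivative) (auto simp: continuous_on_eq_continuous_at)
  then obtain F where F: "\<And>x. (F has_vector_derivative \<gamma> x) (at x)" by auto
  show ?thesis
  proof (rule that[of "\<lambda>x. F x - F 0"])
    show "((\<lambda>x. F x - F 0) has_real_derivative \<gamma> r) (at r)" for r
      using F[of r] by (auto simp: has_real_derivative_iff_has_vector_derivative intro!: derivative_eq_intros)
  qed simp
qed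

text \<open>For finite p the profile is flat beyond h, so the gradient is supported in the cubes of
  radius h about the nodes, and the integral of its p-th power is at most the sum over the nodes,
  whatever their position. For p = \<infinity> the bound on \<gamma> alone suffices.\<close>

lemma optimal_lower_test:
  fixes Q :: "(real^'d) set" and \<gamma> :: "real \<Rightarrow> real"
  assumes Q: "open Q" "bounded Q" and h: "0 < h" and n: "0 < n" and vol: "real n * (2 * h) ^ CARD('d) = measure lebesgue Q"
    and \<gamma>: "continuous_on UNIV \<gamma>" "\<And>r. 0 \<le> \<gamma> r" "\<And>r. \<gamma> r \<le> L" and p: "1 \<le> p"
    and norm: "p = \<infinity> \<and> (\<forall>r. \<gamma> r \<le> 1) \<or> (\<exists>e. p = ereal e \<and> (\<forall>r\<ge>h. \<gamma> r = 0) \<and>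
        of_nat n * (\<integral>\<^sup>+y\<in>icube (0::real^'d) h. ennreal (\<gamma> (infnorm y) powr e) \<partial>lborel) \<le> 1)"
    and V: "0 \<le> V" "ennreal V \<le> of_nat n * (\<integral>\<^sup>+y\<in>icube (0::real^'d) h. (ennreal (kern h y) * ennreal (\<gamma> (infnorm y))) \<partial>lborel)"
  shows "ereal V \<le> optimal_error Q (sobolev_class p Q) n"
  unfolding optimal_error_def
proof (intro INF_greatest)
  fix xs \<Phi> assume "xs \<in> {xs. length xs = n \<and> set xs \<subseteq> Q}"
  then have xs: "length xs = n" "set xs \<subseteq> Q" by auto
  let ?P = "set xs"
  have P: "finite ?P" "?P \<noteq> {}" "card ?P \<le> n" using xs n card_length[of xs] by auto
  obtain g where g: "\<And>r. (g has_real_derivative \<gamma> r) (at r)" "g 0 = 0" using antiderivative_exists[OF \<gamma>(1)] by blast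
  have [measurable]: "\<gamma> \<in> borel_measurable borel" by (intro borel_measurable_continuous_onI \<gamma>)
  have [measurable]: "mindist ?P \<in> borel_measurable borel" by (intro borel_measurable_continuous_onI mindist_continuous P)
  have abs: "\<bar>\<gamma> r\<bar> = \<gamma> r" for r using \<gamma>(2) by simp
  have norm': "p = \<infinity> \<and> (\<forall>r. \<bar>\<gamma> r\<bar> \<le> 1) \<or> (\<exists>e. p = ereal e \<and> (\<integral>\<^sup>+x\<in>Q. ennreal (\<bar>\<gamma> (mindist ?P x)\<bar> powr e) \<partial>lborel) \<le> 1)"
    using norm unfolding abs
  proof (elim disjE exE conjE)
    fix e assume e: "p = ereal e" "\<forall>r\<ge>h. \<gamma> r = 0" and le: "of_nat n * (\<integral>\<^sup>+y\<in>icube (0::real^'d) h. ennreal (\<gamma> (infnorm y) powr e) \<partial>lborel) \<le> 1"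
    have "(\<integral>\<^sup>+x\<in>Q. ennreal (\<gamma> (mindist ?P x) powr e) \<partial>lborel)
      \<le> (\<integral>\<^sup>+x. (\<Sum>y\<in>?P. ennreal (\<gamma> (infnorm (x - y)) powr e) * indicator (icube y h) x) \<partial>lborel)"
    proof (rule nn_integral_mono)
      fix x
      obtain y where y: "y \<in> ?P" "mindist ?P x = infnorm (x - y)" by (rule mindist_attained[OF P(1,2)])
      have "ennreal (\<gamma> (mindist ?P x) powr e) * indicator Q x \<le> ennreal (\<gamma> (infnorm (x - y)) powr e) * indicator (icube y h) x"
        using y e(2) by (auto simp: icube_def indicator_def)
      also have "\<dots> \<le> (\<Sum>y\<in>?P. ennreal (\<gamma> (infnorm (x - y)) powr e) * indicator (icube y h) x)"
        using y(1) by (intro member_le_sum) auto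
      finally show "ennreal (\<gamma> (mindist ?P x) powr e) * indicator Q x \<le> (\<Sum>y\<in>?P. ennreal (\<gamma> (infnorm (x - y)) powr e) * indicator (icube y h) x)" .
    qed
    also have "\<dots> = (\<Sum>y\<in>?P. \<integral>\<^sup>+x\<in>icube y h. ennreal (\<gamma> (infnorm (x - y)) powr e) \<partial>lborel)"
      by (rule nn_integral_sum) measurable
    also have "\<dots> = (\<Sum>y\<in>?P. \<integral>\<^sup>+x\<in>icube (0::real^'d) h. ennreal (\<gamma> (infnorm x) powr e) \<partial>lborel)"
    proof (rule sum.cong[OF refl])
      fix y :: "real^'d"
      show "(\<integral>\<^sup>+x\<in>icube y h. ennreal (\<gamma> (infnorm (x - y)) powr e) \<partial>lborel) = (\<integral>\<^sup>+x\<in>icube (0::real^'d) h. ennreal (\<gamma> (infnorm x) powr e) \<partial>lborel)"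
        by (rule nn_integral_icube_translate) measurable
    qed
    also have "\<dots> \<le> of_nat n * (\<integral>\<^sup>+x\<in>icube (0::real^'d) h. ennreal (\<gamma> (infnorm x) powr e) \<partial>lborel)"
      using P(3) by (simp add: mult_right_mono)
    also note le
    finally show "p = \<infinity> \<and> (\<forall>r. \<gamma> r \<le> 1) \<or> (\<exists>e. p = ereal e \<and> (\<integral>\<^sup>+x\<in>Q. ennreal (\<gamma> (mindist ?P x) powr e) \<partial>lborel) \<le> 1)"
      using e(1) by blast
  qed blast
  let ?f = "\<lambda>x. g (mindist ?P x)"
  have L: "\<bar>\<gamma> r\<bar> \<le> L" for r using \<gamma>(3) abs by simp
  have fX: "?f \<in> sobolev_class p Q" by (rule mindist_sobolev[OF Q P(1,2) g(1) \<gamma>(1) L p norm'])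
  have "(\<lambda>x. - g (mindist ?P x)) \<in> sobolev_class p Q"
  proof (rule mindist_sobolev[OF Q P(1,2), where \<gamma> = "\<lambda>r. - \<gamma> r"])
    show "((\<lambda>x. - g x) has_real_derivative - \<gamma> r) (at r)" for r by (rule DERIV_minus[OF g(1)])
    show "\<bar>- \<gamma> r\<bar> \<le> L" for r using L[of r] by simp
    show "p = \<infinity> \<and> (\<forall>r. \<bar>- \<gamma> r\<bar> \<le> 1) \<or> (\<exists>e. p = ereal e \<and> (\<integral>\<^sup>+x\<in>Q. ennreal (\<bar>- \<gamma> (mindist ?P x)\<bar> powr e) \<partial>lborel) \<le> 1)"
      using norm' by (simp only: abs_minus_cancel)
  qed (use p \<gamma> in \<open>auto intro: continuous_on_minus\<close>)
  moreover have "?f x = 0" if "x \<in> ?P" for x using mindist_point[OF P(1,2) that] g(2) by simp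
  ultimately have "ereal (LINT x|lebesgue_on Q. ?f x) \<le> recovery_error Q (sobolev_class p Q) \<Phi> xs"
    by (rule recovery_error_lower[OF fX])
  moreover have "V \<le> (LINT x|lebesgue_on Q. ?f x)"
  proof -
    have QL: "Q \<inter> space lebesgue \<in> sets lebesgue" using Q by simp
    have mono: "g r \<le> g s" if "r \<le> s" for r s
      by (rule DERIV_nonneg_imp_nondecreasing[OF that]) (use g \<gamma> in blast)
    have f0: "0 \<le> ?f x" for x using mono[OF mindist_nonneg[OF P(1,2), of x]] g(2) by simp
    have int: "integrable (lebesgue_on Q) ?f"
      using fX by (intro Lp_integrable[OF Q p]) (simp add: sobolev_class_def sobolev_space_def)
    have "ennreal V \<le> (\<integral>\<^sup>+x\<in>Q. ennreal (?f x) \<partial>lborel)"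
      using V(2) mindist_integral_lower[OF P g \<gamma>(1,2) Q h vol] by (rule order_trans)
    also have "\<dots> = (\<integral>\<^sup>+x\<in>Q. ennreal (?f x) \<partial>lebesgue)" by (rule nn_integral_completion[symmetric])
    also have "\<dots> = (\<integral>\<^sup>+x. ennreal (?f x) \<partial>lebesgue_on Q)" by (rule nn_integral_restrict_space[OF QL, symmetric])
    also have "\<dots> = ennreal (LINT x|lebesgue_on Q. ?f x)" using f0 by (intro nn_integral_eq_integral int) auto
    finally show ?thesis using f0 by (subst (asm) ennreal_le_iff) (auto intro: integral_nonneg_AE)
  qed
  ultimately show "ereal V \<le> recovery_error Q (sobolev_class p Q) \<Phi> xs" by (meson ereal_less_eq(3) order_trans)
qed

lemma rkern_pos: "0 < d \<Longrightarrow> 0 < r \<Longrightarrow> r < R \<Longrightarrow> 0 < rkern d R r"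
proof -
  assume d: "0 < d" and r: "0 < r" "r < R"
  have "r * r ^ (d - 1) < R ^ d" using power_strict_mono[OF r(2), of d] r d
    by (metis less_imp_le mult.commute power_minus_mult)
  then have "r < R ^ d / r ^ (d - 1)" using r by (simp add: pos_less_divide_eq)
  then show ?thesis using d by (simp add: rkern_def)
qed

text \<open>Equality in Hoelder's inequality against the kernel requires a gradient proportional to
  its (q - 1)-st power. The truncated kernel k stays below the kernel off the origin and agrees with
  it between r0 and h, so the integral i of k^q over the cube is at least j.\<close>

lemma optimal_lower_truncated:
  fixes Q :: "(real^'d) set"
  assumes Q: "open Q" "bounded Q" and h: "0 < h" and n: "0 < n" and vol: "real n * (2 * h) ^ CARD('d) = measure lebesgue Q"
    and d: "2 \<le> CARD('d)" and P: "1 < P" "1 < q" "1 / P + 1 / q = 1" and r0: "0 < r0" "r0 < h"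
    and J: "(\<integral>\<^sup>+y\<in>icube (0::real^'d) h. (ennreal (kern h y powr q) * indicator {y. r0 \<le> infnorm y} y) \<partial>lborel) = ennreal j" "0 \<le> j"
  shows "ereal ((real n * j) powr (1 / q)) \<le> optimal_error Q (sobolev_class (ereal P) Q) n"
proof -
  let ?d = "CARD('d)"
  \<comment> \<open>The inner \<open>max\<close> freezes the kernel below r0, where it is unbounded;
    the outer one cuts off its negative values beyond h. Thus k is continuous, bounded, and zero
    beyond h.\<close>
  define k where "k r = max 0 (rkern ?d h (max r r0))" for r
  have k0: "0 \<le> k r" for r by (simp add: k_def)
  have qP: "(q - 1) * P = q" using P by (simp add: field_simps)
  have kle: "k r \<le> rkern ?d h r0" for r
    using rkern_antimono[of ?d h r0 "max r r0"] rkern_pos[of ?d r0 h] r0 h by (simp add: k_def)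
  have kcont: "continuous_on UNIV k"
    unfolding k_def rkern_def using r0 by (intro continuous_intros) (auto simp: max_def)
  have kzero: "k r = 0" if "h \<le> r" for r
    using rkern_nonpos[of ?d h "max r r0"] that h by (simp add: k_def)
  have kq: "k r * k r powr (q - 1) = k r powr q" for r
  proof (cases "k r = 0")
    case False
    then have "k r powr 1 * k r powr (q - 1) = k r powr q" by (simp only: powr_add[symmetric]) simp
    then show ?thesis by (simp only: powr_one[OF k0])
  qed simp
  have [measurable]: "k \<in> borel_measurable borel" by (rule borel_measurable_continuous_onI[OF kcont])
  let ?I = "\<integral>\<^sup>+y\<in>icube (0::real^'d) h. ennreal (k (infnorm y) powr q) \<partial>lborel"
  have "?I \<le> (\<integral>\<^sup>+y\<in>icube (0::real^'d) h. ennreal (rkern ?d h r0 powr q) \<partial>lborel)"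
    using kle k0 P by (intro nn_integral_mono mult_right_mono ennreal_leI powr_mono2) auto
  also have "\<dots> < \<infinity>" using h by (simp add: nn_integral_cmult_indicator emeasure_icube ennreal_mult_less_top)
  finally have "?I < \<infinity>" .
  then obtain i where i: "?I = ennreal i" "0 \<le> i" by (cases ?I) auto
  have "ennreal (rkern ?d h r0 powr q * (2 * r0) ^ ?d) = (\<integral>\<^sup>+y\<in>icube (0::real^'d) r0. ennreal (rkern ?d h r0 powr q) \<partial>lborel)"
    using r0 by (simp add: nn_integral_cmult_indicator emeasure_icube ennreal_mult)
  also have "\<dots> \<le> ?I"
  proof (rule nn_integral_mono)
    fix y :: "real^'d"
    have "k (infnorm y) = rkern ?d h r0" if "infnorm y \<le> r0"
      using that rkern_pos[of ?d r0 h] r0 by (simp add: k_def max_def)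
    then show "ennreal (rkern ?d h r0 powr q) * indicator (icube 0 r0) y \<le> ennreal (k (infnorm y) powr q) * indicator (icube 0 h) y"
      using r0 by (auto simp: icube_def indicator_def)
  qed
  finally have "rkern ?d h r0 powr q * (2 * r0) ^ ?d \<le> i" using i by (simp add: ennreal_le_iff)
  moreover have "0 < rkern ?d h r0 powr q * (2 * r0) ^ ?d" using rkern_pos[of ?d r0 h] r0 by simp
  ultimately have i0: "0 < i" by linarith
  have "ennreal j \<le> ennreal i"
    unfolding J(1)[symmetric] i(1)[symmetric]
  proof (rule nn_integral_mono)
    fix y :: "real^'d"
    have "k (infnorm y) = kern h y" if "infnorm y \<le> h" "r0 \<le> infnorm y"
      using that rkern_nonneg[of "infnorm y" h ?d] r0 by (simp add: k_def max_def)
    then show "ennreal (kern h y powr q) * indicator {y. r0 \<le> infnorm y} y * indicator (icube 0 h) y \<le> ennreal (k (infnorm y) powr q) * indicator (icube 0 h) y"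
      by (auto simp: icube_def indicator_def)
  qed
  then have ji: "j \<le> i" using i by (simp add: ennreal_le_iff)
  \<comment> \<open>Since (q - 1) P = q, this gives n c^P i = 1, the normalisation of the gradient;
    the integral of the test function is then at least n c i = (n i)^(1/q).\<close>
  define c where "c = (real n * i) powr (- 1 / P)"
  have ni: "0 < real n * i" using n i0 by simp
  have c0: "0 < c" using n i0 by (simp add: c_def)
  let ?\<gamma> = "\<lambda>r. c * k r powr (q - 1)"
  have "ereal ((real n * i) powr (1 / q)) \<le> optimal_error Q (sobolev_class (ereal P) Q) n"
  proof (rule optimal_lower_test[OF Q h n vol, where \<gamma> = ?\<gamma> and L = "c * rkern ?d h r0 powr (q - 1)"])
    show "continuous_on UNIV ?\<gamma>"
      using k0 P kcont by (intro continuous_on_mult continuous_on_const continuous_on_powr') auto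
    show "0 \<le> ?\<gamma> r" "?\<gamma> r \<le> c * rkern ?d h r0 powr (q - 1)" for r
      using c0 k0 kle P by (auto intro!: mult_left_mono powr_mono2)
    have "of_nat n * (\<integral>\<^sup>+y\<in>icube (0::real^'d) h. ennreal (?\<gamma> (infnorm y) powr P) \<partial>lborel) = 1"
    proof -
      have "?\<gamma> r powr P = c powr P * k r powr q" for r by (simp add: powr_mult powr_powr qP)
      then have "(\<integral>\<^sup>+y\<in>icube (0::real^'d) h. ennreal (?\<gamma> (infnorm y) powr P) \<partial>lborel) = (\<integral>\<^sup>+y. ennreal (c powr P) * (ennreal (k (infnorm y) powr q) * indicator (icube (0::real^'d) h) y) \<partial>lborel)"
        by (simp add: ennreal_mult mult.assoc)
      also have "\<dots> = ennreal (c powr P) * ennreal i"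
        unfolding i(1)[symmetric] by (rule nn_integral_cmult) measurable
      finally have "of_nat n * (\<integral>\<^sup>+y\<in>icube (0::real^'d) h. ennreal (?\<gamma> (infnorm y) powr P) \<partial>lborel) = ennreal (real n * (c powr P * i))"
        using i0 by (simp add: ennreal_mult ennreal_of_nat_eq_real_of_nat)
      also have "real n * (c powr P * i) = 1"
      proof -
        have "c powr P = (real n * i) powr (- 1)" using P by (simp add: c_def powr_powr)
        also have "\<dots> = 1 / (real n * i)" using ni by (simp only: powr_minus_divide powr_one less_imp_le)
        finally show ?thesis using n i0 by simp
      qed
      finally show ?thesis by simp
    qed
    then show "ereal P = \<infinity> \<and> (\<forall>r. ?\<gamma> r \<le> 1) \<or> (\<exists>e. ereal P = ereal e \<and> (\<forall>r\<ge>h. ?\<gamma> r = 0) \<and>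
        of_nat n * (\<integral>\<^sup>+y\<in>icube (0::real^'d) h. ennreal (?\<gamma> (infnorm y) powr e) \<partial>lborel) \<le> 1)"
      using kzero by (intro disjI2 exI[of _ P]) auto
    show "ennreal ((real n * i) powr (1 / q)) \<le> of_nat n * (\<integral>\<^sup>+y\<in>icube (0::real^'d) h. (ennreal (kern h y) * ennreal (?\<gamma> (infnorm y))) \<partial>lborel)"
    proof -
      have "(real n * i) powr (1 / q) = real n * (c * i)"
      proof -
        have "1 / q = - 1 / P + 1" using P by simp
        then have "(real n * i) powr (1 / q) = c * (real n * i) powr 1" unfolding c_def by (simp only: powr_add)
        then show ?thesis using ni by simp
      qed
      then have "ennreal ((real n * i) powr (1 / q)) = of_nat n * (ennreal c * ennreal i)"
        using c0 i0 by (simp add: ennreal_mult ennreal_of_nat_eq_real_of_nat)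
      also have "ennreal c * ennreal i = (\<integral>\<^sup>+y. ennreal c * (ennreal (k (infnorm y) powr q) * indicator (icube (0::real^'d) h) y) \<partial>lborel)"
        unfolding i(1)[symmetric] by (rule nn_integral_cmult[symmetric]) measurable
      also have "\<dots> \<le> (\<integral>\<^sup>+y\<in>icube (0::real^'d) h. (ennreal (kern h y) * ennreal (?\<gamma> (infnorm y))) \<partial>lborel)"
      proof (rule nn_integral_mono_AE)
        show "AE y::real^'d in lborel. ennreal c * (ennreal (k (infnorm y) powr q) * indicator (icube 0 h) y) \<le> ennreal (kern h y) * ennreal (?\<gamma> (infnorm y)) * indicator (icube 0 h) y"
          using AE_lborel_singleton[of "0::real^'d"]
        proof eventually_elim
          case (elim y)
          then have y: "0 < infnorm y" by (simp add: infnorm_pos_lt)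
          show ?case
          proof (cases "infnorm y \<le> h")
            case True
            have kk: "k (infnorm y) \<le> kern h y"
              using rkern_antimono[of ?d h "infnorm y" "max (infnorm y) r0"] rkern_nonneg[of "infnorm y" h ?d] y h True by (simp add: k_def)
            have "c * k (infnorm y) powr q = k (infnorm y) * ?\<gamma> (infnorm y)" using kq[of "infnorm y"] by simp
            also have "\<dots> \<le> kern h y * ?\<gamma> (infnorm y)" using kk c0 by (intro mult_right_mono) auto
            finally have "ennreal (c * k (infnorm y) powr q) \<le> ennreal (kern h y * ?\<gamma> (infnorm y))" by (rule ennreal_leI)
            then show ?thesis using True c0 rkern_nonneg[of "infnorm y" h ?d] y by (simp add: icube_def ennreal_mult)
          qed (simp add: icube_def)
        qed
      qed
      finally show ?thesis by (simp add: mult_left_mono)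
    qed
  qed (use P in \<open>auto simp: one_ereal_def\<close>)
  moreover have "(real n * j) powr (1 / q) \<le> (real n * i) powr (1 / q)"
    using ji J(2) P by (intro powr_mono2 mult_left_mono) auto
  ultimately show ?thesis by (meson ereal_less_eq(3) order_trans)
qed

lemma optimal_lower:
  fixes Q :: "(real^'d) set"
  assumes d: "2 \<le> CARD('d)" and q: "1 \<le> q" "(real CARD('d) - 1) * q < real CARD('d)"
    and p: "ereal (real CARD('d)) < p" "1 / p + 1 / ereal q = 1" and Q: "star_domain Q" and n: "0 < n"
  shows "ereal (sharp_bound Q q n) \<le> optimal_error Q (sobolev_class p Q) n"
proof -
  let ?h = "half_step Q n"
  have op: "open Q" "bounded Q" using Q by (auto simp: star_domain_def)
  note m = star_domain_measure_pos[OF Q]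
  note h = half_step_pos[OF m n] and vol = half_step_volume[OF m n]
  have d1: "1 \<le> real CARD('d)" using d by linarith
  let ?A = "?h powr (q + real CARD('d)) * kmass TYPE('d) q"
  have A: "0 < ?A" using h kmass_pos[OF d q] by simp
  have K: "(\<integral>\<^sup>+y\<in>icube (0::real^'d) ?h. ennreal (kern ?h y powr q) \<partial>lborel) = ennreal ?A"
    using nn_integral_kern[OF d q h, of 0] by simp
  show ?thesis
  proof (rule conjugate_cases[OF d1 p])
    assume pinf: "p = \<infinity>" and q1: "q = 1"
    have SB: "sharp_bound Q q n = real n * ?A" using A by (simp add: sharp_bound_def q1)
    show ?thesis
      unfolding SB
    \<comment> \<open>For p = \<infinity> the profile is the identity, so the extremal function is
      the distance to the nodes.\<close>
    proof (rule optimal_lower_test[OF op h n vol, where \<gamma> = "\<lambda>_. 1" and L = 1])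
      have "(\<integral>\<^sup>+y\<in>icube (0::real^'d) ?h. (ennreal (kern ?h y) * ennreal 1) \<partial>lborel) = (\<integral>\<^sup>+y\<in>icube (0::real^'d) ?h. ennreal (kern ?h y powr q) \<partial>lborel)"
        by (intro nn_integral_cong) (auto simp: q1 icube_def indicator_def rkern_nonneg infnorm_pos_le)
      then show "ennreal (real n * ?A) \<le> of_nat n * (\<integral>\<^sup>+y\<in>icube (0::real^'d) ?h. (ennreal (kern ?h y) * ennreal 1) \<partial>lborel)"
        unfolding K using A by (simp add: ennreal_mult ennreal_of_nat_eq_real_of_nat)
    qed (use pinf A in auto)
  next
    fix P assume P: "p = ereal P" "real CARD('d) < P" "1 < q" "1 / P + 1 / q = 1"
    have P1: "1 < P" using P d1 by linarith
    \<comment> \<open>The offset 2 keeps the truncation radius strictly below h already for k = 0.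
      The limit k \<rightarrow> \<infinity> is taken for fixed n, by monotone convergence.\<close>
    let ?r = "\<lambda>k. ?h / real (k + 2)"
    let ?F = "\<lambda>k (y::real^'d). ennreal (kern ?h y powr q) * indicator {y. ?r k \<le> infnorm y} y * indicator (icube 0 ?h) y"
    have r: "0 < ?r k" "?r k < ?h" for k using h by (auto simp: field_simps intro: add_pos_nonneg)
    have lim: "(\<lambda>k. \<integral>\<^sup>+y. ?F k y \<partial>lborel) \<longlonglongrightarrow> ennreal ?A"
      unfolding K[symmetric]
    proof (rule nn_integral_LIMSEQ)
      show "incseq ?F"
      proof (rule incseq_SucI, rule le_funI)
        fix k and y :: "real^'d"
        have "?r (Suc k) \<le> ?r k" using h by (intro divide_left_mono) auto
        then show "?F k y \<le> ?F (Suc k) y" by (auto simp: indicator_def)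
      qed
      fix y :: "real^'d"
      show "(\<lambda>k. ?F k y) \<longlonglongrightarrow> ennreal (kern ?h y powr q) * indicator (icube 0 ?h) y"
      proof (cases "y = 0")
        case True
        then have "kern ?h y = 0" using d by (simp add: rkern_def infnorm_0)
        then show ?thesis by simp
      next
        case False
        then have y: "0 < infnorm y" by (simp add: infnorm_pos_lt)
        have "?r \<longlonglongrightarrow> 0"
          using LIMSEQ_ignore_initial_segment[OF lim_const_over_n[of ?h], of 2] by simp
        then have "\<forall>\<^sub>F k in sequentially. ?r k < infnorm y" by (rule order_tendstoD(2)) (rule y)
        then have "\<forall>\<^sub>F k in sequentially. ?F k y = ennreal (kern ?h y powr q) * indicator (icube 0 ?h) y"
          by eventually_elim (simp add: indicator_def)
        then show ?thesis by (rule tendsto_eventually)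
      qed
    qed measurable
    have le: "(\<integral>\<^sup>+y. ?F k y \<partial>lborel) \<le> ennreal ?A" for k
      unfolding K[symmetric] by (intro nn_integral_mono) (auto simp: indicator_def)
    define j where "j k = enn2real (\<integral>\<^sup>+y. ?F k y \<partial>lborel)" for k
    have j: "(\<integral>\<^sup>+y. ?F k y \<partial>lborel) = ennreal (j k)" "0 \<le> j k" for k
      unfolding j_def using le_less_trans[OF le[of k] ennreal_less_top] by (auto simp: less_top)
    have "j \<longlonglongrightarrow> ?A" using lim unfolding j(1) by (subst (asm) tendsto_ennreal_iff) (use j(2) A in auto)
    then have "(\<lambda>k. (real n * j k) powr (1 / q)) \<longlonglongrightarrow> (real n * ?A) powr (1 / q)"
      using n A by (intro tendsto_powr tendsto_mult tendsto_const) auto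
    then have "(\<lambda>k. ereal ((real n * j k) powr (1 / q))) \<longlonglongrightarrow> ereal (sharp_bound Q q n)"
      unfolding sharp_bound_def by simp
    then show ?thesis
    proof (rule LIMSEQ_le_const2, intro exI[of _ 0] allI impI)
      fix k
      show "ereal ((real n * j k) powr (1 / q)) \<le> optimal_error Q (sobolev_class p Q) n"
        unfolding P(1) by (rule optimal_lower_truncated[OF op h n vol d P1 P(3,4) r j])
    qed
  qed
qed

section \<open>The constant of the theorem\<close>

lemma sharp_bound_pos:
  fixes Q :: "(real^'d) set"
  assumes d: "2 \<le> CARD('d)" and q: "1 \<le> q" "(real CARD('d) - 1) * q < real CARD('d)" and Q: "star_domain Q" and n: "0 < n"
  shows "0 < sharp_bound Q q n"
  using half_step_pos[OF star_domain_measure_pos[OF Q] n] kmass_pos[OF d q] n by (simp add: sharp_bound_def)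

text \<open>The function under the norm is d times the kernel of radius 1, so the factor 1 / d in
  front cancels.\<close>

lemma Lp_norm_kernel:
  assumes d: "2 \<le> CARD('d::finite)" and q: "1 \<le> q" "(real CARD('d) - 1) * q < real CARD('d)"
  shows "1 / real CARD('d) * Lp_norm (ereal q) {x::real^'d. infnorm x \<le> 1} (\<lambda>x. 1 / infnorm x ^ (CARD('d) - 1) - infnorm x)
    = kmass TYPE('d) q powr (1 / q)"
proof -
  let ?C = "{x::real^'d. infnorm x \<le> 1}" and ?k = "\<lambda>x::real^'d. 1 / infnorm x ^ (CARD('d) - 1) - infnorm x"
  have C: "?C = icube 0 1" by (simp add: icube_def)
  have CL: "?C \<inter> space lebesgue \<in> sets lebesgue" unfolding C by simp
  have k: "?k x = real CARD('d) * kern 1 x" for x using d by (simp add: rkern_def)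
  have m: "(\<lambda>x. \<bar>?k x\<bar> powr q) \<in> borel_measurable (lebesgue_on ?C)"
    by (intro measurable_restrict_space1 measurable_completion) measurable
  have "(\<integral>\<^sup>+x. ennreal (\<bar>?k x\<bar> powr q) \<partial>lebesgue_on ?C) = (\<integral>\<^sup>+x\<in>?C. ennreal (\<bar>?k x\<bar> powr q) \<partial>lebesgue)"
    by (rule nn_integral_restrict_space[OF CL])
  also have "\<dots> = (\<integral>\<^sup>+x\<in>?C. ennreal (\<bar>?k x\<bar> powr q) \<partial>lborel)" by (rule nn_integral_completion)
  also have "\<dots> = (\<integral>\<^sup>+x. ennreal (real CARD('d) powr q) * (ennreal (kern 1 x powr q) * indicator (icube (0::real^'d) 1) x) \<partial>lborel)"
  proof (rule nn_integral_cong)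
    fix x :: "real^'d"
    have "\<bar>?k x\<bar> powr q = real CARD('d) powr q * kern 1 x powr q" if "infnorm x \<le> 1"
      unfolding k using that by (simp add: abs_mult rkern_nonneg infnorm_pos_le powr_mult)
    then show "ennreal (\<bar>?k x\<bar> powr q) * indicator ?C x = ennreal (real CARD('d) powr q) * (ennreal (kern 1 x powr q) * indicator (icube 0 1) x)"
      by (auto simp: icube_def indicator_def ennreal_mult)
  qed
  also have "\<dots> = ennreal (real CARD('d) powr q) * ennreal (kmass TYPE('d) q)"
    unfolding nn_integral_kern_unit[OF d q, symmetric] by (rule nn_integral_cmult) measurable
  also have "\<dots> = ennreal (real CARD('d) powr q * kmass TYPE('d) q)"
    using kmass_pos[OF d q] by (simp add: ennreal_mult)
  finally have "(LINT x|lebesgue_on ?C. \<bar>?k x\<bar> powr q) = real CARD('d) powr q * kmass TYPE('d) q"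
    using kmass_pos[OF d q] by (subst integral_eq_nn_integral[OF m]) auto
  then have "Lp_norm (ereal q) ?C ?k = (real CARD('d) powr q * kmass TYPE('d) q) powr (1 / q)"
    by (simp add: Lp_norm_def)
  also have "\<dots> = real CARD('d) * kmass TYPE('d) q powr (1 / q)"
    using q by (simp add: powr_mult powr_powr)
  finally show ?thesis by simp
qed

text \<open>With h = (meas Q / (2^d n))^(1/d) the power h^(q+d) under the q-th root has total
  exponent 1/d + 1/q. The factor n^(1/q) in front cancels part of it and leaves n^(-1/d).\<close>

lemma sharp_bound_formula:
  fixes Q :: "(real^'d) set"
  assumes d: "2 \<le> CARD('d)" and q: "1 \<le> q" "(real CARD('d) - 1) * q < real CARD('d)" and Q: "star_domain Q" and n: "0 < n"
  shows "1 / real CARD('d) * Lp_norm (ereal q) {x::real^'d. infnorm x \<le> 1} (\<lambda>x. 1 / infnorm x ^ (CARD('d) - 1) - infnorm x)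
      * (measure lebesgue Q / 2 ^ CARD('d)) powr (1 / real CARD('d) + 1 / q) / real n powr (1 / real CARD('d)) = sharp_bound Q q n"
proof -
  let ?d = "real CARD('d)" and ?w = "measure lebesgue Q / 2 ^ CARD('d)"
  note m = star_domain_measure_pos[OF Q]
  have d0: "0 < ?d" using d by simp
  have w: "0 < ?w" using m by simp
  have h: "half_step Q n = (?w / real n) powr (1 / ?d)"
  proof -
    have "(2 ^ CARD('d)) powr (1 / ?d) = (2::real)"
      using d0 by (simp add: powr_realpow[symmetric] powr_powr)
    then have "half_step Q n = (measure lebesgue Q / real n) powr (1 / ?d) / (2 ^ CARD('d)) powr (1 / ?d)"
      by (simp add: half_step_def)
    also have "\<dots> = ((measure lebesgue Q / real n) / 2 ^ CARD('d)) powr (1 / ?d)"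
      by (rule powr_divide[symmetric])
    finally show ?thesis by (simp add: mult.commute)
  qed
  have e: "(1 / ?d * (q + ?d)) * (1 / q) = 1 / ?d + 1 / q" using d0 q by (simp add: field_simps)
  have "sharp_bound Q q n = real n powr (1 / q) * ((half_step Q n powr (q + ?d)) powr (1 / q) * kmass TYPE('d) q powr (1 / q))"
    unfolding sharp_bound_def by (simp only: powr_mult)
  also have "(half_step Q n powr (q + ?d)) powr (1 / q) = (?w / real n) powr (1 / ?d + 1 / q)"
    unfolding h by (simp only: powr_powr e)
  also have "\<dots> = ?w powr (1 / ?d + 1 / q) / real n powr (1 / ?d + 1 / q)" by (rule powr_divide)
  also have "real n powr (1 / ?d + 1 / q) = real n powr (1 / ?d) * real n powr (1 / q)" by (rule powr_add)
  finally show ?thesis unfolding Lp_norm_kernel[OF d q] using n by simp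
qed

theorem theorem1:
  fixes Q :: "(real^'d) set" and p :: ereal and p' :: real
  assumes "2 \<le> CARD('d)"
    and "ereal (real CARD('d)) < p"
    and "1 / p + 1 / ereal p' = 1"
    and "star_domain Q"
  shows
    "(\<exists>\<epsilon>::nat \<Rightarrow> real. \<epsilon> \<longlonglongrightarrow> 0 \<and>
       (\<forall>\<^sub>F n in sequentially.
          optimal_error Q (sobolev_class p Q) n =
          ereal (1 / real CARD('d)
              * Lp_norm (ereal p') {x::real^'d. infnorm x \<le> 1}
                  (\<lambda>x. 1 / infnorm x ^ (CARD('d) - 1) - infnorm x)
              * (measure lebesgue Q / 2 ^ CARD('d)) powr (1 / real CARD('d) + 1 / p')
              * (1 + \<epsilon> n) / real n powr (1 / real CARD('d)))))
     \<and>
     (\<forall>(xs :: nat \<Rightarrow> (real^'d) list) (W :: nat \<Rightarrow> nat \<Rightarrow> (real^'d) set).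
       (\<forall>\<^sub>F n in sequentially.
          distinct (xs n) \<and> is_S Q n (set (xs n)) \<and> completed_voronoi Q n (xs n) (W n)) \<longrightarrow>
       (\<lambda>n. optimal_error Q (sobolev_class p Q) n /
            recovery_error Q (sobolev_class p Q) (weighted_sum (W n)) (xs n)) \<longlonglongrightarrow> 1)"
proof -
  note d = assms(1) and p = assms(2,3) and Q = assms(4)
  have d1: "1 \<le> real CARD('d)" using d by linarith
  have q: "1 \<le> p'" "(real CARD('d) - 1) * p' < real CARD('d)"
  proof -
    have "1 \<le> p' \<and> (real CARD('d) - 1) * p' < real CARD('d)"
    proof (rule conjugate_cases[OF d1 p])
      fix P assume P: "p = ereal P" "real CARD('d) < P" "1 < p'" "1 / P + 1 / p' = 1"
      \<comment> \<open>This rewrites as p' (P - 1) = P, and P (d - 1) < d (P - 1) is P > d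
        rearranged; dividing by P - 1 gives the condition on p'.\<close>
      have "P * p' = P + p'" using P d1 by (simp add: field_simps)
      then have "p' * (P - 1) = P" by (simp add: algebra_simps)
      moreover have "P * (real CARD('d) - 1) < real CARD('d) * (P - 1)" using P(2) by (simp add: algebra_simps)
      ultimately have "((real CARD('d) - 1) * p') * (P - 1) < real CARD('d) * (P - 1)" 
      proof -
        assume e: "p' * (P - 1) = P" and l: "P * (real CARD('d) - 1) < real CARD('d) * (P - 1)"
        have "((real CARD('d) - 1) * p') * (P - 1) = (p' * (P - 1)) * (real CARD('d) - 1)" by (simp only: mult_ac)
        also have "\<dots> = P * (real CARD('d) - 1)" by (simp only: e)
        finally show ?thesis using l by (simp only:)
      qed
      then show ?thesis using P d1 by (simp add: mult_less_cancel_right)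
    qed simp
    then show "1 \<le> p'" "(real CARD('d) - 1) * p' < real CARD('d)" by auto
  qed
  let ?E = "\<lambda>n. optimal_error Q (sobolev_class p Q) n" and ?s = "\<lambda>n. sharp_bound Q p' n"
  note lower = optimal_lower[OF d q p Q] and upper = optimal_upper[OF d q p Q] and pos = sharp_bound_pos[OF d q Q]
  \<comment> \<open>\<open>real_of_ereal\<close> gives the true value only when the error is finite,
    which both bounds ensure for large n.\<close>
  define \<epsilon> where "\<epsilon> n = real_of_ereal (?E n) / ?s n - 1" for n
  have fin: "\<forall>\<^sub>F n in sequentially. ?E n = ereal (?s n * (1 + \<epsilon> n))"
    using upper[OF zero_less_one] eventually_gt_at_top[of 0]
  proof eventually_elim
    case (elim n)
    obtain x where "?E n = ereal x" using elim(1) lower[OF elim(2)] by (cases "?E n") auto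
    then show ?case using pos[OF elim(2)] by (simp add: \<epsilon>_def)
  qed
  have "\<epsilon> \<longlonglongrightarrow> 0"
  proof (rule tendstoI)
    fix e :: real assume e: "0 < e"
    have "\<forall>\<^sub>F n in sequentially. ?E n \<le> ereal ((1 + e / 2) * ?s n)" using e by (intro upper) simp
    then show "\<forall>\<^sub>F n in sequentially. dist (\<epsilon> n) 0 < e"
      using fin eventually_gt_at_top[of 0]
    proof eventually_elim
      case (elim n)
      note s = pos[OF elim(3)]
      have "?s n * 1 \<le> ?s n * (1 + \<epsilon> n)" using lower[OF elim(3)] elim(2) by simp
      moreover have "?s n * (1 + \<epsilon> n) \<le> ?s n * (1 + e / 2)" using elim(1,2) by (simp add: mult.commute)
      ultimately show ?case using s e by (simp only: mult_le_cancel_left_pos) (simp add: dist_real_def)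
    qed
  qed
  moreover have "\<forall>\<^sub>F n in sequentially. ?E n = ereal (1 / real CARD('d)
              * Lp_norm (ereal p') {x::real^'d. infnorm x \<le> 1}
                  (\<lambda>x. 1 / infnorm x ^ (CARD('d) - 1) - infnorm x)
              * (measure lebesgue Q / 2 ^ CARD('d)) powr (1 / real CARD('d) + 1 / p')
              * (1 + \<epsilon> n) / real n powr (1 / real CARD('d)))"
    using fin eventually_gt_at_top[of 0]
  proof eventually_elim
    case (elim n)
    show ?case unfolding elim(1) sharp_bound_formula[OF d q Q elim(2), symmetric] by simp
  qed
  moreover have "(\<lambda>n. ?E n / recovery_error Q (sobolev_class p Q) (weighted_sum (W n)) (xs n)) \<longlonglongrightarrow> 1"
    if ev: "\<forall>\<^sub>F n in sequentially. distinct (xs n) \<and> is_S Q n (set (xs n)) \<and> completed_voronoi Q n (xs n) (W n)"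
    for xs :: "nat \<Rightarrow> (real^'d) list" and W :: "nat \<Rightarrow> nat \<Rightarrow> (real^'d) set"
  proof -
    let ?R = "\<lambda>n. recovery_error Q (sobolev_class p Q) (weighted_sum (W n)) (xs n)"
    define \<rho> where "\<rho> n = real_of_ereal (?R n) / ?s n" for n
    \<comment> \<open>The method uses at most n nodes, so its error is at least the optimal one.
      Hence it is squeezed between the sharp bound and (1 + \<delta>) times the sharp bound, like
      the optimal error.\<close>
    have ER: "\<forall>\<^sub>F n in sequentially. ?E n \<le> ?R n"
      using ev eventually_few_bad[OF Q] eventually_gt_at_top[of 0]
    proof eventually_elim
      case (elim n)
      interpret node_set Q n "set (xs n)" "half_step Q n"
        by (rule node_setI[OF Q elim(3,2)]) (use elim in auto)
      show ?case using S_card S_sub assms(4) elim distinct_card[of "xs n"]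
        by (intro optimal_le_recovery) (auto simp: star_domain_def)
    qed
    have RU: "\<forall>\<^sub>F n in sequentially. ?R n \<le> ereal ((1 + \<delta>) * ?s n)" if "0 < \<delta>" for \<delta>
      using recovery_upper[OF d q p Q that] ev by eventually_elim blast
    have Rfin: "\<forall>\<^sub>F n in sequentially. ?R n = ereal (?s n * \<rho> n)"
      using RU[OF zero_less_one] ER eventually_gt_at_top[of 0]
    proof eventually_elim
      case (elim n)
      have "ereal (?s n) \<le> ?R n" using lower[OF elim(3)] elim(2) by (rule order_trans)
      then obtain x where "?R n = ereal x" using elim(1) by (cases "?R n") auto
      then show ?case using pos[OF elim(3)] by (simp add: \<rho>_def)
    qed
    have "\<rho> \<longlonglongrightarrow> 1"
    proof (rule tendstoI)
      fix e :: real assume e: "0 < e"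
      have "\<forall>\<^sub>F n in sequentially. ?R n \<le> ereal ((1 + e / 2) * ?s n)" using e by (intro RU) simp
      then show "\<forall>\<^sub>F n in sequentially. dist (\<rho> n) 1 < e"
        using Rfin ER eventually_gt_at_top[of 0]
      proof eventually_elim
        case (elim n)
        note s = pos[OF elim(4)]
        have "ereal (?s n) \<le> ?R n" using lower[OF elim(4)] elim(3) by (rule order_trans)
        then have "?s n * 1 \<le> ?s n * \<rho> n" using elim(2) by simp
        moreover have "?s n * \<rho> n \<le> ?s n * (1 + e / 2)" using elim(1,2) by (simp add: mult.commute)
        ultimately show ?case using s e by (simp only: mult_le_cancel_left_pos) (simp add: dist_real_def)
      qed
    qed
    then have "(\<lambda>n. (1 + \<epsilon> n) / \<rho> n) \<longlonglongrightarrow> (1 + 0) / 1"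
      using \<open>\<epsilon> \<longlonglongrightarrow> 0\<close> by (intro tendsto_divide tendsto_add tendsto_const) auto
    then have "(\<lambda>n. ereal ((1 + \<epsilon> n) / \<rho> n)) \<longlonglongrightarrow> 1" by (simp add: one_ereal_def)
    moreover have "\<forall>\<^sub>F n in sequentially. ereal ((1 + \<epsilon> n) / \<rho> n) = ?E n / ?R n"
      using fin Rfin eventually_gt_at_top[of 0] order_tendstoD(1)[OF \<open>\<rho> \<longlonglongrightarrow> 1\<close> zero_less_one]
    proof eventually_elim
      case (elim n)
      have "?s n * \<rho> n \<noteq> 0" using pos[OF elim(3)] elim(4) by simp
      then show ?case unfolding elim(1,2) using pos[OF elim(3)] elim(4) by simp
    qed
    ultimately show ?thesis by (rule Lim_transform_eventually)
  qed
  ultimately show ?thesis by blast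
qed

end
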